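(* Let $n\ge2$, $r\ge0$. Fix any total order on $\mathcal L^+$ and any total order on $\mathcal L^-$, and take products with respect to these orders. Then the set $$\Big\{\prod_{(i,j)\in\mathcal L^+}\big(E^\triangle_{i,j}[0,r]\big)^{a_{i,j}}\,[\mathrm{diag}(\boldsymbol\sigma(A))]_1\prod_{(i,j)\in\mathcal L^-}\big(E^\triangle_{i,j}[0,r]\big)^{a_{i,j}}\ \Big|\ A\in\Theta_\triangle(n,r)\Big\}$$ is a $\mathbb Q$-basis of the affine Schur algebra $\mathcal S_\triangle(n,r)_{\mathbb Q}$.
   Context: $\mathbb N=\{0,1,2,\dots\}$. $\mathbb N_\triangle^n$ is the set of sequences $\lambda=(\lambda_i)_{i\in\mathbb Z}$ in $\mathbb N$ with $\lambda_i=\lambda_{i+n}$; $\Lambda_\triangle(n,r)=\{\lambda\in\mathbb N_\triangle^n:\sum_{i=1}^n\lambda_i=r\}$. $\Theta_\triangle(n)$ is the set of matrices $A=(a_{i,j})_{i,j\in\mathbb Z}$ with $a_{i,j}\in\mathbb N$, $a_{i,j}=a_{i+n,j+n}$, and finitely many nonzero entries in each row; $\sigma(A)=\sum_{1\le i\le n,\,j\in\mathbb Z}a_{i,j}$; $\Theta_\triangle(n,r)=\{A\in\Theta_\triangle(n):\sigma(A)=r\}$. $E^\triangle_{i,j}$ is the $\mathbb Z\times\mathbb Z$ matrix with entry $1$ at positions $(i+sn,j+sn)$, $s\in\mathbb Z$, and $0$ elsewhere. Affine Schur algebra: for a finite field $k$ with $q$ elements let $V$ be a free $k[\epsilon,\epsilon^{-1}]$-module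 of rank $r$; a lattice is a finitely generated $k[\epsilon]$-submodule $L$ with $k[\epsilon,\epsilon^{-1}]L=V$. Let $\mathcal F$ be the set of families $(L_i)_{i\in\mathbb Z}$ of lattices with $L_{i-1}\subseteq L_i$, $L_{i-n}=\epsilon L_i$. The orbits of $\mathrm{Aut}_{k[\epsilon,\epsilon^{-1}]}(V)$ on $\mathcal F\times\mathcal F$ are indexed by $\Theta_\triangle(n,r)$: $(L,L')\in\mathcal O_A$ iff $a_{i,j}=\dim_k\frac{L_i\cap L'_j}{(L_{i-1}\cap L'_j)+(L_i\cap L'_{j-1})}$ for all $i,j$. For $A,B,C\in\Theta_\triangle(n,r)$ there is a polynomial $g_{A,B,C}\in\mathbb Z[x]$ with $g_{A,B,C}(q)=\#\{L'\in\mathcal F:(L,L')\in\mathcal O_A,(L',L'')\in\mathcal O_B\}$ for every finite field with $q$ elements and every $(L,L'')\in\mathcal O_C$. $\mathcal S_\triangle(n,r)_{\mathbb Q}$ is the $\mathbb Q$-algebra with basis $\{[A]_1:A\in\Theta_\triangle(n,r)\}$ and product $[A]_1[B]_1=\sum_C g_{A,B,C}(1)[C]_1$ (the specialization at $v=1$ of Lusztig's affine quantum Schur algebra). For $i\ne j$, $E^\triangle_{i,j}[0,r]=\sum_{\lambda\in\Lambda_\triangle(n,r-1)}[E^\triangle_{i,j}+\mathrm{diag}(\lambda)]_1$ (zero if $r=0$). $\mathcal L^+=\{(i,j):1\le i\le n,\ j\in\mathbb Z,\ i<j\}$, $\mathcal L^-=\{(i,j):1\le i\le n,\ j\in\mathbb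 Z,\ i>j\}$. For $A\in\Theta_\triangle(n,r)$, $\boldsymbol\sigma(A)=(\sigma_i(A))_{i\in\mathbb Z}\in\Lambda_\triangle(n,r)$ with $\sigma_i(A)=a_{i,i}+\sum_{j<i}(a_{i,j}+a_{j,i})$. *)

theory Defs
  imports
    "HOL-Algebra.AbelCoset"
    "HOL-Algebra.Module"
    "HOL-Computational_Algebra.Polynomial"
    "HOL-Library.Poly_Mapping"
begin

section \<open>Periodic sequences and matrices\<close>

type_synonym zmat = "int \<Rightarrow> int \<Rightarrow> nat"

definition aff_comps :: "nat \<Rightarrow> nat \<Rightarrow> (int \<Rightarrow> nat) set" where
  "aff_comps n r = {l. (\<forall>i. l (i + int n) = l i) \<and> (\<Sum>i=1..int n. l i) = r}"

definition Theta :: "nat \<Rightarrow> zmat set" where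
  "Theta n = {A. (\<forall>i j. A (i + int n) (j + int n) = A i j) \<and> (\<forall>i. finite {j. A i j \<noteq> 0})}"

definition mat_sigma :: "nat \<Rightarrow> zmat \<Rightarrow> nat" where
  "mat_sigma n A = (\<Sum>i=1..int n. \<Sum>j | A i j \<noteq> 0. A i j)"

definition Theta_r :: "nat \<Rightarrow> nat \<Rightarrow> zmat set" where
  "Theta_r n r = {A \<in> Theta n. mat_sigma n A = r}"

definition E_mat :: "nat \<Rightarrow> int \<Rightarrow> int \<Rightarrow> zmat" where
  "E_mat n i j = (\<lambda>k l. if \<exists>s. k = i + s * int n \<and> l = j + s * int n then 1 else 0)"

definition diag_mat :: "(int \<Rightarrow> nat) \<Rightarrow> zmat" where
  "diag_mat l = (\<lambda>i j. if i = j then l i else 0)"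

definition mat_add :: "zmat \<Rightarrow> zmat \<Rightarrow> zmat" where
  "mat_add A B = (\<lambda>i j. A i j + B i j)"

text \<open>For a matrix in \<open>Theta n\<close> rows and (by periodicity) columns have finite support, so the
  index set below is finite.\<close>
definition bsigma :: "zmat \<Rightarrow> int \<Rightarrow> nat" where
  "bsigma A i = A i i + (\<Sum>j | j < i \<and> A i j + A j i \<noteq> 0. A i j + A j i)"

section \<open>Lattices in a free module over the Laurent polynomials\<close>

text \<open>The ring of Laurent polynomials over \<open>K\<close>: \<open>f m\<close> is the coefficient of the \<open>m\<close>-th power of
  the indeterminate.\<close>
definition laurent :: "('a, 'b) ring_scheme \<Rightarrow> (int \<Rightarrow> 'a) ring" where
  "laurent K = \<lparr>
     carrier = {f. (\<forall>m. f m \<in> carrier K) \<and> finite {m. f m \<noteq> \<zero>\<^bsub>K\<^esub>}},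
     monoid.mult = (\<lambda>f g m. \<Oplus>\<^bsub>K\<^esub>i\<in>{i. f i \<noteq> \<zero>\<^bsub>K\<^esub>}. f i \<otimes>\<^bsub>K\<^esub> g (m - i)),
     monoid.one = (\<lambda>m. if m = 0 then \<one>\<^bsub>K\<^esub> else \<zero>\<^bsub>K\<^esub>),
     ring.zero = (\<lambda>m. \<zero>\<^bsub>K\<^esub>),
     ring.add = (\<lambda>f g m. f m \<oplus>\<^bsub>K\<^esub> g m)\<rparr>"

definition laurent_monom :: "('a, 'b) ring_scheme \<Rightarrow> 'a \<Rightarrow> int \<Rightarrow> int \<Rightarrow> 'a" where
  "laurent_monom K c d = (\<lambda>m. if m = d then c else \<zero>\<^bsub>K\<^esub>)"

abbreviation laurent_eps :: "('a, 'b) ring_scheme \<Rightarrow> int \<Rightarrow> 'a" where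
  "laurent_eps K \<equiv> laurent_monom K \<one>\<^bsub>K\<^esub> 1"

text \<open>The polynomials, as a subring of the Laurent polynomials.\<close>
definition laurent_poly :: "('a, 'b) ring_scheme \<Rightarrow> (int \<Rightarrow> 'a) ring" where
  "laurent_poly K = (laurent K)\<lparr>carrier := {f \<in> carrier (laurent K). \<forall>m<0. f m = \<zero>\<^bsub>K\<^esub>}\<rparr>"

text \<open>The standard free module of rank \<open>r\<close>. The record type of modules extends that of rings; the
  fields \<open>mult\<close> and \<open>one\<close> play no role.\<close>
definition free_module :: "('a, 'b) ring_scheme \<Rightarrow> nat \<Rightarrow> ('a, nat \<Rightarrow> 'a) module" where
  "free_module R r = \<lparr>
     carrier = {..<r} \<rightarrow>\<^sub>E carrier R,
     monoid.mult = undefined,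
     monoid.one = undefined,
     ring.zero = (\<lambda>t\<in>{..<r}. \<zero>\<^bsub>R\<^esub>),
     ring.add = (\<lambda>v w. \<lambda>t\<in>{..<r}. v t \<oplus>\<^bsub>R\<^esub> w t),
     module.smult = (\<lambda>c v. \<lambda>t\<in>{..<r}. c \<otimes>\<^bsub>R\<^esub> v t)\<rparr>"

definition gen_submodule ::
    "('a, 'b) ring_scheme \<Rightarrow> ('a, 'c, 'd) module_scheme \<Rightarrow> 'c set \<Rightarrow> 'c set" where
  "gen_submodule R M S = \<Inter>{H. submodule H R M \<and> S \<subseteq> H}"

abbreviation lat_space :: "('a, 'b) ring_scheme \<Rightarrow> nat \<Rightarrow> (int \<Rightarrow> 'a, nat \<Rightarrow> int \<Rightarrow> 'a) module" where
  "lat_space K r \<equiv> free_module (laurent K) r"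

definition lattice_in :: "('a, 'b) ring_scheme \<Rightarrow> nat \<Rightarrow> (nat \<Rightarrow> int \<Rightarrow> 'a) set \<Rightarrow> bool" where
  "lattice_in K r L \<longleftrightarrow>
     submodule L (laurent_poly K) (lat_space K r) \<and>
     (\<exists>S. finite S \<and> S \<subseteq> carrier (lat_space K r) \<and>
          L = gen_submodule (laurent_poly K) (lat_space K r) S) \<and>
     gen_submodule (laurent K) (lat_space K r) L = carrier (lat_space K r)"

definition flags :: "nat \<Rightarrow> ('a, 'b) ring_scheme \<Rightarrow> nat \<Rightarrow> (int \<Rightarrow> (nat \<Rightarrow> int \<Rightarrow> 'a) set) set" where
  "flags n K r = {L. (\<forall>i. lattice_in K r (L i)) \<and> (\<forall>i. L (i - 1) \<subseteq> L i) \<and>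
     (\<forall>i. L (i - int n) = (\<lambda>v. laurent_eps K \<odot>\<^bsub>lat_space K r\<^esub> v) ` L i)}"

text \<open>\<open>quot_dim K r U W d\<close>: for \<open>K\<close>-subspaces \<open>W \<subseteq> U\<close> of the free module, the quotient \<open>U / W\<close>
  has dimension \<open>d\<close>, i.e. there are \<open>d\<close> elements of \<open>U\<close> whose classes modulo \<open>W\<close> form a basis
  of \<open>U / W\<close>. Scalars act through the constant Laurent polynomials.\<close>
definition quot_dim :: "('a, 'b) ring_scheme \<Rightarrow> nat \<Rightarrow> (nat \<Rightarrow> int \<Rightarrow> 'a) set \<Rightarrow>
    (nat \<Rightarrow> int \<Rightarrow> 'a) set \<Rightarrow> nat \<Rightarrow> bool" where
  "quot_dim K r U W d \<longleftrightarrow> (\<exists>B. finite B \<and> B \<subseteq> U \<and> card B = d \<and>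
     (\<forall>u\<in>U. \<exists>!c. c \<in> B \<rightarrow>\<^sub>E carrier K \<and>
        u \<ominus>\<^bsub>lat_space K r\<^esub> (\<Oplus>\<^bsub>lat_space K r\<^esub>b\<in>B. laurent_monom K (c b) 0 \<odot>\<^bsub>lat_space K r\<^esub> b) \<in> W))"

definition flag_orbit :: "nat \<Rightarrow> ('a, 'b) ring_scheme \<Rightarrow> nat \<Rightarrow> zmat \<Rightarrow>
    ((int \<Rightarrow> (nat \<Rightarrow> int \<Rightarrow> 'a) set) \<times> (int \<Rightarrow> (nat \<Rightarrow> int \<Rightarrow> 'a) set)) set" where
  "flag_orbit n K r A = {(L, L'). L \<in> flags n K r \<and> L' \<in> flags n K r \<and>
     (\<forall>i j. quot_dim K r (L i \<inter> L' j)
        ((L (i - 1) \<inter> L' j) <+>\<^bsub>lat_space K r\<^esub> (L i \<inter> L' (j - 1))) (A i j))}"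

section \<open>The affine Schur algebra at $v = 1$\<close>

text \<open>Every finite field is isomorphic to one whose carrier is a set of natural numbers, so the
  quantification over \<open>K\<close> covers all finite fields. For matrices in \<open>Theta_r n r\<close> such a polynomial
  exists, and it is unique because the orbit of \<open>C\<close> is nonempty over every finite field.\<close>
definition struct_poly :: "nat \<Rightarrow> nat \<Rightarrow> zmat \<Rightarrow> zmat \<Rightarrow> zmat \<Rightarrow> int poly" where
  "struct_poly n r A B C = (THE p. \<forall>K :: nat ring. field K \<and> finite (carrier K) \<longrightarrow>
     (\<forall>L L''. (L, L'') \<in> flag_orbit n K r C \<longrightarrow>
        poly p (int (card (carrier K))) =
        int (card {L' \<in> flags n K r. (L, L') \<in> flag_orbit n K r A \<and> (L', L'') \<in> flag_orbit n K r B})))"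

abbreviation basis_elt :: "zmat \<Rightarrow> zmat \<Rightarrow>\<^sub>0 rat" where
  "basis_elt A \<equiv> Poly_Mapping.single A 1"

text \<open>For fixed \<open>A\<close> and \<open>B\<close> only finitely many \<open>C\<close> have a nonzero structure constant.\<close>
definition basis_mult :: "nat \<Rightarrow> nat \<Rightarrow> zmat \<Rightarrow> zmat \<Rightarrow> zmat \<Rightarrow>\<^sub>0 rat" where
  "basis_mult n r A B = (\<Sum>C | C \<in> Theta_r n r \<and> poly (struct_poly n r A B C) 1 \<noteq> 0.
     Poly_Mapping.single C (of_int (poly (struct_poly n r A B C) 1)))"

definition rat_scale :: "rat \<Rightarrow> ('a \<Rightarrow>\<^sub>0 rat) \<Rightarrow> 'a \<Rightarrow>\<^sub>0 rat" where
  "rat_scale c x = Poly_Mapping.map ((*) c) x"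

lemma lookup_rat_scale:
  "Poly_Mapping.lookup (rat_scale c x) k = c * Poly_Mapping.lookup x k"
  by (simp add: rat_scale_def Poly_Mapping.map.rep_eq when_def)

interpretation rat_vs: vector_space "rat_scale :: rat \<Rightarrow> ('a \<Rightarrow>\<^sub>0 rat) \<Rightarrow> 'a \<Rightarrow>\<^sub>0 rat"
  by unfold_locales
    (auto intro!: poly_mapping_eqI simp: lookup_rat_scale lookup_add algebra_simps)

text \<open>The identity element is the sum of the basis elements of the diagonal matrices, which are the
  orbits \<open>{(L, L) | dim (L i / L (i - 1)) = l i for all i}\<close>.\<close>
definition affine_schur :: "nat \<Rightarrow> nat \<Rightarrow> (zmat \<Rightarrow>\<^sub>0 rat) ring" where
  "affine_schur n r = \<lparr>
     carrier = {x. Poly_Mapping.keys x \<subseteq> Theta_r n r},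
     monoid.mult = (\<lambda>x y. \<Sum>A\<in>Poly_Mapping.keys x. \<Sum>B\<in>Poly_Mapping.keys y.
        rat_scale (Poly_Mapping.lookup x A * Poly_Mapping.lookup y B) (basis_mult n r A B)),
     monoid.one = (\<Sum>l\<in>aff_comps n r. basis_elt (diag_mat l)),
     ring.zero = 0,
     ring.add = (+)\<rparr>"

section \<open>Ordered products\<close>

definition E_elt :: "nat \<Rightarrow> nat \<Rightarrow> int \<Rightarrow> int \<Rightarrow> zmat \<Rightarrow>\<^sub>0 rat" where
  "E_elt n r i j = (if r = 0 then 0
     else (\<Sum>l\<in>aff_comps n (r - 1). basis_elt (mat_add (E_mat n i j) (diag_mat l))))"

definition L_plus :: "nat \<Rightarrow> (int \<times> int) set" where
  "L_plus n = {(i, j). 1 \<le> i \<and> i \<le> int n \<and> i < j}"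

definition L_minus :: "nat \<Rightarrow> (int \<times> int) set" where
  "L_minus n = {(i, j). 1 \<le> i \<and> i \<le> int n \<and> i > j}"

definition ordered_list :: "('a \<times> 'a) set \<Rightarrow> 'a set \<Rightarrow> 'a list" where
  "ordered_list R T =
     (THE xs. set xs = T \<and> distinct xs \<and> sorted_wrt (\<lambda>x y. (x, y) \<in> R) xs)"

text \<open>The product over an infinite index set \<open>I\<close>: the factors with exponent \<open>0\<close> are the identity,
  and the finitely many others are multiplied in increasing order from left to right.\<close>
definition E_prod ::
    "nat \<Rightarrow> nat \<Rightarrow> (int \<times> int) set \<Rightarrow> ((int \<times> int) \<times> (int \<times> int)) set \<Rightarrow> zmat \<Rightarrow> zmat \<Rightarrow>\<^sub>0 rat" where
  "E_prod n r I R A = foldr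
     (\<lambda>(i, j) x. (E_elt n r i j [^]\<^bsub>affine_schur n r\<^esub> A i j) \<otimes>\<^bsub>affine_schur n r\<^esub> x)
     (ordered_list R {(i, j) \<in> I. A i j \<noteq> 0}) \<one>\<^bsub>affine_schur n r\<^esub>"

definition pbw_elt :: "nat \<Rightarrow> nat \<Rightarrow> ((int \<times> int) \<times> (int \<times> int)) set \<Rightarrow>
    ((int \<times> int) \<times> (int \<times> int)) set \<Rightarrow> zmat \<Rightarrow> zmat \<Rightarrow>\<^sub>0 rat" where
  "pbw_elt n r Rp Rm A =
     E_prod n r (L_plus n) Rp A \<otimes>\<^bsub>affine_schur n r\<^esub> basis_elt (diag_mat (bsigma A))
       \<otimes>\<^bsub>affine_schur n r\<^esub> E_prod n r (L_minus n) Rm A"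

end

(* Let X be the set of maps g : Z -> Z with g(k + r) = g(k) + n. A complete periodic flag L and a flag
   L' of F have a relative position g in X. Replacing one member of L runs through q + 1 flags, and
   each g with g(i) > g(i + 1) can be sorted by such replacements, as in the affine Hecke algebra.
   This computes the structure constants recursively; at q = 1 the recursion collapses: writing
   [f, g] for the matrix whose (i, j) entry is the number of k with f(k) = i and g(k) = j, the coefficient
   of [f, h] in [A]_1 [B]_1 is the number of g in X with [f, g] = A and [g, h] = B.

   Hence elements with nonnegative coefficients multiply like relations on X. The element
   E_{i,j}[0, r] moves one point from i to j, so the support of the product attached to A consists of
   matrices of pairs (f, h) such that h arises from f by as many moves as A has off-diagonal entries.
   If no point is moved twice, the off-diagonal part is that of A, the intermediate map is max(f, h),
   and its fibres are fixed by the idempotent of sigma(A); so the matrix is A. Otherwise it has fewer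
   off-diagonal entries, and the transition matrix is triangular with positive diagonal. *)
theory Submission
  imports Defs "HOL-Library.Product_Lexorder" "HOL-Computational_Algebra.Primes"
begin

section \<open>Periodic maps and their matrices\<close>

text \<open>To count the \<open>L'\<close> between two flags \<open>L\<close> and
  \<open>L''\<close>, a complete flag \<open>M\<close> refining \<open>L\<close> is chosen. The
  orbit of \<open>(L, L')\<close> then depends only on the position \<open>g\<close> of
  \<open>L'\<close> to \<open>M\<close>, and the \<open>L'\<close> are counted for one
  \<open>g\<close> at a time. The obstacle: the position \<open>h\<close> of \<open>L''\<close> to
  \<open>M\<close> varies with \<open>M\<close>, while a single polynomial must serve all pairs in
  the orbit of \<open>C\<close> and all finite fields. It is overcome by sorting the pairs
  \<open>(f k, h k)\<close> lexicographically: a matrix determines the sorted pair of maps up to a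
  translation of \<open>k\<close>, and every pair of flags in the orbit has a refinement
  \<open>M\<close> realising it. The recursion then involves \<open>g\<close> and \<open>h\<close>
  alone, and a field enters only through its number of elements, the point of evaluation. A
  structure polynomial is pinned down by the infinitely many prime fields once its orbit is seen to
  be nonempty over each of them. The engine of the geometry is the modular law together with the
  count of intermediate spaces in a two-dimensional quotient, so the counting takes place in an
  abstract lattice of subspaces.\<close>

definition pmaps :: "nat \<Rightarrow> nat \<Rightarrow> (int \<Rightarrow> int) set" where
  "pmaps n r = {g. \<forall>k. g (k + int r) = g k + int n}"

definition rmat :: "(int \<Rightarrow> int) \<Rightarrow> (int \<Rightarrow> int) \<Rightarrow> zmat" where
  "rmat f g = (\<lambda>i j. card {k. f k = i \<and> g k = j})"

lemma pmaps_add_mult: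
  assumes "g \<in> pmaps n r"
  shows "g (k + m * int r) = g k + m * int n"
proof (induction m rule: int_induct[where k = 0])
  case (step1 i)
  have "g (k + (i + 1) * int r) = g ((k + i * int r) + int r)" by (simp add: algebra_simps)
  also have "\<dots> = g (k + i * int r) + int n" using assms by (simp only: pmaps_def mem_Collect_eq)
  finally show ?case using step1 by (simp add: algebra_simps)
next
  case (step2 i)
  have "g (k + i * int r) = g ((k + (i - 1) * int r) + int r)" by (simp add: algebra_simps)
  also have "\<dots> = g (k + (i - 1) * int r) + int n" using assms by (simp only: pmaps_def mem_Collect_eq)
  finally show ?case using step2 by (simp add: algebra_simps)
qed simp

lemma pmaps_eq_of_mod:
  assumes "g \<in> pmaps n r"
  shows "g k = g (k mod int r) + (k div int r) * int n"
proof -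
  have "g k = g (k mod int r + (k div int r) * int r)" by (simp add: algebra_simps)
  then show ?thesis using pmaps_add_mult[OF assms] by metis
qed

lemma pmaps_eqI:
  assumes "f \<in> pmaps n r" "g \<in> pmaps n r" "r > 0" "\<And>k. k \<in> {0..<int r} \<Longrightarrow> f k = g k"
  shows "f = g"
proof
  fix k
  have "k mod int r \<in> {0..<int r}" using assms(3) by simp
  then show "f k = g k" using pmaps_eq_of_mod[OF assms(1), of k] pmaps_eq_of_mod[OF assms(2), of k] assms(4) by simp
qed

lemma card_fibres:
  assumes "finite S" "finite T" "g ` S \<subseteq> T"
  shows "card S = (\<Sum>y\<in>T. card {x \<in> S. g x = y})"
  using sum.group[OF assms, of "\<lambda>_. 1 :: nat"] by simp

text \<open>The points with value in \<open>1..n\<close> and the points in \<open>0..<r\<close> are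
  both systems of representatives modulo shifts by \<open>r\<close>. This converts sums over the
  rows \<open>1..n\<close>, as in \<open>mat_sigma\<close>, into counts of points in one
  period.\<close>

lemma pmaps_fund_bij:
  assumes f: "f \<in> pmaps n r" and "n > 0" "r > 0"
  shows "bij_betw (\<lambda>k. k mod int r) {k. 1 \<le> f k \<and> f k \<le> int n} {0..<int r}"
proof (rule bij_betw_imageI)
  show "inj_on (\<lambda>k. k mod int r) {k. 1 \<le> f k \<and> f k \<le> int n}"
  proof (rule inj_onI, clarsimp)
    fix k l assume a: "1 \<le> f k" "f k \<le> int n" "1 \<le> f l" "f l \<le> int n" and e: "k mod int r = l mod int r"
    define d where "d = k div int r - l div int r"
    have "f k = f l + d * int n"
      unfolding d_def using pmaps_eq_of_mod[OF f, of k] pmaps_eq_of_mod[OF f, of l] e by (simp add: algebra_simps)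
    then have b: "d * int n < int n \<and> - int n < d * int n" using a by linarith
    have "d < 1"
    proof (rule ccontr)
      assume "\<not> d < 1"
      then have "1 * int n \<le> d * int n" by (intro mult_right_mono) auto
      then show False using b by linarith
    qed
    moreover have "-1 < d"
    proof (rule ccontr)
      assume "\<not> -1 < d"
      then have "d * int n \<le> (-1) * int n" by (intro mult_right_mono) auto
      then show False using b by linarith
    qed
    ultimately have "d = 0" by simp
    then show "k = l" using e unfolding d_def
      by (metis div_mult_mod_eq eq_iff_diff_eq_0)
  qed
  show "(\<lambda>k. k mod int r) ` {k. 1 \<le> f k \<and> f k \<le> int n} = {0..<int r}"
  proof (intro equalityI subsetI)
    fix t assume "t \<in> {0..<int r}"
    then have t: "t mod int r = t" by simp
    \<comment> \<open>Subtracting 1 before dividing makes the shifted value land in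
      \<open>1..n\<close> instead of \<open>0..<n\<close>.\<close>
    define m where "m = - ((f t - 1) div int n)"
    have "f (t + m * int r) = f t + m * int n" by (rule pmaps_add_mult[OF f])
    also have "\<dots> = (f t - 1) mod int n + 1"
      unfolding m_def using minus_mult_div_eq_mod[of "f t - 1" "int n"] by (simp add: algebra_simps)
    finally have "f (t + m * int r) = (f t - 1) mod int n + 1" .
    moreover have "0 \<le> (f t - 1) mod int n" "(f t - 1) mod int n < int n" using assms(2) by simp_all
    ultimately have "t + m * int r \<in> {k. 1 \<le> f k \<and> f k \<le> int n}" by simp
    moreover have "(t + m * int r) mod int r = t" using t by simp
    ultimately show "t \<in> (\<lambda>k. k mod int r) ` {k. 1 \<le> f k \<and> f k \<le> int n}"
      by (intro image_eqI[where x = "t + m * int r"]) (rule sym)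
  qed (use assms(3) in auto)
qed

lemma pmaps_fund_card:
  assumes "f \<in> pmaps n r" "n > 0" "r > 0" "\<And>k. P (k mod int r) = P k"
  shows "card {k. 1 \<le> f k \<and> f k \<le> int n \<and> P k} = card {k \<in> {0..<int r}. P k}"
proof (rule bij_betw_same_card)
  note b = pmaps_fund_bij[OF assms(1-3)]
  show "bij_betw (\<lambda>k. k mod int r) {k. 1 \<le> f k \<and> f k \<le> int n \<and> P k} {k \<in> {0..<int r}. P k}"
  proof (rule bij_betw_imageI)
    show "inj_on (\<lambda>k. k mod int r) {k. 1 \<le> f k \<and> f k \<le> int n \<and> P k}"
      by (rule inj_on_subset[OF bij_betw_imp_inj_on[OF b]]) auto
    show "(\<lambda>k. k mod int r) ` {k. 1 \<le> f k \<and> f k \<le> int n \<and> P k} = {k \<in> {0..<int r}. P k}"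
    proof (intro equalityI subsetI)
      fix t assume t: "t \<in> {k \<in> {0..<int r}. P k}"
      then have "t \<in> (\<lambda>k. k mod int r) ` {k. 1 \<le> f k \<and> f k \<le> int n}"
        using bij_betw_imp_surj_on[OF b] by simp
      then obtain k where "t = k mod int r" "1 \<le> f k" "f k \<le> int n" by auto
      then show "t \<in> (\<lambda>k. k mod int r) ` {k. 1 \<le> f k \<and> f k \<le> int n \<and> P k}"
        using t assms(4)[of k] by auto
    next
      fix t assume "t \<in> (\<lambda>k. k mod int r) ` {k. 1 \<le> f k \<and> f k \<le> int n \<and> P k}"
      then show "t \<in> {k \<in> {0..<int r}. P k}" using assms(3,4) by auto
    qed
  qed
qed

text \<open>A fibre meets each residue class modulo \<open>r\<close> at most once, because a shift
  by \<open>r\<close> changes the value by \<open>n > 0\<close>. Without finiteness the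
  \<open>card\<close> in \<open>rmat\<close> would default to 0.\<close>

lemma finite_fibre:
  assumes f: "f \<in> pmaps n r" and "n > 0" "r > 0"
  shows "finite {k. f k = i}"
proof (rule finite_imageD)
  show "finite ((\<lambda>k. k mod int r) ` {k. f k = i})"
    by (rule finite_subset[of _ "{0..<int r}"]) (use assms(3) in auto)
  show "inj_on (\<lambda>k. k mod int r) {k. f k = i}"
  proof (rule inj_onI, clarsimp)
    fix k l assume a: "f l = f k" "i = f k" and e: "k mod int r = l mod int r"
    have "(k div int r) * int n = (l div int r) * int n"
      using pmaps_eq_of_mod[OF f, of k] pmaps_eq_of_mod[OF f, of l] e a by simp
    then show "k = l" using e assms(2) by (metis div_mult_mod_eq mult_cancel_right of_nat_0_eq_iff not_gr_zero)
  qed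
qed

lemma finite_fibre_conj:
  assumes "f \<in> pmaps n r" "n > 0" "r > 0"
  shows "finite {k. f k = i \<and> P k}"
  by (rule finite_subset[OF _ finite_fibre[OF assms, of i]]) auto

lemma finite_fund:
  assumes f: "f \<in> pmaps n r" and "n > 0" "r > 0"
  shows "finite {k. a \<le> f k \<and> f k \<le> b \<and> P k}"
proof (rule finite_subset)
  show "{k. a \<le> f k \<and> f k \<le> b \<and> P k} \<subseteq> (\<Union>i\<in>{a..b}. {k. f k = i})" by auto
  show "finite (\<Union>i\<in>{a..b}. {k. f k = i})" using finite_fibre[OF assms] by simp
qed

lemma rmat_pos_iff:
  assumes "f \<in> pmaps n r" "n > 0" "r > 0"
  shows "rmat f g i j \<noteq> 0 \<longleftrightarrow> (\<exists>k. f k = i \<and> g k = j)"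
  using finite_fibre_conj[OF assms, of i "\<lambda>k. g k = j"] by (auto simp: rmat_def)

lemma rmat_supp:
  assumes "f \<in> pmaps n r" "n > 0" "r > 0"
  shows "{j. rmat f g i j \<noteq> 0} = g ` {k. f k = i}"
  using rmat_pos_iff[OF assms, of g i] by auto

lemma rmat_row_sum:
  assumes "f \<in> pmaps n r" "n > 0" "r > 0"
  shows "(\<Sum>j | rmat f g i j \<noteq> 0. rmat f g i j) = card {k. f k = i}"
proof -
  have "card {k. f k = i} = (\<Sum>y\<in>g ` {k. f k = i}. card {x \<in> {k. f k = i}. g x = y})"
    by (rule card_fibres) (use finite_fibre[OF assms] in auto)
  then show ?thesis unfolding rmat_supp[OF assms] by (simp add: rmat_def)
qed

lemma rmat_periodic:
  assumes "f \<in> pmaps n r" "g \<in> pmaps n r"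
  shows "rmat f g (i + int n) (j + int n) = rmat f g i j"
  unfolding rmat_def
proof (rule bij_betw_same_card[symmetric])
  show "bij_betw (\<lambda>k. k + int r) {k. f k = i \<and> g k = j} {k. f k = i + int n \<and> g k = j + int n}"
  proof (rule bij_betw_byWitness[where f' = "\<lambda>k. k - int r"])
    show "(\<lambda>k. k - int r) ` {k. f k = i + int n \<and> g k = j + int n} \<subseteq> {k. f k = i \<and> g k = j}"
      using pmaps_add_mult[OF assms(1), of _ "-1"] pmaps_add_mult[OF assms(2), of _ "-1"] by auto
  qed (use assms in \<open>auto simp: pmaps_def\<close>)
qed

lemma rmat_in_Theta_r:
  assumes f: "f \<in> pmaps n r" and g: "g \<in> pmaps n r" and n: "n > 0" and r: "r > 0"
  shows "rmat f g \<in> Theta_r n r"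
proof -
  have "mat_sigma n (rmat f g) = (\<Sum>i=1..int n. card {k. f k = i})"
    unfolding mat_sigma_def using rmat_row_sum[OF f n r] by simp
  also have "\<dots> = card {k. 1 \<le> f k \<and> f k \<le> int n \<and> True}"
  proof -
    have "card {k. 1 \<le> f k \<and> f k \<le> int n \<and> True} =
        (\<Sum>y\<in>{1..int n}. card {x \<in> {k. 1 \<le> f k \<and> f k \<le> int n \<and> True}. f x = y})"
      by (rule card_fibres) (use finite_fund[OF f n r, of 1 "int n" "\<lambda>_. True"] in auto)
    also have "\<dots> = (\<Sum>i=1..int n. card {k. f k = i})"
      by (rule sum.cong[OF refl], rule arg_cong[where f = card]) auto
    finally show ?thesis by simp
  qed
  also have "\<dots> = card {k \<in> {0..<int r}. True}" by (rule pmaps_fund_card[OF f n r refl])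
  also have "{k \<in> {0..<int r}. True} = {0..<int r}" by auto
  finally have "mat_sigma n (rmat f g) = r" by simp
  moreover have "finite {j. rmat f g i j \<noteq> 0}" for i
    unfolding rmat_supp[OF f n r] using finite_fibre[OF f n r] by simp
  ultimately show ?thesis using rmat_periodic[OF f g] by (simp add: Theta_r_def Theta_def)
qed

text \<open>An entry counts points of the common domain, so renaming the points changes nothing. It
  is applied to \<open>u = sw r i\<close>, where it evaluates the recursion at 1.\<close>

lemma rmat_reindex:
  assumes "bij u"
  shows "rmat (f \<circ> u) (g \<circ> u) = rmat f g"
proof (intro ext)
  fix i j
  have "bij_betw u {k. f (u k) = i \<and> g (u k) = j} {k. f k = i \<and> g k = j}"
  proof (rule bij_betw_imageI)
    show "inj_on u {k. f (u k) = i \<and> g (u k) = j}"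
      by (rule inj_on_subset[OF bij_is_inj[OF assms]]) simp
    show "u ` {k. f (u k) = i \<and> g (u k) = j} = {k. f k = i \<and> g k = j}"
    proof (intro equalityI subsetI)
      fix k assume k: "k \<in> {k. f k = i \<and> g k = j}"
      obtain l where "k = u l" using bij_is_surj[OF assms] by (metis surjD)
      with k show "k \<in> u ` {k. f (u k) = i \<and> g (u k) = j}" by simp
    qed auto
  qed
  then show "rmat (f \<circ> u) (g \<circ> u) i j = rmat f g i j"
    unfolding rmat_def comp_def by (rule bij_betw_same_card)
qed

subsection \<open>Sorting by adjacent transpositions\<close>

text \<open>A simple reflection of the affine symmetric group: it exchanges \<open>i + m r\<close>
  and \<open>i + 1 + m r\<close> for all \<open>m\<close> at once and acts on maps by composition on
  the right. For \<open>r = 1\<close> the formula degenerates to the translation by 1, hence the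
  assumption \<open>r >= 2\<close> below.\<close>

definition sw :: "nat \<Rightarrow> int \<Rightarrow> int \<Rightarrow> int" where
  "sw r i k = (if (k - i) mod int r = 0 then k + 1 else if (k - i) mod int r = 1 then k - 1 else k)"

lemma sw_involutive:
  assumes "r \<ge> 2" shows "sw r i (sw r i k) = k"
proof -
  have 1: "(1 :: int) mod int r = 1" using assms by simp
  have a: "(k + 1 - i) mod int r = 1" if "(k - i) mod int r = 0"
    using mod_add_left_eq[of "k - i" "int r" 1] that 1 by (simp add: algebra_simps)
  have b: "(k - 1 - i) mod int r = 0" if "(k - i) mod int r = 1"
    using mod_diff_left_eq[of "k - i" "int r" 1] that 1 by (simp add: algebra_simps)
  show ?thesis unfolding sw_def using a b by simp
qed

lemma sw_bij: "r \<ge> 2 \<Longrightarrow> bij (sw r i)"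
  by (rule involuntory_imp_bij) (rule sw_involutive)

lemma sw_comp_sw: "r \<ge> 2 \<Longrightarrow> (g \<circ> sw r i) \<circ> sw r i = g"
  by (rule ext) (simp add: sw_involutive)

lemma sw_add: "sw r i (k + int r) = sw r i k + int r"
proof -
  have "(k + int r - i) mod int r = (k - i) mod int r"
    using mod_add_self2[of "k - i" "int r"] by (simp add: algebra_simps)
  then show ?thesis by (simp add: sw_def)
qed

lemma sw_comp_pmaps: "g \<in> pmaps n r \<Longrightarrow> g \<circ> sw r i \<in> pmaps n r"
  by (simp add: pmaps_def sw_add)

lemma sw_at: "r \<ge> 2 \<Longrightarrow> sw r i i = i + 1" "r \<ge> 2 \<Longrightarrow> sw r i (i + 1) = i"
  by (simp_all add: sw_def)

lemma sum_period:
  fixes \<phi> :: "int \<Rightarrow> 'a :: comm_monoid_add"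
  assumes "\<And>k. \<phi> (k + int r) = \<phi> k"
  shows "sum \<phi> {a..<a + int r} = sum \<phi> {0..<int r}"
proof -
  have step: "sum \<phi> {a + 1..<a + 1 + int r} = sum \<phi> {a..<a + int r}" for a
  proof (cases "r = 0")
    case False
    then have 1: "{a..<a + int r} = insert a {a + 1..<a + int r}"
      and 2: "{a + 1..<a + 1 + int r} = insert (a + int r) {a + 1..<a + int r}" by auto
    show ?thesis unfolding 1 2 using assms by simp
  qed simp
  show ?thesis
  proof (induction a rule: int_induct[where k = 0])
    case (step1 i) then show ?case using step[of i] by simp
  next
    case (step2 i) then show ?case using step[of "i - 1"] by simp
  qed simp
qed

text \<open>Sorting decreases the distance from the linear map \<open>k \<mapsto> (n / r) k\<close>; the summand is
  \<open>r\<close>-periodic in \<open>k\<close>, so that any period may be used.\<close>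
definition disorder :: "nat \<Rightarrow> nat \<Rightarrow> (int \<Rightarrow> int) \<Rightarrow> nat" where
  "disorder n r g = nat (\<Sum>k\<in>{0..<int r}. (int r * g k - int n * k)\<^sup>2)"

text \<open>A period starting at \<open>i\<close> contains both exchanged points, and no other
  summand changes. In the difference the squares of the values cancel, and the mixed terms leave
  \<open>2 r n (g i - g (i + 1))\<close>.\<close>

lemma disorder_sw:
  assumes g: "g \<in> pmaps n r" and n: "n > 0" and r: "r \<ge> 2" and d: "g (i + 1) < g i"
  shows "disorder n r (g \<circ> sw r i) < disorder n r g"
proof -
  let ?\<phi> = "\<lambda>g k. (int r * g k - int n * k)\<^sup>2"
  have per: "?\<phi> g (k + int r) = ?\<phi> g k" if "g \<in> pmaps n r" for g k
    using that by (simp add: pmaps_def algebra_simps)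
  have s: "(\<Sum>k\<in>{0..<int r}. ?\<phi> g k) = ?\<phi> g i + (?\<phi> g (i + 1) + (\<Sum>k\<in>{i + 2..<i + int r}. ?\<phi> g k))"
    if "g \<in> pmaps n r" for g
  proof -
    have "(\<Sum>k\<in>{0..<int r}. ?\<phi> g k) = (\<Sum>k\<in>{i..<i + int r}. ?\<phi> g k)"
      by (rule sum_period[symmetric]) (rule per[OF that])
    also have "{i..<i + int r} = insert i (insert (i + 1) {i + 2..<i + int r})" using r by auto
    finally show ?thesis by simp
  qed
  have e: "(\<Sum>k\<in>{i + 2..<i + int r}. ?\<phi> (g \<circ> sw r i) k) = (\<Sum>k\<in>{i + 2..<i + int r}. ?\<phi> g k)"
    by (rule sum.cong) (auto simp: sw_def)
  have "?\<phi> g i + ?\<phi> g (i + 1) - (?\<phi> (g \<circ> sw r i) i + ?\<phi> (g \<circ> sw r i) (i + 1))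
      = 2 * int r * int n * (g i - g (i + 1))"
    using r by (simp add: sw_at) (simp add: power2_eq_square algebra_simps)
  moreover have "\<dots> > 0" using n r d by simp
  ultimately have "(\<Sum>k\<in>{0..<int r}. ?\<phi> (g \<circ> sw r i) k) < (\<Sum>k\<in>{0..<int r}. ?\<phi> g k)"
    unfolding s[OF g] s[OF sw_comp_pmaps[OF g]] e by linarith
  moreover have "0 \<le> (\<Sum>k\<in>{0..<int r}. ?\<phi> (g \<circ> sw r i) k)" by (rule sum_nonneg) simp
  ultimately show ?thesis unfolding disorder_def by (subst nat_less_eq_zless)
qed

lemma mono_int_iff: "mono (F :: int \<Rightarrow> 'a :: order) \<longleftrightarrow> (\<forall>k. F k \<le> F (k + 1))"
proof
  assume s: "\<forall>k. F k \<le> F (k + 1)"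
  have "F k \<le> F (k + int m)" for k m
  proof (induction m)
    case (Suc m)
    then have "F k \<le> F ((k + int m) + 1)" using s[rule_format, of "k + int m"] by (rule order_trans)
    then show ?case by (simp add: algebra_simps)
  qed simp
  then show "mono F" by (metis monoI zle_iff_zadd)
qed (simp add: monoD)

text \<open>Induction along sorting, with \<open>disorder\<close> as measure. A descent forces
  \<open>r >= 2\<close>: for \<open>r = 1\<close> periodicity reads
  \<open>g (i + 1) = g i + n\<close>.\<close>

lemma pmaps_descent_induct [consumes 3, case_names sorted descent]:
  assumes "n > 0" "r > 0" "g \<in> pmaps n r"
    and "\<And>g. g \<in> pmaps n r \<Longrightarrow> mono g \<Longrightarrow> P g"
    and "\<And>g i. r \<ge> 2 \<Longrightarrow> g \<in> pmaps n r \<Longrightarrow> g (i + 1) < g i \<Longrightarrow> P (g \<circ> sw r i) \<Longrightarrow> P g"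
  shows "P g"
  using assms(3)
proof (induction "disorder n r g" arbitrary: g rule: less_induct)
  case less
  show ?case
  proof (cases "mono g")
    case False
    then obtain i where i: "g (i + 1) < g i" unfolding mono_int_iff by (auto simp: not_le)
    have "r \<ge> 2"
    proof (rule ccontr)
      assume "\<not> r \<ge> 2"
      then have "r = 1" using assms(2) by simp
      then show False using less.prems i by (auto simp: pmaps_def)
    qed
    then show ?thesis using assms(5) i less.hyps[OF disorder_sw[OF less.prems assms(1) _ i]]
        sw_comp_pmaps less.prems by blast
  qed (use assms(4) less.prems in blast)
qed

subsection \<open>Normal form of a pair of periodic maps\<close>

text \<open>Pairs carry the lexicographic order.\<close>
abbreviation lexmono :: "(int \<Rightarrow> int) \<Rightarrow> (int \<Rightarrow> int) \<Rightarrow> bool" where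
  "lexmono f h \<equiv> mono (\<lambda>k. (f k, h k))"

lemma lexmono_fst: "lexmono f h \<Longrightarrow> mono f"
  unfolding mono_int_iff by (auto simp: less_eq_prod_def less_le)

text \<open>At a first disagreement let \<open>y\<close> be the smaller of the two values. The
  sequence with the larger value has already passed \<open>y\<close>, and each of its occurrences of
  \<open>y\<close> is one in the other sequence, which has at least one more; this contradicts equal
  fibre sizes. The start \<open>k0\<close> is a first occurrence in both, so no occurrence of
  \<open>y\<close> hides to its left.\<close>

lemma mono_fibres_ge:
  fixes F G :: "int \<Rightarrow> 'a :: linorder"
  assumes F: "mono F" and G: "mono G" and fin: "\<And>x. finite {k. F k = x}" "\<And>x. finite {k. G k = x}"
    and card: "\<And>x. card {k. F k = x} = card {k. G k = x}"
    and 0: "F k0 = G k0" "\<And>k. k < k0 \<Longrightarrow> F k \<noteq> F k0" "\<And>k. k < k0 \<Longrightarrow> G k \<noteq> G k0"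
  shows "F (k0 + int m) = G (k0 + int m)"
proof (induction m rule: less_induct)
  case (less m)
  have aux: "\<not> F (k0 + int m) < G (k0 + int m)"
    if F: "mono F" and G: "mono G" and fin: "\<And>x. finite {k. F k = x}"
    and card: "\<And>x. card {k. F k = x} = card {k. G k = x}"
    and 0: "F k0 = G k0" "\<And>k. k < k0 \<Longrightarrow> F k \<noteq> F k0" "\<And>k. k < k0 \<Longrightarrow> G k \<noteq> G k0"
    and IH: "\<And>m'. m' < m \<Longrightarrow> F (k0 + int m') = G (k0 + int m')" for F G :: "int \<Rightarrow> 'a"
  proof
    assume lt: "F (k0 + int m) < G (k0 + int m)"
    let ?y = "F (k0 + int m)"
    have "G k = ?y \<Longrightarrow> F k = ?y \<and> k \<noteq> k0 + int m" for k
    proof -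
      assume k: "G k = ?y"
      have "F k0 \<le> ?y" using F by (simp add: monoD)
      have "k \<ge> k0"
      proof (rule ccontr)
        assume "\<not> k \<ge> k0"
        then have "G k \<le> G k0" "G k \<noteq> G k0" using G 0(3) by (auto simp: monoD)
        then show False using k \<open>F k0 \<le> ?y\<close> 0(1) by simp
      qed
      moreover have "k < k0 + int m"
        using k lt G by (metis monoD not_le leD)
      ultimately obtain m' where "k = k0 + int m'" "m' < m"
        by (metis add_less_cancel_left of_nat_less_iff zle_iff_zadd)
      then show ?thesis using IH k by auto
    qed
    then have "{k. G k = ?y} \<subset> {k. F k = ?y}" by blast
    then show False using psubset_card_mono[OF fin] card by (metis less_irrefl)
  qed
  show ?case
    using aux[OF F G fin(1) card 0 less] aux[OF G F fin(2) card[symmetric] 0(1)[symmetric] 0(3,2) less[symmetric]]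
    by (meson linorder_neqE)
qed

text \<open>A sorted enumeration of a multiset is unique once its start is aligned; here it runs
  over all integers, so a translation remains free.\<close>

lemma lexmono_unique:
  assumes P: "f \<in> pmaps n r" "h \<in> pmaps n r" "f' \<in> pmaps n r" "h' \<in> pmaps n r"
    and n: "n > 0" and r: "r > 0"
    and m: "lexmono f h" "lexmono f' h'" and eq: "rmat f h = rmat f' h'"
  obtains c where "f' = (\<lambda>k. f (k + c))" "h' = (\<lambda>k. h (k + c))"
proof -
  let ?F = "\<lambda>k. (f k, h k)" and ?G = "\<lambda>k. (f' k, h' k)"
  have e: "{k. ?F k = x} = {k. f k = fst x \<and> h k = snd x}" "{k. ?G k = x} = {k. f' k = fst x \<and> h' k = snd x}" for x
    by auto
  have fin: "finite {k. ?F k = x}" "finite {k. ?G k = x}" for x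
    unfolding e using finite_fibre_conj[OF P(1) n r] finite_fibre_conj[OF P(3) n r] by simp_all
  have card: "card {k. ?F k = x} = card {k. ?G k = x}" for x
    unfolding e using fun_cong[OF fun_cong[OF eq]] by (simp add: rmat_def)
  let ?x = "?F 0"
  have "{k. ?F k = ?x} \<noteq> {}" by blast
  then have "{k. ?G k = ?x} \<noteq> {}" using card[of ?x] fin[of ?x] by (metis card_eq_0_iff)
  \<comment> \<open>Both enumerations are aligned at the first occurrence of the pair
    \<open>(f 0, h 0)\<close>.\<close>
  define a where "a = Min {k. ?F k = ?x}"
  define b where "b = Min {k. ?G k = ?x}"
  have a: "?F a = ?x" "k < a \<Longrightarrow> ?F k \<noteq> ?x" for k
  proof -
    show "?F a = ?x" using Min_in[OF fin(1) \<open>{k. ?F k = ?x} \<noteq> {}\<close>] unfolding a_def by blast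
    show "?F k \<noteq> ?x" if "k < a"
    proof
      assume "?F k = ?x"
      then have "k \<in> {k. ?F k = ?x}" by blast
      then show False using Min_le[OF fin(1)] that unfolding a_def by (meson not_le)
    qed
  qed
  have b: "?G b = ?x" "k < b \<Longrightarrow> ?G k \<noteq> ?x" for k
  proof -
    show "?G b = ?x" using Min_in[OF fin(2) \<open>{k. ?G k = ?x} \<noteq> {}\<close>] unfolding b_def by blast
    show "?G k \<noteq> ?x" if "k < b"
    proof
      assume "?G k = ?x"
      then have "k \<in> {k. ?G k = ?x}" by blast
      then show False using Min_le[OF fin(2)] that unfolding b_def by (meson not_le)
    qed
  qed
  let ?H = "\<lambda>k. ?F (k + (a - b))"
  have "?H (b + int m) = ?G (b + int m)" for m
  proof (rule mono_fibres_ge)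
    show "mono ?H" using m(1) unfolding mono_def by simp
    have im: "{k. ?H k = x} = (\<lambda>k. k - (a - b)) ` {k. ?F k = x}" for x
      by (auto intro!: image_eqI[where x = "_ + (a - b)"])
    show "finite {k. ?H k = x}" for x unfolding im using fin by simp
    show "card {k. ?H k = x} = card {k. ?G k = x}" for x
      unfolding im card[symmetric] by (rule card_image) (simp add: inj_on_def)
    show "?H k \<noteq> ?H b" if "k < b" for k using a(2)[of "k + (a - b)"] a(1) that by simp
    show "?G k \<noteq> ?G b" if "k < b" for k using b that by simp
  qed (use m fin a b in simp_all)
  then have ge: "?H k = ?G k" if "k \<ge> b" for k using that by (metis zle_iff_zadd)
  have "f' k = f (k + (a - b)) \<and> h' k = h (k + (a - b))" for k
  proof -
    \<comment> \<open>Agreement is known only from \<open>b\<close> on. A shift by \<open>M\<close>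
      periods carries \<open>k\<close> there, and periodicity carries the equations back.\<close>
    define M where "M = \<bar>k - b\<bar>"
    have "M * 1 \<le> M * int r" using r by (intro mult_left_mono) (auto simp: M_def)
    then have "M \<le> M * int r" by simp
    moreover have "k + M \<ge> b" unfolding M_def by linarith
    ultimately have "k + M * int r \<ge> b" by linarith
    from ge[OF this] show ?thesis
      using pmaps_add_mult[OF P(3), of k M] pmaps_add_mult[OF P(4), of k M]
        pmaps_add_mult[OF P(1), of "k + (a - b)" M] pmaps_add_mult[OF P(2), of "k + (a - b)" M]
      by (simp add: algebra_simps)
  qed
  then show thesis by (intro that[of "a - b"]) auto
qed

definition zperiodic :: "nat \<Rightarrow> zmat \<Rightarrow> bool" where
  "zperiodic n A \<longleftrightarrow> (\<forall>i j. A (i + int n) (j + int n) = A i j)"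

lemma zperiodic_shift:
  assumes "zperiodic n A" shows "A (i + m * int n) (j + m * int n) = A i j"
proof (induction m rule: int_induct[where k = 0])
  case (step1 m)
  have "A ((i + m * int n) + int n) ((j + m * int n) + int n) = A (i + m * int n) (j + m * int n)"
    using assms by (simp only: zperiodic_def)
  then show ?case using step1 by (simp add: algebra_simps)
next
  case (step2 m)
  have "A ((i + (m - 1) * int n) + int n) ((j + (m - 1) * int n) + int n) = A (i + (m - 1) * int n) (j + (m - 1) * int n)"
    using assms by (simp only: zperiodic_def)
  then show ?case using step2 by (simp add: algebra_simps)
qed simp

lemma residue_row:
  assumes "n > 0"
  obtains m :: int where "1 \<le> i + m * int n" "i + m * int n \<le> int n"
proof -
  have "i + (- ((i - 1) div int n)) * int n = (i - 1) mod int n + 1"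
    using minus_mult_div_eq_mod[of "i - 1" "int n"] by (simp add: algebra_simps)
  moreover have "0 \<le> (i - 1) mod int n \<and> (i - 1) mod int n < int n" using assms by simp
  ultimately have "1 \<le> i + (- ((i - 1) div int n)) * int n \<and> i + (- ((i - 1) div int n)) * int n \<le> int n" by linarith
  then show thesis using that by blast
qed

lemma zperiodic_eqI:
  assumes "n > 0" "zperiodic n A" "zperiodic n B" "\<And>i j. 1 \<le> i \<Longrightarrow> i \<le> int n \<Longrightarrow> A i j = B i j"
  shows "A = B"
proof (intro ext)
  fix i j
  obtain m :: int where m: "1 \<le> i + m * int n" "i + m * int n \<le> int n" by (rule residue_row[OF assms(1)])
  show "A i j = B i j"
    using assms(4)[OF m, of "j + m * int n"] by (simp add: zperiodic_shift assms(2,3))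
qed

lemma Theta_zperiodic: "A \<in> Theta n \<Longrightarrow> zperiodic n A"
  by (simp add: Theta_def zperiodic_def)

lemma div_mod_step:
  assumes "r > 0"
  shows "(k + 1) div int r = (if (k + 1) mod int r = 0 then k div int r + 1 else k div int r)"
    and "(k + 1) mod int r \<noteq> 0 \<Longrightarrow> (k + 1) mod int r = k mod int r + 1"
proof -
  let ?q = "k div int r" and ?m = "k mod int r"
  have k: "k = int r * ?q + ?m" by simp
  have m: "0 \<le> ?m \<and> ?m < int r" using assms by simp
  have "((k + 1) div int r, (k + 1) mod int r) = (if ?m + 1 = int r then (?q + 1, 0) else (?q, ?m + 1))"
  proof (cases "?m + 1 = int r")
    case True
    have "k + 1 = int r * ?q + (?m + 1)" using k by linarith
    also have "\<dots> = (?q + 1) * int r" unfolding True by (simp add: distrib_right)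
    finally have "k + 1 = (?q + 1) * int r" .
    then show ?thesis using True assms by simp
  next
    case False
    then have "0 \<le> ?m + 1 \<and> ?m + 1 < int r" using m by linarith
    moreover have "k + 1 = (?m + 1) + ?q * int r" using k by (simp add: algebra_simps)
    ultimately show ?thesis using False assms
      by (metis Pair_inject add_0 div_mult_self1 div_pos_pos_trivial mod_mult_self1 mod_pos_pos_trivial less_irrefl of_nat_0_less_iff add.commute)
  qed
  then show "(k + 1) div int r = (if (k + 1) mod int r = 0 then ?q + 1 else ?q)"
    "(k + 1) mod int r \<noteq> 0 \<Longrightarrow> (k + 1) mod int r = ?m + 1"
    using m by (auto split: if_splits)
qed

text \<open>The \<open>r\<close> units of the entries in rows \<open>1..n\<close> are listed in
  lexicographic order, and the list is continued with period \<open>r\<close>, each round adding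
  \<open>n\<close> to both coordinates.\<close>

lemma ex_lexmono_rmat:
  assumes C: "C \<in> Theta_r n r" and n: "n > 0" and r: "r > 0"
  obtains f h where "f \<in> pmaps n r" "h \<in> pmaps n r" "lexmono f h" "rmat f h = C"
proof -
  have T: "C \<in> Theta n" using C by (simp add: Theta_r_def)
  have rowfin: "finite {j. C i j \<noteq> 0}" for i using T by (simp add: Theta_def)
  \<comment> \<open>The last component numbers the copies of a position, so that an entry of size
    \<open>c\<close> gives \<open>c\<close> distinct elements.\<close>
  define S :: "((int \<times> int) \<times> nat) set"
    where "S = (\<Union>i\<in>{1..int n}. \<Union>j\<in>{j. C i j \<noteq> 0}. (\<lambda>c. ((i, j), c)) ` {..<C i j})"
  have finS: "finite S" unfolding S_def using rowfin by auto
  have memS: "((i, j), c) \<in> S \<longleftrightarrow> 1 \<le> i \<and> i \<le> int n \<and> c < C i j" for i j c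
    unfolding S_def by (auto simp: image_iff)
  have "card S = (\<Sum>i\<in>{1..int n}. card (\<Union>j\<in>{j. C i j \<noteq> 0}. (\<lambda>c. ((i, j), c)) ` {..<C i j}))"
    unfolding S_def using rowfin by (intro card_UN_disjoint) auto
  also have "\<dots> = (\<Sum>i\<in>{1..int n}. \<Sum>j | C i j \<noteq> 0. card ((\<lambda>c. ((i, j), c)) ` {..<C i j}))"
    using rowfin by (intro sum.cong[OF refl] card_UN_disjoint) auto
  also have "\<dots> = mat_sigma n C" unfolding mat_sigma_def
    by (intro sum.cong[OF refl]) (simp add: card_image inj_on_def)
  finally have cardS: "card S = r" using C by (simp add: Theta_r_def)
  define xs where "xs = sorted_list_of_set S"
  have xs: "set xs = S" "distinct xs" "length xs = r" "sorted xs"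
    unfolding xs_def using finS cardS by simp_all
  define e where "e k = fst (xs ! nat (k mod int r))" for k
  define f where "f k = fst (e k) + (k div int r) * int n" for k
  define h where "h k = snd (e k) + (k div int r) * int n" for k
  have e_per: "e (k + int r) = e k" for k unfolding e_def by simp
  have fP: "f \<in> pmaps n r" and hP: "h \<in> pmaps n r"
    unfolding pmaps_def f_def h_def using r by (simp_all add: e_per algebra_simps)
  have nat_mod: "nat (k mod int r) < r" for k using r by (simp add: nat_less_iff)
  have e_range: "1 \<le> fst (e k) \<and> fst (e k) \<le> int n" for k
  proof -
    have "xs ! nat (k mod int r) \<in> S" using xs nat_mod by (metis nth_mem)
    then obtain i j c where x: "xs ! nat (k mod int r) = ((i, j), c)" "((i, j), c) \<in> S" by (metis surj_pair)
    then show ?thesis using memS[of i j c] unfolding e_def by simp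
  qed
  have lm: "lexmono f h"
    unfolding mono_int_iff
  proof
    fix k
    show "(f k, h k) \<le> (f (k + 1), h (k + 1))"
    proof (cases "(k + 1) mod int r = 0")
      \<comment> \<open>The list starts afresh here. The old row lay in \<open>1..n\<close> up to a
        multiple of \<open>n\<close> and the new one is in the next block of rows, so the step is
        strict in the first coordinate.\<close>
      case True
      have d: "(k + 1) div int r = k div int r + 1"
        using True div_mod_step[OF r, of k] by simp
      then have "f k < f (k + 1)" unfolding f_def using e_range[of k] e_range[of "k + 1"] by (simp add: algebra_simps)
      then show ?thesis by (simp add: less_eq_prod_def)
    next
      case False
      then have d: "(k + 1) div int r = k div int r" "(k + 1) mod int r = k mod int r + 1"
        using div_mod_step[OF r, of k] by simp_all
      then have "nat ((k + 1) mod int r) = Suc (nat (k mod int r))" using r by (simp add: nat_add_distrib)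
      then have "xs ! nat (k mod int r) \<le> xs ! nat ((k + 1) mod int r)"
        using sorted_nth_mono[OF xs(4), of "nat (k mod int r)" "Suc (nat (k mod int r))"] nat_mod[of "k + 1"] xs(3)
        by simp
      then have "e k \<le> e (k + 1)" unfolding e_def less_eq_prod_def[of "xs ! _"] by (meson less_imp_le)
      then show ?thesis unfolding f_def h_def d(1) by (auto simp: less_eq_prod_def)
    qed
  qed
  have row: "rmat f h i j = C i j" if i: "1 \<le> i" "i \<le> int n" for i j
  proof -
    have k: "f k = i \<Longrightarrow> k div int r = 0" for k
    proof -
      assume "f k = i"
      then have "(k div int r) * int n < 1 * int n" "(-1) * int n < (k div int r) * int n"
        using e_range[of k] i unfolding f_def by linarith+
      then show ?thesis using n by (simp only: mult_less_cancel_right) auto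
    qed
    have "{k. f k = i \<and> h k = j} = {k \<in> {0..<int r}. e k = (i, j)}"
    proof (intro equalityI subsetI)
      fix k assume "k \<in> {k. f k = i \<and> h k = j}"
      then show "k \<in> {k \<in> {0..<int r}. e k = (i, j)}"
        using k[of k] r unfolding f_def h_def by (auto simp: prod_eq_iff zdiv_eq_0_iff)
    next
      fix k assume "k \<in> {k \<in> {0..<int r}. e k = (i, j)}"
      then show "k \<in> {k. f k = i \<and> h k = j}" unfolding f_def h_def by simp
    qed
    also have "card \<dots> = card {m. m < r \<and> fst (xs ! m) = (i, j)}"
    proof (rule bij_betw_same_card)
      show "bij_betw nat {k \<in> {0..<int r}. e k = (i, j)} {m. m < r \<and> fst (xs ! m) = (i, j)}"
        by (rule bij_betw_byWitness[where f' = int]) (auto simp: e_def)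
    qed
    also have "\<dots> = card ((!) xs ` {m. m < r \<and> fst (xs ! m) = (i, j)})"
      by (rule card_image[symmetric]) (use xs in \<open>auto simp: inj_on_def nth_eq_iff_index_eq\<close>)
    also have "(!) xs ` {m. m < r \<and> fst (xs ! m) = (i, j)} = {x \<in> S. fst x = (i, j)}"
    proof (intro equalityI subsetI)
      fix x assume "x \<in> {x \<in> S. fst x = (i, j)}"
      moreover from this obtain m where "m < r" "x = xs ! m" using xs(1,3) by (auto simp: in_set_conv_nth)
      ultimately show "x \<in> (!) xs ` {m. m < r \<and> fst (xs ! m) = (i, j)}" by simp
    qed (use xs in auto)
    also have "\<dots> = (\<lambda>c. ((i, j), c)) ` {..<C i j}" using memS i by auto
    also have "card \<dots> = C i j" by (simp add: card_image inj_on_def)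
    finally show ?thesis by (simp add: rmat_def)
  qed
  have "rmat f h = C"
  proof (rule zperiodic_eqI[OF n])
    show "zperiodic n (rmat f h)" using rmat_in_Theta_r[OF fP hP n r] by (simp add: Theta_r_def Theta_zperiodic)
    show "zperiodic n C" by (rule Theta_zperiodic[OF T])
  qed (rule row)
  then show thesis using that fP hP lm by blast
qed

section \<open>Periodic flags in a modular lattice of subspaces\<close>

lemma int_threshold:
  fixes P :: "int \<Rightarrow> bool"
  assumes down: "\<And>j j'. P j \<Longrightarrow> j' \<le> j \<Longrightarrow> P j'" and a: "P a" and b: "\<not> P b"
  obtains g where "\<And>j. P j \<longleftrightarrow> j < g"
proof -
  let ?Z = "{j. a \<le> j \<and> j \<le> b \<and> \<not> P j}"
  have fin: "finite ?Z" by (rule finite_subset[of _ "{a..b}"]) auto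
  have "a \<le> b" using down[OF a, of b] b by (meson linear)
  then have "b \<in> ?Z" using b by simp
  then have m: "Min ?Z \<in> ?Z" using Min_in[OF fin] by blast
  have "P j \<longleftrightarrow> j < Min ?Z" for j
  proof
    assume "P j"
    show "j < Min ?Z"
    proof (rule ccontr)
      assume "\<not> j < Min ?Z"
      then have "P (Min ?Z)" using down[OF \<open>P j\<close>] by simp
      then show False using m by blast
    qed
  next
    assume j: "j < Min ?Z"
    show "P j"
    proof (rule ccontr)
      assume n: "\<not> P j"
      have "a \<le> j" using down[OF a, of j] n by (meson linear)
      moreover have "j \<le> b" using j m by simp
      ultimately have "j \<in> ?Z" using n by simp
      then show False using Min_le[OF fin] j by (meson not_le)
    qed
  qed
  then show thesis by (rule that)
qed

text \<open>For subspaces this means that \<open>U / W\<close> is one-dimensional. It is phrased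
  inside the lattice \<open>S\<close>, so that the modular law can be applied without choosing
  vectors.\<close>

definition covers :: "'v set set \<Rightarrow> 'v set \<Rightarrow> 'v set \<Rightarrow> bool" where
  "covers S W U \<longleftrightarrow> W \<in> S \<and> U \<in> S \<and> W \<subset> U \<and> (\<forall>Y\<in>S. W \<subseteq> Y \<longrightarrow> Y \<subseteq> U \<longrightarrow> Y = W \<or> Y = U)"

definition periodic_flag :: "'v set set \<Rightarrow> (int \<Rightarrow> 'v set \<Rightarrow> 'v set) \<Rightarrow> nat \<Rightarrow> (int \<Rightarrow> 'v set) \<Rightarrow> bool" where
  "periodic_flag Lat sh p L \<longleftrightarrow> (\<forall>i. L i \<in> Lat) \<and> (\<forall>i. L (i - 1) \<subseteq> L i) \<and> (\<forall>i. L (i - int p) = sh 1 (L i))"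

definition complete_flag ::
    "'v set set \<Rightarrow> 'v set set \<Rightarrow> (int \<Rightarrow> 'v set \<Rightarrow> 'v set) \<Rightarrow> nat \<Rightarrow> (int \<Rightarrow> 'v set) \<Rightarrow> bool" where
  "complete_flag S Lat sh p L \<longleftrightarrow> periodic_flag Lat sh p L \<and> (\<forall>i. covers S (L (i - 1)) (L i))"

text \<open>\<open>g k\<close> is the first \<open>j\<close> for which \<open>N j\<close> contributes to the one-dimensional quotient
  \<open>L k / L (k - 1)\<close> of a complete flag \<open>L\<close>.\<close>
definition rel_pos :: "(int \<Rightarrow> 'v set) \<Rightarrow> (int \<Rightarrow> 'v set) \<Rightarrow> (int \<Rightarrow> int) \<Rightarrow> bool" where
  "rel_pos L N g \<longleftrightarrow> (\<forall>k j. L k \<inter> N j \<subseteq> L (k - 1) \<longleftrightarrow> j < g k)"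

lemma rel_pos_unique: "rel_pos L N g \<Longrightarrow> rel_pos L N g' \<Longrightarrow> g = g'"
proof
  fix k assume a: "rel_pos L N g" "rel_pos L N g'"
  have "j < g k \<longleftrightarrow> j < g' k" for j using a unfolding rel_pos_def by blast
  then show "g k = g' k" by (metis linorder_neqE less_irrefl)
qed

text \<open>\<open>J\<close> is the sum of subspaces, \<open>D U W d\<close> says that \<open>U / W\<close> has dimension \<open>d\<close>, and \<open>sh a\<close> is
  multiplication by the \<open>a\<close>-th power of \<open>\<epsilon>\<close>.\<close>
locale flag_geometry =
  fixes S Lat :: "'v set set" and J :: "'v set \<Rightarrow> 'v set \<Rightarrow> 'v set"
    and D :: "'v set \<Rightarrow> 'v set \<Rightarrow> nat \<Rightarrow> bool" and sh :: "int \<Rightarrow> 'v set \<Rightarrow> 'v set"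
    and n r q :: nat
  assumes n_pos: "n > 0" and r_pos: "r > 0" and q_pos: "q > 0"
    and S_Int: "U \<in> S \<Longrightarrow> W \<in> S \<Longrightarrow> U \<inter> W \<in> S"
    and S_J: "U \<in> S \<Longrightarrow> W \<in> S \<Longrightarrow> J U W \<in> S"
    and J_ub: "U \<in> S \<Longrightarrow> W \<in> S \<Longrightarrow> U \<subseteq> J U W" "U \<in> S \<Longrightarrow> W \<in> S \<Longrightarrow> W \<subseteq> J U W"
    and J_least: "U \<in> S \<Longrightarrow> W \<in> S \<Longrightarrow> X \<in> S \<Longrightarrow> U \<subseteq> X \<Longrightarrow> W \<subseteq> X \<Longrightarrow> J U W \<subseteq> X"
    and modular: "U \<in> S \<Longrightarrow> W \<in> S \<Longrightarrow> X \<in> S \<Longrightarrow> U \<subseteq> X \<Longrightarrow> X \<inter> J U W \<subseteq> J U (X \<inter> W)"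
    and Lat_S: "U \<in> Lat \<Longrightarrow> U \<in> S"
    and sh_0: "U \<in> S \<Longrightarrow> sh 0 U = U"
    and sh_add: "U \<in> S \<Longrightarrow> sh a (sh b U) = sh (a + b) U"
    and sh_S: "U \<in> S \<Longrightarrow> sh a U \<in> S"
    and sh_Lat: "U \<in> Lat \<Longrightarrow> sh a U \<in> Lat"
    and sh_mono: "U \<subseteq> W \<Longrightarrow> sh a U \<subseteq> sh a W"
    and commensurable: "U \<in> Lat \<Longrightarrow> W \<in> Lat \<Longrightarrow> \<exists>m::nat. sh (int m) U \<subseteq> W"
    and Lat_between: "U \<in> Lat \<Longrightarrow> X \<in> Lat \<Longrightarrow> Y \<in> S \<Longrightarrow> U \<subseteq> Y \<Longrightarrow> Y \<subseteq> X \<Longrightarrow> sh 1 X \<subseteq> U \<Longrightarrow> Y \<in> Lat"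
    and line_count: "covers S W U \<Longrightarrow> covers S U X \<Longrightarrow>
      finite {Y \<in> S. W \<subset> Y \<and> Y \<subset> X} \<and> card {Y \<in> S. W \<subset> Y \<and> Y \<subset> X} = Suc q"
    and D_refl: "U \<in> S \<Longrightarrow> D U U 0"
    and D_step: "W \<in> S \<Longrightarrow> W \<subseteq> U \<Longrightarrow> D U W d \<Longrightarrow> covers S U X \<Longrightarrow> D X W (Suc d)"
    and D_unique: "W \<in> S \<Longrightarrow> U \<in> S \<Longrightarrow> W \<subseteq> U \<Longrightarrow> D U W d \<Longrightarrow> D U W d' \<Longrightarrow> d = d'"
    and base_flag: "\<exists>L. complete_flag S Lat sh r L"
begin

abbreviation cov where "cov \<equiv> covers S"
abbreviation pflag where "pflag \<equiv> periodic_flag Lat sh n"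
abbreviation cflag where "cflag \<equiv> complete_flag S Lat sh r"

definition orb :: "(int \<Rightarrow> 'v set) \<Rightarrow> (int \<Rightarrow> 'v set) \<Rightarrow> zmat \<Rightarrow> bool" where
  "orb L L' A \<longleftrightarrow> pflag L \<and> pflag L' \<and>
     (\<forall>i j. D (L i \<inter> L' j) (J (L (i - 1) \<inter> L' j) (L i \<inter> L' (j - 1))) (A i j))"

section \<open>Covers in a modular lattice, and shifts\<close>

lemma J_mono: "U \<in> S \<Longrightarrow> W \<in> S \<Longrightarrow> U' \<in> S \<Longrightarrow> W' \<in> S \<Longrightarrow> U \<subseteq> U' \<Longrightarrow> W \<subseteq> W' \<Longrightarrow> J U W \<subseteq> J U' W'"
  by (rule J_least) (auto simp: S_J intro: subsetD[OF J_ub(1)] subsetD[OF J_ub(2)])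

lemma J_comm: "U \<in> S \<Longrightarrow> W \<in> S \<Longrightarrow> J U W = J W U"
  by (intro equalityI J_least S_J J_ub)

lemma J_absorb: "U \<in> S \<Longrightarrow> W \<in> S \<Longrightarrow> U \<subseteq> W \<Longrightarrow> J U W = W"
  by (intro equalityI J_least J_ub) simp_all

lemma covD:
  assumes "cov W U"
  shows "W \<in> S" "U \<in> S" "W \<subset> U" "\<And>Y. Y \<in> S \<Longrightarrow> W \<subseteq> Y \<Longrightarrow> Y \<subseteq> U \<Longrightarrow> Y = W \<or> Y = U"
  using assms unfolding covers_def by blast+

text \<open>The quotient of \<open>X \<inter> N\<close> by \<open>U \<inter> N\<close> embeds into
  \<open>X / U\<close>. In lattice terms, an intermediate \<open>Y\<close> has
  \<open>J U Y = U\<close> or \<open>J U Y = X\<close>, and in the second case the modular law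
  forces \<open>Y\<close> to be all of \<open>X \<inter> N\<close>.\<close>

lemma cov_Int:
  assumes c: "cov U X" and N: "N \<in> S" and nle: "\<not> X \<inter> N \<subseteq> U"
  shows "cov (U \<inter> N) (X \<inter> N)"
  unfolding covers_def
proof (intro conjI ballI impI)
  note d = covD[OF c]
  show UN: "U \<inter> N \<in> S" and XN: "X \<inter> N \<in> S" using S_Int d N by blast+
  show "U \<inter> N \<subset> X \<inter> N" using d(3) nle by blast
  fix Y assume Y: "Y \<in> S" "U \<inter> N \<subseteq> Y" "Y \<subseteq> X \<inter> N"
  have "J U Y \<subseteq> X" using J_least[OF d(1) Y(1) d(2)] d(3) Y(3) by blast
  then consider "J U Y = U" | "J U Y = X" using d(4)[OF S_J[OF d(1) Y(1)] J_ub(1)[OF d(1) Y(1)]] by blast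
  then show "Y = U \<inter> N \<or> Y = X \<inter> N"
  proof cases
    case 1
    then have "Y \<subseteq> U" using J_ub(2)[OF d(1) Y(1)] by simp
    then show ?thesis using Y by blast
  next
    case 2
    have "X \<inter> N \<subseteq> N \<inter> J Y U" using 2 J_comm[OF d(1) Y(1)] by blast
    also have "\<dots> \<subseteq> J Y (N \<inter> U)" using modular[OF Y(1) d(1) N] Y(3) by blast
    also have "\<dots> \<subseteq> Y" using J_least[OF Y(1) S_Int[OF N d(1)] Y(1)] Y(2) by blast
    finally show ?thesis using Y(3) by blast
  qed
qed

text \<open>The dual of \<open>cov_Int\<close>: the quotient of \<open>J B R\<close> by
  \<open>J A R\<close> is a quotient of \<open>B / A\<close>. An intermediate \<open>Y\<close> is
  decided by \<open>B \<inter> Y\<close>, which is \<open>A\<close> or \<open>B\<close>.\<close>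

lemma cov_J:
  assumes c: "cov A B" and R: "R \<in> S" and nle: "\<not> B \<subseteq> J A R"
  shows "cov (J A R) (J B R)"
  unfolding covers_def
proof (intro conjI ballI impI)
  note d = covD[OF c]
  show AR: "J A R \<in> S" and BR: "J B R \<in> S" using S_J d R by blast+
  have "J A R \<subseteq> J B R" using J_mono[OF d(1) R d(2) R] d(3) by blast
  then show "J A R \<subset> J B R" using nle J_ub(1)[OF d(2) R] by blast
  fix Y assume Y: "Y \<in> S" "J A R \<subseteq> Y" "Y \<subseteq> J B R"
  have AY: "A \<subseteq> Y" and RY: "R \<subseteq> Y" using J_ub[OF d(1) R] Y(2) by blast+
  have "B \<inter> Y = A \<or> B \<inter> Y = B"
  proof (rule d(4))
    show "B \<inter> Y \<in> S" by (rule S_Int[OF d(2) Y(1)])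
    show "A \<subseteq> B \<inter> Y" using AY d(3) by blast
  qed blast
  then show "Y = J A R \<or> Y = J B R"
  proof
    assume "B \<inter> Y = B"
    then have "J B R \<subseteq> Y" using J_least[OF d(2) R Y(1)] RY by blast
    then show ?thesis using Y(3) by blast
  next
    assume e: "B \<inter> Y = A"
    have "Y \<subseteq> Y \<inter> J R B" using Y(3) J_comm[OF d(2) R] by blast
    also have "\<dots> \<subseteq> J R (Y \<inter> B)" by (rule modular[OF R d(2) Y(1) RY])
    also have "\<dots> = J A R" using e J_comm[OF d(1) R] by (simp add: Int_commute)
    finally show ?thesis using Y(2) by blast
  qed
qed

text \<open>In an interval of length two, an intermediate \<open>Y\<close> different from
  \<open>U\<close> is a complement of \<open>U\<close> in the interval, and the two preceding lemmas
  transport the covers through \<open>U\<close> to covers through \<open>Y\<close>.\<close>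

lemma cov_mid:
  assumes c1: "cov W U" and c2: "cov U X" and Y: "Y \<in> S" "W \<subset> Y" "Y \<subset> X"
  shows "cov W Y \<and> cov Y X"
proof (cases "Y = U")
  case False
  note d = covD[OF c1] and e = covD[OF c2]
  have nle: "\<not> U \<subseteq> Y" using e(4)[OF Y(1)] Y(3) False by blast
  have nle': "\<not> Y \<subseteq> U" using d(4)[OF Y(1)] Y(2) False by blast
  have "U \<inter> Y = W \<or> U \<inter> Y = U"
    using d(4)[OF S_Int[OF d(2) Y(1)]] d(3) Y(2) by blast
  then have UY: "U \<inter> Y = W" using nle by blast
  have "J U Y = U \<or> J U Y = X"
    using e(4)[OF S_J[OF e(1) Y(1)] J_ub(1)[OF e(1) Y(1)]] J_least[OF e(1) Y(1) e(2)] e(3) Y(3) by blast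
  then have JUY: "J U Y = X" using nle' J_ub(2)[OF e(1) Y(1)] by blast
  have "cov (U \<inter> Y) (X \<inter> Y)" by (rule cov_Int[OF c2 Y(1)]) (use nle' Y(3) in blast)
  moreover have "X \<inter> Y = Y" using Y(3) by blast
  ultimately have 1: "cov W Y" using UY by simp
  have JWY: "J W Y = Y" by (rule J_absorb[OF d(1) Y(1)]) (use Y(2) in blast)
  have "cov (J W Y) (J U Y)" by (rule cov_J[OF c1 Y(1)]) (simp add: JWY nle)
  then show ?thesis using 1 JWY JUY by simp
qed (use assms in blast)

lemma sh_subset_iff: "U \<in> S \<Longrightarrow> W \<in> S \<Longrightarrow> sh a U \<subseteq> sh a W \<longleftrightarrow> U \<subseteq> W"
  using sh_mono[of "sh a U" "sh a W" "- a"] sh_mono[of U W a] by (auto simp: sh_add sh_0)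

lemma sh_Int: "U \<in> S \<Longrightarrow> W \<in> S \<Longrightarrow> sh a (U \<inter> W) = sh a U \<inter> sh a W"
proof (intro equalityI)
  assume U: "U \<in> S" and W: "W \<in> S"
  show "sh a (U \<inter> W) \<subseteq> sh a U \<inter> sh a W" using sh_mono[of "U \<inter> W"] by blast
  let ?X = "sh a U \<inter> sh a W"
  have X: "?X \<in> S" using U W S_Int sh_S by blast
  have "sh (- a) ?X \<subseteq> sh (- a) (sh a U)" "sh (- a) ?X \<subseteq> sh (- a) (sh a W)" by (rule sh_mono, blast)+
  then have "sh (- a) ?X \<subseteq> U \<inter> W" using U W by (simp add: sh_add sh_0)
  then have "sh a (sh (- a) ?X) \<subseteq> sh a (U \<inter> W)" by (rule sh_mono)
  then show "?X \<subseteq> sh a (U \<inter> W)" using X by (simp add: sh_add sh_0)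
qed

lemma cov_sh:
  assumes "cov U X" shows "cov (sh a U) (sh a X)"
  unfolding covers_def
proof (intro conjI ballI impI)
  note d = covD[OF assms]
  show "sh a U \<in> S" "sh a X \<in> S" using d sh_S by blast+
  show "sh a U \<subset> sh a X" using d(3) sh_subset_iff[OF d(1,2)] sh_subset_iff[OF d(2,1)] by blast
  fix Y assume Y: "Y \<in> S" "sh a U \<subseteq> Y" "Y \<subseteq> sh a X"
  have "sh (- a) (sh a U) \<subseteq> sh (- a) Y" "sh (- a) Y \<subseteq> sh (- a) (sh a X)" using Y sh_mono by blast+
  then have "sh (- a) Y = U \<or> sh (- a) Y = X" using d(4)[OF sh_S[OF Y(1)]] d by (simp add: sh_add sh_0)
  then have "sh a (sh (- a) Y) = sh a U \<or> sh a (sh (- a) Y) = sh a X" by auto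
  then show "Y = sh a U \<or> Y = sh a X" using Y(1) by (simp add: sh_add sh_0)
qed

section \<open>Periodic flags and relative positions\<close>

lemma pf_mono:
  assumes "periodic_flag Lat sh p L" "i \<le> j" shows "L i \<subseteq> L j"
proof -
  have "mono L" unfolding mono_int_iff using assms(1) unfolding periodic_flag_def
    by (metis add_diff_cancel_right')
  then show ?thesis using assms(2) by (rule monoD)
qed

lemma pf_S: "periodic_flag Lat sh p L \<Longrightarrow> L i \<in> S"
  using Lat_S by (simp add: periodic_flag_def)

lemma pf_shift:
  assumes L: "periodic_flag Lat sh p L" shows "L (i - m * int p) = sh m (L i)"
proof (induction m rule: int_induct[where k = 0])
  case base show ?case using sh_0 pf_S[OF L] by simp
next
  case (step1 m)
  have "L ((i - m * int p) - int p) = sh 1 (L (i - m * int p))" using L by (simp only: periodic_flag_def)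
  then show ?case using step1 sh_add[OF pf_S[OF L]] by (simp add: algebra_simps)
next
  case (step2 m)
  have "L ((i - (m - 1) * int p) - int p) = sh 1 (L (i - (m - 1) * int p))" using L by (simp only: periodic_flag_def)
  then have "L (i - m * int p) = sh 1 (L (i - (m - 1) * int p))" by (simp add: algebra_simps)
  then have "sh (-1) (sh m (L i)) = sh (-1) (sh 1 (L (i - (m - 1) * int p)))" using step2 by simp
  then show ?case by (simp add: sh_add sh_0 pf_S[OF L])
qed

lemma pf_add: "periodic_flag Lat sh p L \<Longrightarrow> L (i + m * int p) = sh (- m) (L i)"
  using pf_shift[of p L i "- m"] by simp

lemma cflag_pf: "cflag L \<Longrightarrow> periodic_flag Lat sh r L"
  by (simp add: complete_flag_def)

lemma cflag_cov: "cflag L \<Longrightarrow> cov (L (i - 1)) (L i)"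
  by (simp add: complete_flag_def)

text \<open>Any two lattices are commensurable, so far enough down one flag lies below a given
  member of the other. This and its dual make the thresholds that define a position finite.\<close>

lemma flags_cofinal:
  assumes L: "periodic_flag Lat sh p L" and N: "periodic_flag Lat sh p' N" and p: "p > 0"
  obtains a where "\<And>j. j \<le> a \<Longrightarrow> L j \<subseteq> N k"
proof -
  have "L 0 \<in> Lat" "N k \<in> Lat" using L N by (simp_all add: periodic_flag_def)
  then obtain m where m: "sh (int m) (L 0) \<subseteq> N k" using commensurable by blast
  have "L (0 - int m * int p) \<subseteq> N k" using pf_shift[OF L, of 0 "int m"] m by simp
  then show thesis using that pf_mono[OF L] by (metis order_trans)
qed

lemma flags_coinitial:
  assumes L: "periodic_flag Lat sh p L" and N: "periodic_flag Lat sh p' N" and p: "p > 0"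
  obtains a where "\<And>j. j \<ge> a \<Longrightarrow> N k \<subseteq> L j"
proof -
  have "L 0 \<in> Lat" "N k \<in> Lat" using L N by (simp_all add: periodic_flag_def)
  then obtain m where m: "sh (int m) (N k) \<subseteq> L 0" using commensurable by blast
  have "sh (- int m) (sh (int m) (N k)) \<subseteq> sh (- int m) (L 0)" using m by (rule sh_mono)
  then have "N k \<subseteq> L (0 + int m * int p)" using pf_add[OF L, of 0 "int m"] by (simp add: sh_add sh_0 pf_S[OF N])
  then show thesis using that pf_mono[OF L] by (metis order_trans)
qed

lemma rel_pos_ex:
  assumes L: "cflag L" and N: "pflag N"
  obtains g where "rel_pos L N g"
proof -
  have "\<exists>g. \<forall>j. L k \<inter> N j \<subseteq> L (k - 1) \<longleftrightarrow> j < g" for k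
  proof -
    obtain a where a: "\<And>j. j \<le> a \<Longrightarrow> N j \<subseteq> L (k - 1)"
      using flags_cofinal[OF N cflag_pf[OF L] n_pos, where k = "k - 1"] by blast
    obtain b where b: "\<And>j. j \<ge> b \<Longrightarrow> L k \<subseteq> N j"
      using flags_coinitial[OF N cflag_pf[OF L] n_pos, where k = k] by blast
    let ?P = "\<lambda>j. L k \<inter> N j \<subseteq> L (k - 1)"
    have Pa: "?P a" using a[OF order_refl] by (rule le_infI2)
    have "L k \<inter> N b = L k" using b[OF order_refl] by (rule Int_absorb2)
    then have Pb: "\<not> ?P b" using covD(3)[OF cflag_cov[OF L, of k]] by simp
    have "?P j'" if "?P j" "j' \<le> j" for j j'
      using that(1) Int_mono[OF order_refl pf_mono[OF N that(2)], of "L k"] by (rule order_trans[rotated])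
    then obtain g where "\<And>j. ?P j \<longleftrightarrow> j < g" using int_threshold[of ?P, OF _ Pa Pb] by blast
    then show ?thesis by blast
  qed
  then have "\<exists>g. \<forall>k j. L k \<inter> N j \<subseteq> L (k - 1) \<longleftrightarrow> j < g k" by (rule choice[OF allI])
  then show thesis using that unfolding rel_pos_def by blast
qed

text \<open>The shift moves \<open>L\<close> by \<open>r\<close> places and \<open>N\<close> by
  \<open>n\<close> places and preserves intersections and inclusions.\<close>

lemma rel_pos_pmaps:
  assumes L: "cflag L" and N: "pflag N" and g: "rel_pos L N g"
  shows "g \<in> pmaps n r"
proof -
  note pL = cflag_pf[OF L]
  have "g (k + int r) = g k + int n" for k
  proof -
    have "j < g k \<longleftrightarrow> j + int n < g (k + int r)" for j
    proof -
      have e: "L (k + int r) = sh (-1) (L k)" "N (j + int n) = sh (-1) (N j)" "L (k + int r - 1) = sh (-1) (L (k - 1))"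
        using pf_add[OF pL, of k 1] pf_add[OF N, of j 1] pf_add[OF pL, of "k - 1" 1] by (simp_all add: algebra_simps)
      have "j + int n < g (k + int r) \<longleftrightarrow> L (k + int r) \<inter> N (j + int n) \<subseteq> L (k + int r - 1)"
        using g unfolding rel_pos_def by blast
      also have "\<dots> \<longleftrightarrow> L k \<inter> N j \<subseteq> L (k - 1)"
        unfolding e sh_Int[OF pf_S[OF pL] pf_S[OF N], symmetric]
        by (rule sh_subset_iff[OF S_Int[OF pf_S[OF pL] pf_S[OF N]] pf_S[OF pL]])
      also have "\<dots> \<longleftrightarrow> j < g k" using g unfolding rel_pos_def by blast
      finally show ?thesis by blast
    qed
    from this[of "g k"] this[of "g k - 1"] show ?thesis by linarith
  qed
  then show ?thesis by (simp add: pmaps_def)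
qed

subsection \<open>Varying one member of a complete flag\<close>

text \<open>The panels of type \<open>i\<close> of an affine building. Periodicity makes all members
  at places \<open>i + m r\<close> vary together, so a flag of the panel is one choice of
  \<open>M i\<close>.\<close>

definition panel :: "(int \<Rightarrow> 'v set) \<Rightarrow> int \<Rightarrow> (int \<Rightarrow> 'v set) set" where
  "panel L i = {M. cflag M \<and> (\<forall>k. (k - i) mod int r \<noteq> 0 \<longrightarrow> M k = L k)}"

abbreviation mids :: "'v set \<Rightarrow> 'v set \<Rightarrow> 'v set set" where
  "mids W X \<equiv> {Y \<in> S. W \<subset> Y \<and> Y \<subset> X}"

lemma panel_neighbours:
  assumes "r \<ge> 2" "M \<in> panel L i"
  shows "M (i - 1) = L (i - 1)" "M (i + 1) = L (i + 1)"
proof -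
  have "(-1) mod int r \<noteq> 0" "(1 :: int) mod int r \<noteq> 0" using assms(1) by (simp_all add: zmod_minus1)
  then show "M (i - 1) = L (i - 1)" "M (i + 1) = L (i + 1)" using assms(2) unfolding panel_def by simp_all
qed

lemma panel_self: "cflag L \<Longrightarrow> L \<in> panel L i"
  by (simp add: panel_def)

lemma panel_eq: "M \<in> panel L i \<Longrightarrow> panel M i = panel L i"
  by (auto simp: panel_def)

lemma mod_0_imp: "(k - i) mod int r = 0 \<Longrightarrow> k = i + ((k - i) div int r) * int r"
  using div_mult_mod_eq[of "k - i" "int r"] by simp

text \<open>By periodicity \<open>M i\<close> determines \<open>M\<close>. Conversely any
  \<open>Y\<close> strictly between the neighbours is a lattice, and its shifts can be inserted at
  all places \<open>i + m r\<close>.\<close>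

lemma panel_bij:
  assumes L: "cflag L" and r: "r \<ge> 2"
  shows "bij_betw (\<lambda>M. M i) (panel L i) (mids (L (i - 1)) (L (i + 1)))"
proof (rule bij_betw_imageI)
  show "inj_on (\<lambda>M. M i) (panel L i)"
  proof (rule inj_onI, rule ext)
    fix M M' k assume M: "M \<in> panel L i" "M' \<in> panel L i" and e: "M i = M' i"
    show "M k = M' k"
    proof (cases "(k - i) mod int r = 0")
      case True
      have p: "periodic_flag Lat sh r M" "periodic_flag Lat sh r M'" using M cflag_pf by (auto simp: panel_def)
      show ?thesis using pf_add[OF p(1), of i "(k - i) div int r"] pf_add[OF p(2), of i "(k - i) div int r"]
          mod_0_imp[OF True] e by simp
    qed (use M in \<open>auto simp: panel_def\<close>)
  qed
  note pL = cflag_pf[OF L]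
  have c1: "cov (L (i - 1)) (L i)" and c2: "cov (L i) (L (i + 1))"
    using cflag_cov[OF L, of i] cflag_cov[OF L, of "i + 1"] by simp_all
  show "(\<lambda>M. M i) ` panel L i = mids (L (i - 1)) (L (i + 1))"
  proof (intro equalityI subsetI)
    fix Y assume "Y \<in> (\<lambda>M. M i) ` panel L i"
    then obtain M where M: "M \<in> panel L i" and Y: "Y = M i" by blast
    have cM: "cflag M" using M by (simp add: panel_def)
    show "Y \<in> mids (L (i - 1)) (L (i + 1))"
      using covD[OF cflag_cov[OF cM, of i]] covD[OF cflag_cov[OF cM, of "i + 1"]]
        panel_neighbours[OF r M] Y by simp
  next
    fix Y assume "Y \<in> mids (L (i - 1)) (L (i + 1))"
    then have Y: "Y \<in> S" "L (i - 1) \<subset> Y" "Y \<subset> L (i + 1)" by simp_all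
    have cY: "cov (L (i - 1)) Y" "cov Y (L (i + 1))" using cov_mid[OF c1 c2 Y] by simp_all
    \<comment> \<open>This uses \<open>r >= 2\<close>, as the left side is
      \<open>L (i + 1 - r)\<close>. It is the bound under which an intermediate subspace is a
      lattice.\<close>
    have "sh 1 (L (i + 1)) \<subseteq> L (i - 1)"
      using pf_shift[OF pL, of "i + 1" 1] pf_mono[OF pL, of "i + 1 - int r" "i - 1"] r by simp
    moreover have "L (i - 1) \<in> Lat" "L (i + 1) \<in> Lat" using pL by (simp_all add: periodic_flag_def)
    ultimately have YL: "Y \<in> Lat" using Lat_between Y by blast
    define M where "M k = (if (k - i) mod int r = 0 then sh (- ((k - i) div int r)) Y else L k)" for k
    have Mi: "M i = Y" using sh_0[OF Y(1)] by (simp add: M_def)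
    have "covers S (M (k - 1)) (M k)" for k
    proof (cases "(k - i) mod int r = 0")
      case True
      define m where "m = (k - i) div int r"
      have k: "k = i + m * int r" using mod_0_imp[OF True] m_def by simp
      have "k - 1 - i = -1 + m * int r" using k by simp
      then have "(k - 1 - i) mod int r = (-1) mod int r" by (simp only: mod_mult_self1)
      then have "(k - 1 - i) mod int r \<noteq> 0" using r by (simp add: zmod_minus1)
      then have "M (k - 1) = L ((i - 1) + m * int r)" using k by (simp add: M_def algebra_simps)
      then have "M (k - 1) = sh (- m) (L (i - 1))" using pf_add[OF pL] by simp
      moreover have "M k = sh (- m) Y" using True by (simp add: M_def m_def)
      ultimately show ?thesis using cov_sh[OF cY(1)] by simp
    next
      case F: False
      show ?thesis
      proof (cases "(k - 1 - i) mod int r = 0")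
        case True
        define m where "m = (k - 1 - i) div int r"
        have k: "k - 1 = i + m * int r" using mod_0_imp[OF True] m_def by simp
        have "M k = L ((i + 1) + m * int r)" using k F by (simp add: M_def algebra_simps)
        then have "M k = sh (- m) (L (i + 1))" using pf_add[OF pL] by simp
        moreover have "M (k - 1) = sh (- m) Y" using True by (simp add: M_def m_def)
        ultimately show ?thesis using cov_sh[OF cY(2)] by simp
      qed (use F cflag_cov[OF L, of k] in \<open>simp add: M_def\<close>)
    qed
    moreover have "M k \<in> Lat" for k using YL sh_Lat pL by (simp add: M_def periodic_flag_def)
    moreover have "M (k - int r) = sh 1 (M k)" for k
    proof -
      have e: "k - int r - i = (k - i) + (-1) * int r" by simp
      have "(k - int r - i) mod int r = (k - i) mod int r" "(k - int r - i) div int r = (k - i) div int r - 1"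
        unfolding e mod_mult_self1 using r div_mult_self1[of "int r" "k - i" "-1"] by simp_all
      then show ?thesis using pf_shift[OF pL, of k 1] by (simp add: M_def sh_add[OF Y(1)])
    qed
    ultimately have "cflag M" unfolding complete_flag_def periodic_flag_def using covD(3) by blast
    then have "M \<in> panel L i" by (simp add: panel_def M_def)
    then show "Y \<in> (\<lambda>M. M i) ` panel L i" using Mi by blast
  qed
qed

lemma panel_card:
  assumes L: "cflag L" and r: "r \<ge> 2"
  shows "finite (panel L i)" "card (panel L i) = Suc q"
proof -
  have "cov (L (i - 1)) (L i)" "cov (L i) (L (i + 1))"
    using cflag_cov[OF L, of i] cflag_cov[OF L, of "i + 1"] by simp_all
  note lc = line_count[OF this]
  show "finite (panel L i)" using bij_betw_finite[OF panel_bij[OF L r, of i]] lc by simp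
  show "card (panel L i) = Suc q" using bij_betw_same_card[OF panel_bij[OF L r, of i]] lc by simp
qed

text \<open>The two conditions of \<open>rel_pos\<close> at consecutive steps
  \<open>W < Y < X\<close>, isolated so that the middle member can vary while \<open>W\<close> and
  \<open>X\<close> stay fixed.\<close>

definition mid_pos :: "(int \<Rightarrow> 'v set) \<Rightarrow> 'v set \<Rightarrow> 'v set \<Rightarrow> 'v set \<Rightarrow> int \<Rightarrow> int \<Rightarrow> bool" where
  "mid_pos N W Y X a b \<longleftrightarrow> (\<forall>j. Y \<inter> N j \<subseteq> W \<longleftrightarrow> j < a) \<and> (\<forall>j. X \<inter> N j \<subseteq> Y \<longleftrightarrow> j < b)"

text \<open>The filtration induced by \<open>N\<close> on the two-dimensional quotient \<open>X / W\<close> either jumps by two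
  at \<open>a\<close>, or jumps at \<open>a < b\<close> and singles out the line \<open>Y0 / W\<close>.\<close>
lemma mid_pos_cases:
  assumes c1: "cov W U" and c2: "cov U X" and N: "\<And>j. N j \<in> S" "\<And>i j. i \<le> j \<Longrightarrow> N i \<subseteq> N j"
    and lo: "N l \<subseteq> W" and up: "X \<subseteq> N u"
  obtains a where "\<And>Y. Y \<in> mids W X \<Longrightarrow> mid_pos N W Y X a a"
  | a b Y0 where "a < b" "Y0 \<in> mids W X" "mid_pos N W Y0 X a b"
      "\<And>Y. Y \<in> mids W X \<Longrightarrow> Y \<noteq> Y0 \<Longrightarrow> mid_pos N W Y X b a"
proof -
  have W: "W \<in> S" and X: "X \<in> S" and WX: "W \<subset> X" using covD[OF c1] covD[OF c2] by blast+
  have XN: "X \<inter> N j \<in> S" for j using S_Int X N by blast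
  have XNmono: "X \<inter> N i \<subseteq> X \<inter> N j" if "i \<le> j" for i j using N(2)[OF that] by blast
  have "\<not> X \<inter> N u \<subseteq> W" using up WX by blast
  moreover have "X \<inter> N l \<subseteq> W" using lo by blast
  moreover have "X \<inter> N j' \<subseteq> W" if "X \<inter> N j \<subseteq> W" "j' \<le> j" for j j' using XNmono that by blast
  ultimately obtain a where a: "\<And>j. X \<inter> N j \<subseteq> W \<longleftrightarrow> j < a"
    using int_threshold[of "\<lambda>j. X \<inter> N j \<subseteq> W"] by blast
  \<comment> \<open>\<open>a\<close> is where \<open>N\<close> begins to contribute to
    \<open>X / W\<close>; \<open>b\<close> will be where it fills \<open>X / W\<close>.\<close>
  let ?P = "\<lambda>j. \<not> X \<subseteq> J W (X \<inter> N j)"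
  have "X \<inter> N u = X" using up by blast
  then have Pu: "\<not> ?P u" using J_ub(2)[OF W X] by simp
  have Pl: "?P l" using J_least[OF W XN W] lo WX by blast
  have "?P j'" if "?P j" "j' \<le> j" for j j'
    using J_mono[OF W XN W XN order_refl XNmono[OF that(2)]] that(1) by blast
  then obtain b where b: "\<And>j. ?P j \<longleftrightarrow> j < b" using int_threshold[of ?P, OF _ Pl Pu] by blast
  have "?P (a - 1)"
  proof -
    have "X \<inter> N (a - 1) \<subseteq> W" using a by simp
    then have "J W (X \<inter> N (a - 1)) \<subseteq> W" using J_least[OF W XN W order_refl] by blast
    then show ?thesis using WX by blast
  qed
  then have ab: "a \<le> b" using b[of "a - 1"] by linarith
  have hi: "\<not> Y \<inter> N j \<subseteq> W" "\<not> X \<inter> N j \<subseteq> Y" if Y: "Y \<in> mids W X" and j: "b \<le> j" for Y j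
  proof -
    have XJ: "X \<subseteq> J W (X \<inter> N j)" using b[of j] j by linarith
    show "\<not> X \<inter> N j \<subseteq> Y" using J_least[OF W XN, of Y j] XJ Y by blast
    show "\<not> Y \<inter> N j \<subseteq> W"
    proof
      assume s: "Y \<inter> N j \<subseteq> W"
      have YS: "Y \<in> S" "W \<subseteq> Y" "Y \<subseteq> X" using Y by blast+
      have "Y \<subseteq> Y \<inter> J W (X \<inter> N j)" using XJ YS by blast
      also have "\<dots> \<subseteq> J W (Y \<inter> (X \<inter> N j))" by (rule modular[OF W XN YS(1,2)])
      also have "\<dots> \<subseteq> W" by (rule J_least[OF W S_Int[OF YS(1) XN] W order_refl]) (use s in blast)
      finally show False using Y by blast
    qed
  qed
  have lo': "Y \<inter> N j \<subseteq> W \<and> X \<inter> N j \<subseteq> Y" if Y: "Y \<in> mids W X" and j: "j < a" for Y j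
    using a j Y by blast
  show thesis
  proof (cases "a = b")
    case True
    have "mid_pos N W Y X a a" if "Y \<in> mids W X" for Y
      unfolding mid_pos_def using hi[OF that] lo'[OF that] True by (meson not_le)
    then show thesis by (rule that(1))
  next
    case False
    then have lt: "a < b" using ab by simp
    \<comment> \<open>For all \<open>j\<close> with \<open>a <= j < b\<close> the image of
      \<open>X \<inter> N j\<close> in \<open>X / W\<close> is the same line; it is taken at
      \<open>j = a\<close>.\<close>
    define Y0 where "Y0 = J W (X \<inter> N a)"
    have Y0S: "Y0 \<in> S" unfolding Y0_def by (rule S_J[OF W XN])
    have WY0: "W \<subseteq> Y0" and NY0: "X \<inter> N a \<subseteq> Y0" unfolding Y0_def using J_ub[OF W XN] by blast+
    have Y0X: "Y0 \<subseteq> X" unfolding Y0_def by (rule J_least[OF W XN X]) (use WX in blast)+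
    have "\<not> X \<inter> N a \<subseteq> W" using a by blast
    then have "W \<noteq> Y0" using NY0 by blast
    moreover have "Y0 \<noteq> X" using b lt unfolding Y0_def by blast
    ultimately have Y0: "Y0 \<in> mids W X" using Y0S WY0 Y0X by blast
    have cY0: "cov W Y0" "cov Y0 X" using cov_mid[OF c1 c2] Y0 by blast+
    have in0: "X \<inter> N j \<subseteq> Y0" if "j < b" for j
    proof (cases "j < a")
      case False
      have s: "Y0 \<subseteq> J W (X \<inter> N j)" unfolding Y0_def
        by (rule J_mono[OF W XN W XN order_refl XNmono]) (use False in simp)
      have "J W (X \<inter> N j) \<subseteq> X" by (rule J_least[OF W XN X]) (use WX in blast)+
      then have "J W (X \<inter> N j) = Y0" using covD(4)[OF cY0(2) S_J[OF W XN] s] b that by blast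
      then show ?thesis using J_ub(2)[OF W XN] by blast
    qed (use a WY0 in blast)
    have "mid_pos N W Y0 X a b"
      unfolding mid_pos_def
    proof (intro conjI allI)
      fix j
      show "X \<inter> N j \<subseteq> Y0 \<longleftrightarrow> j < b" using in0 hi(2)[OF Y0] by (meson not_le)
      have "\<not> Y0 \<inter> N j \<subseteq> W" if "a \<le> j"
      proof -
        have "X \<inter> N a \<subseteq> Y0 \<inter> N j" using NY0 N(2)[OF that] by blast
        then show ?thesis using \<open>\<not> X \<inter> N a \<subseteq> W\<close> by blast
      qed
      then show "Y0 \<inter> N j \<subseteq> W \<longleftrightarrow> j < a" using lo'[OF Y0] by (meson not_le)
    qed
    moreover have "mid_pos N W Y X b a" if Y: "Y \<in> mids W X" "Y \<noteq> Y0" for Y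
      unfolding mid_pos_def
    proof (intro conjI allI)
      fix j
      have YS: "Y \<in> S" "W \<subset> Y" "Y \<subset> X" using Y by blast+
      have cY: "cov W Y" using cov_mid[OF c1 c2 YS] by blast
      have nle: "\<not> Y0 \<subseteq> Y" using covD(4)[OF cY0(2) YS(1)] YS Y(2) by blast
      have "Y \<inter> Y0 = W"
        using covD(4)[OF cY0(1) S_Int[OF YS(1) Y0S]] YS(2) WY0 nle by blast
      then have "Y \<inter> N j \<subseteq> W" if "j < b" using in0[OF that] YS(3) by blast
      then show "Y \<inter> N j \<subseteq> W \<longleftrightarrow> j < b" using hi(1)[OF Y(1)] by (meson not_le)
      have "\<not> X \<inter> N j \<subseteq> Y" if "a \<le> j"
      proof
        assume "X \<inter> N j \<subseteq> Y"
        then have "X \<inter> N a \<subseteq> Y" using XNmono[OF that] by blast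
        then have "Y0 \<subseteq> Y" unfolding Y0_def using J_least[OF W XN YS(1)] YS(2) by blast
        then show False using nle by blast
      qed
      then show "X \<inter> N j \<subseteq> Y \<longleftrightarrow> j < a" using lo'[OF Y(1)] by (meson not_le)
    qed
    ultimately show thesis by (rule that(2)[OF lt Y0])
  qed
qed

end

subsection \<open>Counting flags in given relative positions\<close>

lemma sw_fix:
  assumes r: "r \<ge> 2" and g: "g \<in> pmaps n r" and e: "g i = g (i + 1)"
  shows "g \<circ> sw r i = g"
proof
  fix k
  have a: "g (i + m * int r) = g (i + 1 + m * int r)" for m
    using pmaps_add_mult[OF g] e by simp
  have "g (sw r i k) = g k" if "(k - i) mod int r = 0"
    using that div_mult_mod_eq[of "k - i" "int r"] a[of "(k - i) div int r"] by (simp add: sw_def algebra_simps)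
  moreover have "g (sw r i k) = g k" if c: "(k - i) mod int r = 1"
  proof -
    have "k - 1 = i + ((k - i) div int r) * int r" "k = i + 1 + ((k - i) div int r) * int r"
      using c div_mult_mod_eq[of "k - i" "int r"] by linarith+
    then have "g (k - 1) = g k" using a by metis
    then show ?thesis using c by (simp add: sw_def)
  qed
  moreover have "g (sw r i k) = g k" if "(k - i) mod int r \<noteq> 0" "(k - i) mod int r \<noteq> 1"
    using that by (simp add: sw_def)
  ultimately show "(g \<circ> sw r i) k = g k" by (metis comp_apply)
qed

lemma pmaps_eq_off_pair:
  assumes r: "r \<ge> 2" and g: "g \<in> pmaps n r" "g' \<in> pmaps n r" and e: "g i = g' i" "g (i + 1) = g' (i + 1)"
    and o: "\<And>k. (k - i) mod int r \<noteq> 0 \<Longrightarrow> (k - i) mod int r \<noteq> 1 \<Longrightarrow> g k = g' k"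
  shows "g = g'"
proof
  fix k
  have c: "k = i + m + ((k - i) div int r) * int r" if "(k - i) mod int r = m" for m
    using div_mult_mod_eq[of "k - i" "int r"] that by linarith
  consider "(k - i) mod int r = 0" | "(k - i) mod int r = 1" | "(k - i) mod int r \<noteq> 0" "(k - i) mod int r \<noteq> 1" by blast
  then show "g k = g' k"
  proof cases
    case 1 then show ?thesis using c[OF 1] pmaps_add_mult[OF g(1)] pmaps_add_mult[OF g(2)] e by (metis add_0_right)
  next
    case 2 then show ?thesis using c[OF 2] pmaps_add_mult[OF g(1)] pmaps_add_mult[OF g(2)] e by metis
  qed (use o in blast)
qed

text \<open>The largest \<open>k\<close> with \<open>g k \<le> j\<close>; meaningful for monotone periodic \<open>g\<close> only.\<close>
definition bnd :: "(int \<Rightarrow> int) \<Rightarrow> int \<Rightarrow> int" where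
  "bnd g j = (SOME b. \<forall>k. g k \<le> j \<longleftrightarrow> k \<le> b)"

lemma bnd_iff:
  assumes g: "g \<in> pmaps n r" and n: "n > 0" and r: "r > 0" and m: "mono g"
  shows "g k \<le> j \<longleftrightarrow> k \<le> bnd g j"
proof -
  have "\<exists>k. g k \<le> j"
  proof -
    have "g (0 - \<bar>g 0 - j\<bar> * int r) = g 0 - \<bar>g 0 - j\<bar> * int n"
      using pmaps_add_mult[OF g, of 0 "- \<bar>g 0 - j\<bar>"] by simp
    moreover have "\<bar>g 0 - j\<bar> * 1 \<le> \<bar>g 0 - j\<bar> * int n" by (rule mult_left_mono) (use n in auto)
    ultimately have "g (0 - \<bar>g 0 - j\<bar> * int r) \<le> j" by simp
    then show ?thesis by blast
  qed
  then obtain a where a: "g a \<le> j" by blast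
  have "\<exists>k. \<not> g k \<le> j"
  proof -
    define x where "x = \<bar>g 0 - j\<bar> + 1"
    have "x \<ge> 0" "g 0 + x > j" unfolding x_def by linarith+
    moreover have "g (0 + x * int r) = g 0 + x * int n" by (rule pmaps_add_mult[OF g])
    moreover have "x * 1 \<le> x * int n" by (rule mult_left_mono) (use n \<open>x \<ge> 0\<close> in auto)
    ultimately have "\<not> g (0 + x * int r) \<le> j" by linarith
    then show ?thesis by blast
  qed
  then obtain b where b: "\<not> g b \<le> j" by blast
  have "g k' \<le> j" if "g k \<le> j" "k' \<le> k" for k k' using monoD[OF m that(2)] that(1) by simp
  then obtain t where t: "\<And>k. g k \<le> j \<longleftrightarrow> k < t" using int_threshold[of "\<lambda>k. g k \<le> j", OF _ a b] by blast
  have "\<forall>k. g k \<le> j \<longleftrightarrow> k \<le> t - 1" using t by auto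
  then have "\<forall>k. g k \<le> j \<longleftrightarrow> k \<le> bnd g j" unfolding bnd_def by (rule someI)
  then show ?thesis by blast
qed

lemma bnd_eqI: "(\<And>k. g k \<le> j \<longleftrightarrow> k \<le> b) \<Longrightarrow> (\<And>k. g k \<le> j \<longleftrightarrow> k \<le> bnd g j) \<Longrightarrow> bnd g j = b"
  by (meson order.antisym order_refl)

text \<open>The relation follows the recursion for structure constants of the affine Hecke algebra;
  the polynomials give the number of flags at position \<open>g\<close> from one flag and \<open>B\<close> to another.\<close>
inductive count_poly :: "nat \<Rightarrow> zmat \<Rightarrow> (int \<Rightarrow> int) \<Rightarrow> (int \<Rightarrow> int) \<Rightarrow> int poly \<Rightarrow> bool" for r B where
  sorted: "mono g \<Longrightarrow> count_poly r B g h (if rmat g h = B then 1 else 0)"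
| up: "r \<ge> 2 \<Longrightarrow> g (i + 1) < g i \<Longrightarrow> h i \<le> h (i + 1) \<Longrightarrow> count_poly r B (g \<circ> sw r i) (h \<circ> sw r i) p \<Longrightarrow>
    count_poly r B g h ([:0, 1:] * p)"
| down: "r \<ge> 2 \<Longrightarrow> g (i + 1) < g i \<Longrightarrow> h (i + 1) < h i \<Longrightarrow> count_poly r B (g \<circ> sw r i) (h \<circ> sw r i) p \<Longrightarrow>
    count_poly r B (g \<circ> sw r i) h p' \<Longrightarrow> count_poly r B g h (p + [:-1, 1:] * p')"

text \<open>The descents of \<open>g\<close> may be removed in different orders. Whichever order is
  taken, \<open>reach_card\<close> applies, because it holds for every polynomial that the relation
  admits.\<close>

lemma count_poly_ex:
  assumes "n > 0" "r > 0" "g \<in> pmaps n r"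
  shows "\<forall>h. \<exists>p. count_poly r B g h p"
  using assms
proof (induction rule: pmaps_descent_induct)
  case (sorted g) then show ?case using count_poly.sorted by blast
next
  case (descent g i)
  show ?case
  proof
    fix h
    obtain p p' where p: "count_poly r B (g \<circ> sw r i) (h \<circ> sw r i) p" "count_poly r B (g \<circ> sw r i) h p'"
      using descent(4) by blast
    then show "\<exists>p. count_poly r B g h p"
      using count_poly.up[OF descent(1,3)] count_poly.down[OF descent(1,3)] by (meson not_le)
  qed
qed

text \<open>At 1 the factor in \<open>up\<close> becomes 1 and the factor of \<open>p'\<close> in
  \<open>down\<close> becomes 0. What remains is a simultaneous reindexing of \<open>g\<close> and
  \<open>h\<close>, harmless by \<open>rmat_reindex\<close>.\<close>

lemma count_poly_at_1: "count_poly r B g h p \<Longrightarrow> poly p 1 = (if rmat g h = B then 1 else 0)"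
  by (induction rule: count_poly.induct) (simp_all add: rmat_reindex[OF sw_bij, unfolded comp_def] comp_def)

section \<open>Positions within a panel, and orbits from positions\<close>

context flag_geometry
begin

text \<open>The value of a position at \<open>k\<close> involves only the members at
  \<open>k\<close> and \<open>k - 1\<close>. A change of \<open>M i\<close> therefore affects it
  only at \<open>i\<close> and \<open>i + 1\<close> modulo \<open>r\<close>, and there
  \<open>mid_pos\<close> gives the values.\<close>

lemma panel_pos:
  assumes L: "cflag L" and N: "pflag N" and g: "rel_pos L N g" and r: "r \<ge> 2" and M: "M \<in> panel L i"
    and p: "mid_pos N (L (i - 1)) (M i) (L (i + 1)) a b"
    and g': "g' \<in> pmaps n r" "g' i = a" "g' (i + 1) = b"
      "\<And>k. (k - i) mod int r \<noteq> 0 \<Longrightarrow> (k - i) mod int r \<noteq> 1 \<Longrightarrow> g' k = g k"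
  shows "rel_pos M N g'"
proof -
  have cM: "cflag M" using M by (simp add: panel_def)
  obtain f where f: "rel_pos M N f" by (rule rel_pos_ex[OF cM N])
  note nb = panel_neighbours[OF r M]
  have "f = g'"
  proof (rule pmaps_eq_off_pair[OF r rel_pos_pmaps[OF cM N f] g'(1)])
    have "j < f i \<longleftrightarrow> j < a" for j using f p nb unfolding rel_pos_def mid_pos_def by metis
    then show "f i = g' i" unfolding g' by (metis linorder_neqE less_irrefl)
    have "j < f (i + 1) \<longleftrightarrow> j < b" for j using f p nb unfolding rel_pos_def mid_pos_def by (metis add_diff_cancel_right')
    then show "f (i + 1) = g' (i + 1)" unfolding g' by (metis linorder_neqE less_irrefl)
    fix k assume k: "(k - i) mod int r \<noteq> 0" "(k - i) mod int r \<noteq> 1"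
    have "(k - 1 - i) mod int r \<noteq> 0"
    proof
      assume z: "(k - 1 - i) mod int r = 0"
      have "k - i = 1 + ((k - 1 - i) div int r) * int r" using mod_0_imp[OF z] by simp
      then have "(k - i) mod int r = 1 mod int r" by (simp only: mod_mult_self1)
      then show False using k(2) r by simp
    qed
    then have "M k = L k" "M (k - 1) = L (k - 1)" using M k unfolding panel_def by blast+
    then have "j < f k \<longleftrightarrow> j < g k" for j using f g unfolding rel_pos_def by metis
    then show "f k = g' k" unfolding g'(4)[OF k] by (metis linorder_neqE less_irrefl)
  qed
  then show ?thesis using f by simp
qed

text \<open>The geometric form of the quadratic Hecke relation. Equal values mean that
  \<open>N\<close> fills the two-dimensional quotient in one jump, so that all middle members look
  alike. Otherwise one intermediate space \<open>Y0\<close> is singled out: in an ascent it is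
  \<open>L i\<close> itself, in a descent it belongs to another flag of the panel.\<close>

lemma panel_pos_cases:
  assumes L: "cflag L" and N: "pflag N" and g: "rel_pos L N g" and r: "r \<ge> 2"
  shows "g i = g (i + 1) \<Longrightarrow> M \<in> panel L i \<Longrightarrow> rel_pos M N g"
    and "g i < g (i + 1) \<Longrightarrow> M \<in> panel L i \<Longrightarrow> M \<noteq> L \<Longrightarrow> rel_pos M N (g \<circ> sw r i)"
    and "g (i + 1) < g i \<Longrightarrow> \<exists>M0 \<in> panel L i. rel_pos M0 N (g \<circ> sw r i) \<and>
      (\<forall>M\<in>panel L i. M \<noteq> M0 \<longrightarrow> rel_pos M N g)"
proof -
  let ?W = "L (i - 1)" and ?X = "L (i + 1)"
  have c: "cov ?W (L i)" "cov (L i) ?X" using cflag_cov[OF L, of i] cflag_cov[OF L, of "i + 1"] by simp_all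
  note pL = cflag_pf[OF L]
  obtain l where "\<And>j. j \<le> l \<Longrightarrow> N j \<subseteq> ?W" using flags_cofinal[OF N pL n_pos, of "i - 1"] by blast
  from this[OF order_refl] have l: "N l \<subseteq> ?W" .
  obtain u where "\<And>j. j \<ge> u \<Longrightarrow> ?X \<subseteq> N j" using flags_coinitial[OF N pL n_pos, of "i + 1"] by blast
  from this[OF order_refl] have u: "?X \<subseteq> N u" .
  note gP = rel_pos_pmaps[OF L N g]
  note bij = panel_bij[OF L r, of i]
  have mid: "M i \<in> mids ?W ?X" if "M \<in> panel L i" for M using bij_betwE[OF bij] that by blast
  have own: "mid_pos N ?W (L i) ?X (g i) (g (i + 1))"
    using g unfolding mid_pos_def rel_pos_def by (metis add_diff_cancel_right')
  have own_unique: "a = g i \<and> b = g (i + 1)" if "mid_pos N ?W (L i) ?X a b" for a b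
  proof -
    have "j < a \<longleftrightarrow> j < g i" "j < b \<longleftrightarrow> j < g (i + 1)" for j using own that unfolding mid_pos_def by blast+
    then show ?thesis by (metis linorder_neqE less_irrefl)
  qed
  have Lm: "L i \<in> mids ?W ?X" by (rule mid[OF panel_self[OF L]])
  note swP = sw_comp_pmaps[OF gP, of i]
  have same: "rel_pos M N g" if "M \<in> panel L i" "mid_pos N ?W (M i) ?X (g i) (g (i + 1))" for M
    by (rule panel_pos[OF L N g r that gP]) simp_all
  have swap: "rel_pos M N (g \<circ> sw r i)" if "M \<in> panel L i" "mid_pos N ?W (M i) ?X (g (i + 1)) (g i)" for M
    by (rule panel_pos[OF L N g r that swP]) (simp_all add: sw_at[OF r], simp add: sw_def)
  show "rel_pos M N g" if e: "g i = g (i + 1)" and M: "M \<in> panel L i"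
  proof (rule mid_pos_cases[OF c pf_S[OF N] pf_mono[OF N] l u], assumption)
    fix a assume "\<And>Y. Y \<in> mids ?W ?X \<Longrightarrow> mid_pos N ?W Y ?X a a"
    then have "mid_pos N ?W (M i) ?X a a" "mid_pos N ?W (L i) ?X a a" using mid[OF M] Lm by blast+
    then show ?thesis using same[OF M] own_unique by metis
  next
    fix a b Y0 assume a: "a < b" "Y0 \<in> mids ?W ?X" "mid_pos N ?W Y0 ?X a b"
      "\<And>Y. Y \<in> mids ?W ?X \<Longrightarrow> Y \<noteq> Y0 \<Longrightarrow> mid_pos N ?W Y ?X b a"
    show ?thesis
    proof (cases "L i = Y0")
      case True
      then have "a = g i \<and> b = g (i + 1)" using own_unique a(3) by blast
      then show ?thesis using a(1) e by simp
    next
      case False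
      then have "b = g i \<and> a = g (i + 1)" using own_unique[OF a(4)[OF Lm]] by blast
      then show ?thesis using a(1) e by simp
    qed
  qed
  show "rel_pos M N (g \<circ> sw r i)" if lt: "g i < g (i + 1)" and M: "M \<in> panel L i" "M \<noteq> L"
  proof (rule mid_pos_cases[OF c pf_S[OF N] pf_mono[OF N] l u], assumption)
    fix a assume "\<And>Y. Y \<in> mids ?W ?X \<Longrightarrow> mid_pos N ?W Y ?X a a"
    then show ?thesis using own_unique[of a a] Lm lt by auto
  next
    fix a b Y0 assume a: "a < b" "Y0 \<in> mids ?W ?X" "mid_pos N ?W Y0 ?X a b"
      "\<And>Y. Y \<in> mids ?W ?X \<Longrightarrow> Y \<noteq> Y0 \<Longrightarrow> mid_pos N ?W Y ?X b a"
    have "L i = Y0" using a(4)[OF Lm] own_unique[of b a] lt a(1) by force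
    moreover have "M i \<noteq> L i"
      using bij_betw_imp_inj_on[OF bij] M panel_self[OF L] unfolding inj_on_def by blast
    ultimately have "mid_pos N ?W (M i) ?X b a" "mid_pos N ?W (L i) ?X a b" using a mid[OF M(1)] by simp_all
    then show ?thesis using swap[OF M(1)] own_unique by metis
  qed
  show "\<exists>M0 \<in> panel L i. rel_pos M0 N (g \<circ> sw r i) \<and> (\<forall>M\<in>panel L i. M \<noteq> M0 \<longrightarrow> rel_pos M N g)"
    if lt: "g (i + 1) < g i"
  proof (rule mid_pos_cases[OF c pf_S[OF N] pf_mono[OF N] l u], assumption)
    fix a assume "\<And>Y. Y \<in> mids ?W ?X \<Longrightarrow> mid_pos N ?W Y ?X a a"
    then show ?thesis using own_unique[of a a] Lm lt by auto
  next
    fix a b Y0 assume a: "a < b" "Y0 \<in> mids ?W ?X" "mid_pos N ?W Y0 ?X a b"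
      "\<And>Y. Y \<in> mids ?W ?X \<Longrightarrow> Y \<noteq> Y0 \<Longrightarrow> mid_pos N ?W Y ?X b a"
    have ne: "L i \<noteq> Y0" using a(3) own_unique[of a b] lt a(1) by force
    have ab: "b = g i" "a = g (i + 1)" using own_unique[OF a(4)[OF Lm ne]] by simp_all
    have "Y0 \<in> (\<lambda>M. M i) ` panel L i" using bij_betw_imp_surj_on[OF bij] a(2) by simp
    then obtain M0 where M0: "M0 \<in> panel L i" "M0 i = Y0" by blast
    have "rel_pos M0 N (g \<circ> sw r i)" using swap[OF M0(1)] a(3) M0(2) ab by simp
    moreover have "rel_pos M N g" if M: "M \<in> panel L i" "M \<noteq> M0" for M
    proof -
      have "M i \<noteq> M0 i" using bij_betw_imp_inj_on[OF bij] M M0(1) unfolding inj_on_def by blast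
      then show ?thesis using same[OF M(1)] a(4)[OF mid[OF M(1)]] M0(2) ab by simp
    qed
    ultimately show ?thesis using M0(1) by blast
  qed
qed

text \<open>For sorted \<open>g\<close> the flag \<open>N\<close> is a coarsening of
  \<open>L\<close>. Going up, \<open>g k <= j\<close> says that \<open>L k \<inter> N j\<close> is
  not inside \<open>L (k - 1)\<close>, so \<open>L k\<close> lies in \<open>N j\<close> as soon as
  \<open>L (k - 1)\<close> does. Going down, \<open>j < g k\<close> pushes \<open>N j\<close> from
  \<open>L k\<close> into \<open>L (k - 1)\<close>.\<close>

lemma coarse_unique:
  assumes L: "cflag L" and N: "pflag N" and g: "rel_pos L N g" and m: "mono g"
  shows "N j = L (bnd g j)"
proof -
  note pL = cflag_pf[OF L]
  note b = bnd_iff[OF rel_pos_pmaps[OF L N g] n_pos r_pos m]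
  obtain a where a: "\<And>k. k \<le> a \<Longrightarrow> L k \<subseteq> N j" using flags_cofinal[OF pL N r_pos, of j] by blast
  obtain c where c: "\<And>k. k \<ge> c \<Longrightarrow> N j \<subseteq> L k" using flags_coinitial[OF pL N r_pos, of j] by blast
  have up: "L (a + int m) \<subseteq> N j" if "a + int m \<le> bnd g j" for m
    using that
  proof (induction m)
    case (Suc m)
    let ?k = "a + int (Suc m)"
    have "L (?k - 1) \<subseteq> N j" using Suc by (simp add: algebra_simps)
    moreover have nle: "\<not> L ?k \<inter> N j \<subseteq> L (?k - 1)"
      using g b[of ?k j] Suc(2) unfolding rel_pos_def by (meson not_less)
    moreover note d = covD[OF cflag_cov[OF L, of ?k]]
    have "L (?k - 1) \<subseteq> L ?k \<inter> N j" using calculation d(3) by blast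
    then have "L ?k \<inter> N j = L ?k" using d(4)[OF S_Int[OF pf_S[OF pL] pf_S[OF N]]] nle by blast
    then show ?case by blast
  qed (use a in simp)
  have "L (bnd g j) \<subseteq> N j"
  proof (cases "bnd g j \<le> a")
    case False
    then show ?thesis using up[of "nat (bnd g j - a)"] by simp
  qed (rule a)
  moreover have down: "N j \<subseteq> L (c - int m)" if "c - int m \<ge> bnd g j" for m
    using that
  proof (induction m)
    case (Suc m)
    let ?k = "c - int m"
    have "N j \<subseteq> L ?k" using Suc by simp
    moreover have "L ?k \<inter> N j \<subseteq> L (?k - 1)"
      using g b[of ?k j] Suc(2) unfolding rel_pos_def by (auto simp: not_le)
    ultimately have "N j \<subseteq> L (?k - 1)" by blast
    then show ?case by (simp add: algebra_simps)
  qed (use c in simp)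
  have "N j \<subseteq> L (bnd g j)"
  proof (cases "bnd g j \<ge> c")
    case False
    then show ?thesis using down[of "nat (c - bnd g j)"] by simp
  qed (rule c)
  ultimately show ?thesis by blast
qed

text \<open>The converse of \<open>coarse_unique\<close>: selecting the members
  \<open>bnd g j\<close> of \<open>L\<close> realises every sorted map as a position.\<close>

lemma coarse_flag:
  assumes L: "cflag L" and g: "g \<in> pmaps n r" and m: "mono g"
  shows "pflag (\<lambda>j. L (bnd g j))" "rel_pos L (\<lambda>j. L (bnd g j)) g"
proof -
  note pL = cflag_pf[OF L]
  note b = bnd_iff[OF g n_pos r_pos m]
  have "bnd g (j - 1) \<le> bnd g j" for j using b[of "bnd g (j - 1)" "j - 1"] b[of "bnd g (j - 1)" j] by simp
  moreover have "bnd g (j - int n) = bnd g j - int r" for j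
  proof (rule bnd_eqI[OF _ b])
    fix k
    have "g k \<le> j - int n \<longleftrightarrow> g (k + int r) \<le> j" using g by (auto simp: pmaps_def)
    then show "g k \<le> j - int n \<longleftrightarrow> k \<le> bnd g j - int r" using b[of "k + int r" j] by linarith
  qed
  ultimately show "pflag (\<lambda>j. L (bnd g j))"
    using pL pf_mono[OF pL] unfolding periodic_flag_def by simp
  show "rel_pos L (\<lambda>j. L (bnd g j)) g"
    unfolding rel_pos_def
  proof (intro allI)
    fix k j
    show "L k \<inter> L (bnd g j) \<subseteq> L (k - 1) \<longleftrightarrow> j < g k"
    proof (cases "j < g k")
      case True
      then have "bnd g j \<le> k - 1" using b[of k j] by simp
      then show ?thesis using pf_mono[OF pL] True by blast
    next
      case False
      then have "L k \<subseteq> L (bnd g j)" using b[of k j] pf_mono[OF pL] by simp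
      then show ?thesis using covD(3)[OF cflag_cov[OF L, of k]] False by blast
    qed
  qed
qed

text \<open>For \<open>k\<close> from \<open>bnd f (i - 1)\<close> to \<open>bnd f i\<close> the
  sums of \<open>M k \<inter> N j\<close> and \<open>L i \<inter> N (j - 1)\<close> form a chain
  from the denominator to the numerator of the quotient. Step \<open>k\<close> raises the dimension
  by one exactly if \<open>h k = j\<close>, and the steps of the chain are the \<open>k\<close> with
  \<open>f k = i\<close>.\<close>

lemma orb_of_rel_pos:
  assumes M: "cflag M" and L: "pflag L" and f: "rel_pos M L f" and m: "mono f"
    and N: "pflag N" and h: "rel_pos M N h"
  shows "orb L N (rmat f h)"
  unfolding orb_def
proof (intro conjI allI L N)
  fix i j
  note pM = cflag_pf[OF M]
  note fP = rel_pos_pmaps[OF M L f]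
  note b = bnd_iff[OF fP n_pos r_pos m]
  have Li: "L i = M (bnd f i)" "L (i - 1) = M (bnd f (i - 1))" using coarse_unique[OF M L f m] by blast+
  let ?a = "bnd f (i - 1)" and ?b = "bnd f i"
  let ?N = "N j" and ?N' = "N (j - 1)"
  let ?R = "M ?b \<inter> ?N'"
  have S: "M k \<in> S" "?N \<in> S" "?N' \<in> S" for k using pf_S[OF pM] pf_S[OF N] by blast+
  have MN: "M k \<inter> ?N \<in> S" and R: "?R \<in> S" and MN': "M k \<inter> ?N' \<in> S" for k using S S_Int by blast+
  have NN: "?N' \<subseteq> ?N" by (rule pf_mono[OF N]) simp
  let ?Z = "\<lambda>k. J (M k \<inter> ?N) ?R"
  have Z: "?Z k \<in> S" for k by (rule S_J[OF MN R])
  have Zmono: "?Z k \<subseteq> ?Z k'" if "k \<le> k'" for k k'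
    by (rule J_mono[OF MN R MN R]) (use pf_mono[OF pM that] in blast)+
  have hpos: "M k \<inter> N l \<subseteq> M (k - 1) \<longleftrightarrow> l < h k" for k l using h unfolding rel_pos_def by blast
  have pm1: "M (k - 1) \<subseteq> M k" for k by (rule pf_mono[OF pM]) simp
  have stay: "?Z (k - 1) = ?Z k" if k: "k \<le> ?b" "h k \<noteq> j" for k
  proof (rule equalityI)
    show "?Z (k - 1) \<subseteq> ?Z k" by (rule Zmono) simp
    show "?Z k \<subseteq> ?Z (k - 1)"
    proof (rule J_least[OF MN R Z])
      show "?R \<subseteq> ?Z (k - 1)" by (rule J_ub(2)[OF MN R])
      show "M k \<inter> ?N \<subseteq> ?Z (k - 1)"
      proof (cases "j < h k")
        case True
        then have "M k \<inter> ?N \<subseteq> M (k - 1) \<inter> ?N" using hpos by blast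
        then show ?thesis using J_ub(1)[OF MN R] by blast
      next
        case False
        \<comment> \<open>Here \<open>h k < j\<close>, so \<open>N (j - 1)\<close> already
          contributes the step from \<open>M (k - 1)\<close> to \<open>M k\<close>, and enlarging it
          to \<open>N j\<close> adds nothing at this step.\<close>
        then have nle: "\<not> M k \<inter> ?N' \<subseteq> M (k - 1)" using hpos[of k "j - 1"] k(2) by simp
        note d = covD[OF cflag_cov[OF M, of k]]
        have "J (M (k - 1)) (M k \<inter> ?N') \<subseteq> M k" by (rule J_least[OF S(1) MN' S(1) pm1]) blast
        from d(4)[OF S_J[OF S(1) MN'] J_ub(1)[OF S(1) MN'] this]
        have JM: "J (M (k - 1)) (M k \<inter> ?N') = M k"
        proof
          assume "J (M (k - 1)) (M k \<inter> ?N') = M (k - 1)"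
          then show ?thesis using J_ub(2)[OF S(1)[of "k - 1"] MN'[of k]] nle by simp
        qed
        have "M k \<inter> ?N = ?N \<inter> J (M k \<inter> ?N') (M (k - 1))"
          using JM J_comm[OF S(1) MN', of "k - 1" k] by blast
        also have "\<dots> \<subseteq> J (M k \<inter> ?N') (?N \<inter> M (k - 1))"
          by (rule modular[OF MN' S(1) S(2)]) (use NN in blast)
        also have "\<dots> \<subseteq> ?Z (k - 1)"
        proof (rule J_least[OF MN' S_Int[OF S(2) S(1)] Z])
          show "M k \<inter> ?N' \<subseteq> ?Z (k - 1)" using J_ub(2)[OF MN R] pf_mono[OF pM k(1)] by blast
          show "?N \<inter> M (k - 1) \<subseteq> ?Z (k - 1)" using J_ub(1)[OF MN R] by blast
        qed
        finally show ?thesis .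
      qed
    qed
  qed
  have move: "cov (?Z (k - 1)) (?Z k)" if k: "k \<le> ?b" "h k = j" for k
  proof (rule cov_J[OF _ R])
    have nle: "\<not> M k \<inter> ?N \<subseteq> M (k - 1)" using hpos[of k j] k(2) by simp
    show "cov (M (k - 1) \<inter> ?N) (M k \<inter> ?N)" by (rule cov_Int[OF cflag_cov[OF M] S(2) nle])
    show "\<not> M k \<inter> ?N \<subseteq> ?Z (k - 1)"
    proof
      assume "M k \<inter> ?N \<subseteq> ?Z (k - 1)"
      then have "M k \<inter> ?N \<subseteq> M k \<inter> ?Z (k - 1)" by blast
      also have "\<dots> \<subseteq> J (M (k - 1) \<inter> ?N) (M k \<inter> ?R)"
        by (rule modular[OF MN R S(1)]) (use pm1 in blast)
      also have "\<dots> \<subseteq> M (k - 1)"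
      proof (rule J_least[OF MN S_Int[OF S(1) R] S(1)])
        show "M k \<inter> ?R \<subseteq> M (k - 1)" using hpos[of k "j - 1"] k(2) by auto
      qed blast
      finally show False using nle by simp
    qed
  qed
  have chain: "D (?Z (?a + int m)) (?Z ?a) (card {k. ?a < k \<and> k \<le> ?a + int m \<and> h k = j})"
    if "?a + int m \<le> ?b" for m
    using that
  proof (induction m)
    case 0
    have e: "{k. ?a < k \<and> k \<le> ?a + int 0 \<and> h k = j} = {}" by auto
    show ?case unfolding e using D_refl[OF Z, of ?a] by simp
  next
    case (Suc m)
    let ?k = "?a + int (Suc m)"
    let ?K = "{k. ?a < k \<and> k \<le> ?a + int m \<and> h k = j}"
    have k1: "?k - 1 = ?a + int m" by simp
    have IH: "D (?Z (?k - 1)) (?Z ?a) (card ?K)" unfolding k1 using Suc by simp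
    have fin: "finite ?K" by (rule finite_subset[of _ "{?a..?a + int m}"]) auto
    show ?case
    proof (cases "h ?k = j")
      case True
      have "{k. ?a < k \<and> k \<le> ?k \<and> h k = j} = insert ?k ?K" using True by auto
      moreover have "?k \<notin> ?K" by simp
      ultimately have "card {k. ?a < k \<and> k \<le> ?k \<and> h k = j} = Suc (card ?K)" using fin by simp
      moreover have "?Z ?a \<subseteq> ?Z (?k - 1)" by (rule Zmono) simp
      ultimately show ?thesis using D_step[OF Z _ IH move[OF Suc(2) True]] by simp
    next
      case False
      have "k \<noteq> ?k" if "h k = j" for k using that False by blast
      then have "{k. ?a < k \<and> k \<le> ?k \<and> h k = j} = ?K" by force
      then show ?thesis using IH stay[OF Suc(2) False] by simp
    qed
  qed
  have ab: "?a \<le> ?b" using b[of ?a "i - 1"] b[of ?a i] by simp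
  have "D (?Z ?b) (?Z ?a) (card {k. ?a < k \<and> k \<le> ?b \<and> h k = j})"
    using chain[of "nat (?b - ?a)"] ab by simp
  moreover have "{k. ?a < k \<and> k \<le> ?b \<and> h k = j} = {k. f k = i \<and> h k = j}"
    using b[of _ "i - 1"] b[of _ i] by (auto simp: not_le[symmetric]) (smt (verit))+
  moreover have "?Z ?b = M ?b \<inter> ?N"
    using J_comm[OF MN R] J_absorb[OF R MN] NN by blast
  ultimately show "D (L i \<inter> N j) (J (L (i - 1) \<inter> N j) (L i \<inter> N (j - 1))) (rmat f h i j)"
    unfolding Li rmat_def by simp
qed

lemma orb_unique:
  assumes "orb L N A" "orb L N B" shows "A = B"
proof (intro ext)
  fix i j
  have p: "pflag L" "pflag N" using assms by (simp_all add: orb_def)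
  note S = pf_S[OF p(1)] pf_S[OF p(2)]
  have 1: "L i \<inter> N j \<in> S" "L (i - 1) \<inter> N j \<in> S" "L i \<inter> N (j - 1) \<in> S" using S S_Int by blast+
  show "A i j = B i j"
  proof (rule D_unique)
    show "J (L (i - 1) \<inter> N j) (L i \<inter> N (j - 1)) \<in> S" by (rule S_J[OF 1(2,3)])
    show "J (L (i - 1) \<inter> N j) (L i \<inter> N (j - 1)) \<subseteq> L i \<inter> N j"
      by (rule J_least[OF 1(2,3,1)])
        (use pf_mono[OF p(1), of "i - 1" i] pf_mono[OF p(2), of "j - 1" j] in auto)
  qed (use assms 1 in \<open>auto simp: orb_def\<close>)
qed

lemma orb_iff:
  assumes "cflag M" "pflag L" "rel_pos M L f" "mono f" "pflag N" "rel_pos M N h"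
  shows "orb L N A \<longleftrightarrow> A = rmat f h"
  using orb_of_rel_pos[OF assms] orb_unique by blast

end

text \<open>On one period, \<open>g k\<close> is confined to the finite support of row
  \<open>f k\<close> of \<open>A\<close>.\<close>

lemma finite_pmaps_rmat:
  assumes n: "n > 0" and r: "r > 0" and A: "A \<in> Theta n" and f: "f \<in> pmaps n r"
  shows "finite {g \<in> pmaps n r. rmat f g = A}"
proof (rule finite_imageD)
  let ?G = "{g \<in> pmaps n r. rmat f g = A}"
  let ?\<rho> = "\<lambda>g. restrict g {0..<int r}"
  show "inj_on ?\<rho> ?G"
  proof (rule inj_onI)
    fix g g' assume g: "g \<in> ?G" "g' \<in> ?G" "?\<rho> g = ?\<rho> g'"
    have "g k = g' k" if "k \<in> {0..<int r}" for k using fun_cong[OF g(3), of k] that by simp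
    then show "g = g'" using pmaps_eqI[of g n r g'] g r by blast
  qed
  have "?\<rho> ` ?G \<subseteq> (\<Pi>\<^sub>E k\<in>{0..<int r}. {j. A (f k) j \<noteq> 0})"
  proof
    fix x assume "x \<in> ?\<rho> ` ?G"
    then obtain g where g: "g \<in> pmaps n r" "rmat f g = A" "x = ?\<rho> g" by blast
    have "A (f k) (g k) \<noteq> 0" for k using rmat_pos_iff[OF f n r, of g "f k" "g k"] g(2) by blast
    then show "x \<in> (\<Pi>\<^sub>E k\<in>{0..<int r}. {j. A (f k) j \<noteq> 0})" unfolding g(3) by auto
  qed
  moreover have "finite (\<Pi>\<^sub>E k\<in>{0..<int r}. {j. A (f k) j \<noteq> 0})"
    using A by (intro finite_PiE) (auto simp: Theta_def)
  ultimately show "finite (?\<rho> ` ?G)" by (rule finite_subset)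
qed

section \<open>Recursive count of intermediate flags\<close>

context flag_geometry
begin

lemma sw_ne: "(g :: int \<Rightarrow> int) (i + 1) < g i \<Longrightarrow> r \<ge> 2 \<Longrightarrow> g \<circ> sw r i \<noteq> g"
proof
  assume a: "g (i + 1) < g i" "r \<ge> 2" "g \<circ> sw r i = g"
  from fun_cong[OF a(3), of i] a(1) show False by (simp add: sw_at[OF a(2)])
qed

definition reach :: "(int \<Rightarrow> 'v set) \<Rightarrow> (int \<Rightarrow> 'v set) \<Rightarrow> zmat \<Rightarrow> (int \<Rightarrow> int) \<Rightarrow> (int \<Rightarrow> 'v set) set" where
  "reach L N B g = {L'. pflag L' \<and> rel_pos L L' g \<and> orb L' N B}"

text \<open>A flag \<open>L'\<close> with a descent at \<open>i\<close> relative to \<open>L\<close>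
  has an ascent relative to exactly one member of the panel. Classifying \<open>L'\<close> by that
  member distributes the flags to be counted over the members other than \<open>L\<close>.\<close>

lemma reach_descent:
  assumes L: "cflag L" and r: "r \<ge> 2" and d: "g (i + 1) < g i"
  shows "reach L N B g = (\<Union>M\<in>panel L i - {L}. reach M N B (g \<circ> sw r i))"
proof (intro equalityI subsetI)
  fix L' assume "L' \<in> reach L N B g"
  then have L': "pflag L'" "rel_pos L L' g" "orb L' N B" by (simp_all add: reach_def)
  obtain M0 where M0: "M0 \<in> panel L i" "rel_pos M0 L' (g \<circ> sw r i)"
    using panel_pos_cases(3)[OF L L'(1,2) r d] by blast
  have "M0 \<noteq> L" using M0(2) L'(2) rel_pos_unique sw_ne[OF d r] by metis
  then show "L' \<in> (\<Union>M\<in>panel L i - {L}. reach M N B (g \<circ> sw r i))"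
    using M0 L' by (auto simp: reach_def)
next
  fix L' assume "L' \<in> (\<Union>M\<in>panel L i - {L}. reach M N B (g \<circ> sw r i))"
  then obtain M where M: "M \<in> panel L i" "M \<noteq> L" "pflag L'" "rel_pos M L' (g \<circ> sw r i)" "orb L' N B"
    by (auto simp: reach_def)
  have cM: "cflag M" using M(1) by (simp add: panel_def)
  have "L \<in> panel M i" using panel_eq[OF M(1)] panel_self[OF L] by simp
  moreover have "(g \<circ> sw r i) i < (g \<circ> sw r i) (i + 1)" using d by (simp add: sw_at[OF r])
  ultimately have "rel_pos L L' ((g \<circ> sw r i) \<circ> sw r i)"
    using panel_pos_cases(2)[OF cM M(3,4) r] M(2) by blast
  then show "L' \<in> reach L N B g" using M by (simp add: reach_def sw_comp_sw[OF r])
qed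

text \<open>If \<open>M\<close> sees \<open>L'\<close> with an ascent, every other member of its
  panel sees it with a descent, so no flag is counted twice.\<close>

lemma reach_disjoint:
  assumes L: "cflag L" and r: "r \<ge> 2" and d: "g (i + 1) < g i"
    and M: "M \<in> panel L i - {L}" "M' \<in> panel L i - {L}" "M \<noteq> M'"
  shows "reach M N B (g \<circ> sw r i) \<inter> reach M' N B (g \<circ> sw r i) = {}"
proof (rule ccontr)
  assume "\<not> ?thesis"
  then obtain L' where L': "pflag L'" "rel_pos M L' (g \<circ> sw r i)" "rel_pos M' L' (g \<circ> sw r i)"
    by (auto simp: reach_def)
  have cM: "cflag M" using M(1) by (simp add: panel_def)
  have "M' \<in> panel M i" using panel_eq[of M L i] M by simp
  moreover have "(g \<circ> sw r i) i < (g \<circ> sw r i) (i + 1)" using d by (simp add: sw_at[OF r])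
  ultimately have "rel_pos M' L' ((g \<circ> sw r i) \<circ> sw r i)"
    using panel_pos_cases(2)[OF cM L'(1,2) r] M(3) by metis
  then have "rel_pos M' L' g" by (simp only: sw_comp_sw[OF r])
  then show False using L'(3) rel_pos_unique sw_ne[of g i] d r by metis
qed

text \<open>For sorted \<open>g\<close> the only candidate is the coarsening of \<open>L\<close> by
  \<open>g\<close>. In case \<open>up\<close> all \<open>q\<close> members of the panel other than
  \<open>L\<close> see \<open>N\<close> at \<open>h \<circ> sw r i\<close>, which gives the factor
  \<open>q\<close>. In case \<open>down\<close> one of them, \<open>M0\<close>, does, and the
  remaining \<open>q - 1\<close> see \<open>N\<close> at \<open>h\<close>.\<close>

lemma reach_card:
  assumes "count_poly r B g h p" "cflag L" "g \<in> pmaps n r" "pflag N" "rel_pos L N h"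
  shows "finite (reach L N B g) \<and> int (card (reach L N B g)) = poly p (int q)"
  using assms
proof (induction arbitrary: L rule: count_poly.induct)
  case (sorted g h)
  let ?N = "\<lambda>j. L (bnd g j)"
  note cf = coarse_flag[OF sorted(2,3,1)]
  have u: "L' = ?N" if "pflag L'" "rel_pos L L' g" for L'
    using coarse_unique[OF sorted(2) that sorted(1)] by blast
  have o: "orb ?N N B \<longleftrightarrow> B = rmat g h"
    by (rule orb_iff[OF sorted(2) cf sorted(1,4,5)])
  have sub: "reach L N B g \<subseteq> {?N}" unfolding reach_def using u by blast
  have "?N \<in> reach L N B g \<longleftrightarrow> rmat g h = B" unfolding reach_def mem_Collect_eq using cf o by metis
  then have "reach L N B g = (if rmat g h = B then {?N} else {})" using sub by (simp add: subset_singleton_iff) blast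
  then show ?case by simp
next
  case (up g i h p)
  note r = \<open>r \<ge> 2\<close> and d = \<open>g (i + 1) < g i\<close> and L = \<open>cflag L\<close>
  let ?P = "panel L i - {L}" and ?s = "g \<circ> sw r i"
  have rel: "rel_pos M N (h \<circ> sw r i)" if M: "M \<in> ?P" for M
  proof (cases "h i = h (i + 1)")
    \<comment> \<open>A tie of \<open>h\<close> falls under \<open>up\<close>: every member sees
      \<open>N\<close> at \<open>h\<close>, which composition with \<open>sw r i\<close> leaves
      unchanged.\<close>
    case True
    then have "rel_pos M N h" using panel_pos_cases(1)[OF L up.prems(3,4) r] M by blast
    then show ?thesis using sw_fix[OF r rel_pos_pmaps[OF L up.prems(3,4)] True] by simp
  next
    case False
    then show ?thesis using panel_pos_cases(2)[OF L up.prems(3,4) r, of i M] up.hyps(3) M by simp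
  qed
  have IH: "finite (reach M N B ?s) \<and> int (card (reach M N B ?s)) = poly p (int q)" if M: "M \<in> ?P" for M
    by (rule up.IH[OF _ sw_comp_pmaps[OF up.prems(2)] up.prems(3) rel[OF M]]) (use M in \<open>simp add: panel_def\<close>)
  have fP: "finite ?P" and cP: "card ?P = q" using panel_card[OF L r] panel_self[OF L] by simp_all
  have "card (reach L N B g) = (\<Sum>M\<in>?P. card (reach M N B ?s))"
    unfolding reach_descent[OF L r d] using fP IH reach_disjoint[OF L r d] by (intro card_UN_disjoint) blast+
  then have "int (card (reach L N B g)) = (\<Sum>M\<in>?P. poly p (int q))" using IH by simp
  then show ?case using reach_descent[OF L r d] fP IH cP by simp
next
  case (down g i h p p')
  note r = \<open>r \<ge> 2\<close> and d = \<open>g (i + 1) < g i\<close> and L = \<open>cflag L\<close>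
  let ?P = "panel L i - {L}" and ?s = "g \<circ> sw r i"
  obtain M0 where M0: "M0 \<in> panel L i" "rel_pos M0 N (h \<circ> sw r i)"
    "\<And>M. M \<in> panel L i \<Longrightarrow> M \<noteq> M0 \<Longrightarrow> rel_pos M N h"
    using panel_pos_cases(3)[OF L down.prems(3,4) r down.hyps(3)] by blast
  have M0L: "M0 \<noteq> L" using M0(2) down.prems(4) rel_pos_unique sw_ne[OF down.hyps(3) r] by metis
  have cM: "cflag M" if "M \<in> ?P" for M using that by (simp add: panel_def)
  have M0P: "M0 \<in> ?P" using M0 M0L by simp
  have IH0: "finite (reach M0 N B ?s) \<and> int (card (reach M0 N B ?s)) = poly p (int q)"
    by (rule down.IH(1)[OF cM[OF M0P] sw_comp_pmaps[OF down.prems(2)] down.prems(3) M0(2)])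
  have IH: "finite (reach M N B ?s) \<and> int (card (reach M N B ?s)) = poly p' (int q)" if M: "M \<in> ?P - {M0}" for M
    by (rule down.IH(2)[OF _ sw_comp_pmaps[OF down.prems(2)] down.prems(3)]) (use M M0 cM in simp_all)
  have fin: "finite (reach M N B ?s)" if "M \<in> ?P" for M using IH IH0 that by (cases "M = M0") auto
  have fP: "finite ?P" and cP: "card ?P = q" using panel_card[OF L r] panel_self[OF L] by simp_all
  have "card (reach L N B g) = (\<Sum>M\<in>?P. card (reach M N B ?s))"
    unfolding reach_descent[OF L r d] using fP fin reach_disjoint[OF L r d] by (intro card_UN_disjoint) blast+
  also have "\<dots> = card (reach M0 N B ?s) + (\<Sum>M\<in>?P - {M0}. card (reach M N B ?s))"
    by (rule sum.remove[OF fP M0P])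
  finally have "int (card (reach L N B g)) = poly p (int q) + (\<Sum>M\<in>?P - {M0}. poly p' (int q))"
    using IH IH0 by simp
  also have "\<dots> = poly p (int q) + (int q - 1) * poly p' (int q)"
    using fP cP M0P q_pos by (simp add: of_nat_diff)
  finally show ?case using reach_descent[OF L r d] fP fin by (simp add: algebra_simps)
qed

text \<open>Moving to the exceptional member of a panel removes a descent, so a walk through panels
  sorts the position.\<close>

lemma ex_sorted_refinement:
  assumes N: "pflag N"
  obtains M f where "cflag M" "rel_pos M N f" "mono f"
proof -
  obtain L where L: "cflag L" using base_flag by blast
  obtain g where g: "rel_pos L N g" by (rule rel_pos_ex[OF L N])
  have "\<forall>L. cflag L \<longrightarrow> rel_pos L N g \<longrightarrow> (\<exists>M f. cflag M \<and> rel_pos M N f \<and> mono f)"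
    using n_pos r_pos rel_pos_pmaps[OF L N g]
  proof (induction rule: pmaps_descent_induct)
    case (descent g i)
    show ?case
    proof (intro allI impI)
      fix L assume L: "cflag L" "rel_pos L N g"
      obtain M where "M \<in> panel L i" "rel_pos M N (g \<circ> sw r i)"
        using panel_pos_cases(3)[OF L(1) N L(2) descent(1,3)] by blast
      then show "\<exists>M f. cflag M \<and> rel_pos M N f \<and> mono f" using descent(4) unfolding panel_def by blast
    qed
  qed blast
  then show thesis using L g that by blast
qed

text \<open>Once \<open>f\<close> is sorted, a failure of lexicographic order is a descent of
  \<open>h\<close> at a tie of \<open>f\<close>. At a tie every member of the panel keeps the
  position \<open>f\<close>, so \<open>h\<close> can be sorted without disturbing
  \<open>f\<close>.\<close>

lemma ex_lexmono_refinement: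
  assumes N: "pflag N" and N': "pflag N'"
  obtains M f h where "cflag M" "rel_pos M N f" "rel_pos M N' h" "lexmono f h"
proof -
  obtain M f where M: "cflag M" "rel_pos M N f" "mono f" by (rule ex_sorted_refinement[OF N])
  obtain h where h: "rel_pos M N' h" by (rule rel_pos_ex[OF M(1) N'])
  note fP = rel_pos_pmaps[OF M(1) N M(2)]
  have "\<exists>M h. cflag M \<and> rel_pos M N f \<and> rel_pos M N' h \<and> lexmono f h"
    using M(1,2) h
  proof (induction "disorder n r h" arbitrary: M h rule: less_induct)
    case less
    show ?case
    proof (cases "lexmono f h")
      case False
      then obtain i where "\<not> (f i, h i) \<le> (f (i + 1), h (i + 1))" unfolding mono_int_iff by blast
      then have i: "f i = f (i + 1)" "h (i + 1) < h i"
        using M(3) unfolding mono_int_iff by (auto simp: less_eq_prod_def not_le less_le)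
      have r: "r \<ge> 2"
      proof (rule ccontr)
        assume "\<not> r \<ge> 2"
        then have "r = 1" using r_pos by simp
        then show False using fP i(1) n_pos by (auto simp: pmaps_def)
      qed
      obtain M0 where M0: "M0 \<in> panel M i" "rel_pos M0 N' (h \<circ> sw r i)"
        using panel_pos_cases(3)[OF less(2) N' less(4) r i(2)] by blast
      have "rel_pos M0 N f" by (rule panel_pos_cases(1)[OF less(2) N less(3) r i(1) M0(1)])
      moreover have "cflag M0" using M0(1) by (simp add: panel_def)
      ultimately show ?thesis
        using less(1)[OF disorder_sw[OF rel_pos_pmaps[OF less(2) N' less(4)] n_pos r i(2)]] M0(2) by blast
    qed (use less in blast)
  qed
  then show thesis using that by blast
qed

lemma cflag_shift:
  assumes L: "cflag L" shows "cflag (\<lambda>k. L (k + c))"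
proof -
  have e: "k - 1 + c = (k + c) - 1" "k - int r + c = (k + c) - int r" for k by simp_all
  show ?thesis using L unfolding complete_flag_def periodic_flag_def e by blast
qed

lemma rel_pos_shift: "rel_pos L N g \<Longrightarrow> rel_pos (\<lambda>k. L (k + c)) N (\<lambda>k. g (k + c))"
proof -
  have e: "k - 1 + c = (k + c) - 1" for k by simp
  assume "rel_pos L N g" then show ?thesis unfolding rel_pos_def e by blast
qed

text \<open>The sorted positions obtained from different pairs of one orbit differ only by a
  translation, which translating the indices of \<open>M\<close> removes. Hence one choice of
  \<open>f\<close> and \<open>h\<close> serves the whole orbit, over every field.\<close>

lemma ex_refinement_at:
  assumes o: "orb L N C" and P: "f \<in> pmaps n r" "h \<in> pmaps n r" and lm: "lexmono f h" and C: "rmat f h = C"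
  obtains M where "cflag M" "rel_pos M L f" "rel_pos M N h"
proof -
  have p: "pflag L" "pflag N" using o by (simp_all add: orb_def)
  obtain M f' h' where M: "cflag M" "rel_pos M L f'" "rel_pos M N h'" "lexmono f' h'"
    by (rule ex_lexmono_refinement[OF p])
  note P' = rel_pos_pmaps[OF M(1) p(1) M(2)] rel_pos_pmaps[OF M(1) p(2) M(3)]
  have "C = rmat f' h'" using orb_iff[OF M(1) p(1) M(2) lexmono_fst[OF M(4)] p(2) M(3)] o by blast
  then have "rmat f' h' = rmat f h" using C by simp
  then obtain c where "f = (\<lambda>k. f' (k + c))" "h = (\<lambda>k. h' (k + c))"
    by (rule lexmono_unique[OF P' P n_pos r_pos M(4) lm])
  then show thesis
    using that[of "\<lambda>k. M (k + c)"] cflag_shift[OF M(1)] rel_pos_shift M(2,3) by blast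
qed

text \<open>The flags \<open>L'\<close> are classified by their position \<open>g\<close> to the
  refinement \<open>M\<close>. The condition on \<open>(L, L')\<close> becomes
  \<open>rmat f g = A\<close>, and \<open>reach_card\<close> counts each class.\<close>

theorem orbit_count:
  assumes o: "orb L N C" and P: "f \<in> pmaps n r" "h \<in> pmaps n r" and lm: "lexmono f h" and C: "rmat f h = C"
    and A: "A \<in> Theta n" and p: "\<And>g. g \<in> pmaps n r \<Longrightarrow> count_poly r B g h (p g)"
  shows "int (card {L'. orb L L' A \<and> orb L' N B}) = (\<Sum>g | g \<in> pmaps n r \<and> rmat f g = A. poly (p g) (int q))"
proof -
  have pf: "pflag L" "pflag N" using o by (simp_all add: orb_def)
  obtain M where M: "cflag M" "rel_pos M L f" "rel_pos M N h" by (rule ex_refinement_at[OF o P lm C])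
  let ?G = "{g. g \<in> pmaps n r \<and> rmat f g = A}"
  have "{L'. orb L L' A \<and> orb L' N B} = (\<Union>g\<in>?G. reach M N B g)"
  proof (intro equalityI subsetI)
    fix L' assume "L' \<in> {L'. orb L L' A \<and> orb L' N B}"
    then have L': "orb L L' A" "orb L' N B" by simp_all
    then have p': "pflag L'" by (simp add: orb_def)
    obtain g where g: "rel_pos M L' g" by (rule rel_pos_ex[OF M(1) p'])
    have "rmat f g = A" using orb_iff[OF M(1) pf(1) M(2) lexmono_fst[OF lm] p' g] L'(1) by simp
    then show "L' \<in> (\<Union>g\<in>?G. reach M N B g)"
      using rel_pos_pmaps[OF M(1) p' g] g L' p' by (auto simp: reach_def)
  next
    fix L' assume "L' \<in> (\<Union>g\<in>?G. reach M N B g)"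
    then obtain g where "rmat f g = A" "pflag L'" "rel_pos M L' g" "orb L' N B" by (auto simp: reach_def)
    then show "L' \<in> {L'. orb L L' A \<and> orb L' N B}"
      using orb_iff[OF M(1) pf(1) M(2) lexmono_fst[OF lm], of L' g] by simp
  qed
  moreover have fin: "finite ?G" using finite_pmaps_rmat[OF n_pos r_pos A P(1)] by simp
  have rc: "finite (reach M N B g) \<and> int (card (reach M N B g)) = poly (p g) (int q)" if "g \<in> ?G" for g
    by (rule reach_card[OF p M(1) _ pf(2) M(3)]) (use that in simp_all)
  moreover have "card (\<Union>g\<in>?G. reach M N B g) = (\<Sum>g\<in>?G. card (reach M N B g))"
  proof (rule card_UN_disjoint[OF fin])
    show "\<forall>g\<in>?G. \<forall>g'\<in>?G. g \<noteq> g' \<longrightarrow> reach M N B g \<inter> reach M N B g' = {}"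
      using rel_pos_unique unfolding reach_def by blast
  qed (use rc in blast)
  ultimately show ?thesis using rc by simp
qed

text \<open>Sorting run backwards: passing from \<open>L\<close> to any other member of the panel
  turns an ascent into a descent, and \<open>q > 0\<close> provides such a member.\<close>

lemma ex_rel_pos:
  assumes "h \<in> pmaps n r"
  shows "\<exists>L N. cflag L \<and> pflag N \<and> rel_pos L N h"
  using n_pos r_pos assms
proof (induction rule: pmaps_descent_induct)
  case (sorted h)
  obtain L where "cflag L" using base_flag by blast
  then show ?case using coarse_flag[of L h] sorted by blast
next
  case (descent h i)
  then obtain L N where L: "cflag L" "pflag N" "rel_pos L N (h \<circ> sw r i)" by blast
  have "panel L i \<noteq> {L}" using panel_card(2)[OF L(1) descent(1), of i] q_pos by auto
  then obtain M where M: "M \<in> panel L i" "M \<noteq> L" using panel_self[OF L(1)] by blast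
  have "(h \<circ> sw r i) i < (h \<circ> sw r i) (i + 1)" using descent(1,3) by (simp add: sw_at)
  from panel_pos_cases(2)[OF L descent(1) this M] have "rel_pos M N h"
    by (simp only: sw_comp_sw[OF descent(1)])
  then show ?case using M(1) L(2) by (auto simp: panel_def)
qed

lemma ex_orb:
  assumes f: "f \<in> pmaps n r" and h: "h \<in> pmaps n r" and m: "mono f"
  shows "\<exists>L N. orb L N (rmat f h)"
proof -
  obtain M N where M: "cflag M" "pflag N" "rel_pos M N h" using ex_rel_pos[OF h] by blast
  then show ?thesis using orb_of_rel_pos[OF M(1) coarse_flag[OF M(1) f m] m] by blast
qed

end

section \<open>Subspaces of a vector space over a finite field\<close>

lemma coversD: "covers S W U \<Longrightarrow> Y \<in> S \<Longrightarrow> W \<subseteq> Y \<Longrightarrow> Y \<subseteq> U \<Longrightarrow> Y = W \<or> Y = U"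
  by (simp add: covers_def)

text \<open>The scalar action is a separate parameter, because in the intended instance the scalars
  of the module are Laurent polynomials and the field acts through the constant ones.\<close>

locale fin_vs = K: field K + M: abelian_group M
  for K :: "('a, 'c) ring_scheme" and M :: "('v, 'd) ring_scheme" +
  fixes sc :: "'a \<Rightarrow> 'v \<Rightarrow> 'v"
  assumes fin: "finite (carrier K)"
    and sc_closed [simp]: "a \<in> carrier K \<Longrightarrow> v \<in> carrier M \<Longrightarrow> sc a v \<in> carrier M"
    and sc_add_left: "a \<in> carrier K \<Longrightarrow> b \<in> carrier K \<Longrightarrow> v \<in> carrier M \<Longrightarrow>
      sc (a \<oplus>\<^bsub>K\<^esub> b) v = sc a v \<oplus>\<^bsub>M\<^esub> sc b v"
    and sc_add_right: "a \<in> carrier K \<Longrightarrow> v \<in> carrier M \<Longrightarrow> w \<in> carrier M \<Longrightarrow>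
      sc a (v \<oplus>\<^bsub>M\<^esub> w) = sc a v \<oplus>\<^bsub>M\<^esub> sc a w"
    and sc_mult: "a \<in> carrier K \<Longrightarrow> b \<in> carrier K \<Longrightarrow> v \<in> carrier M \<Longrightarrow> sc (a \<otimes>\<^bsub>K\<^esub> b) v = sc a (sc b v)"
    and sc_one [simp]: "v \<in> carrier M \<Longrightarrow> sc \<one>\<^bsub>K\<^esub> v = v"
begin

abbreviation vadd (infixl \<open>\<boxplus>\<close> 65) where "v \<boxplus> w \<equiv> v \<oplus>\<^bsub>M\<^esub> w"
abbreviation vneg (\<open>\<boxminus> _\<close> [81] 80) where "\<boxminus> v \<equiv> \<ominus>\<^bsub>M\<^esub> v"
abbreviation vzero (\<open>\<zero>v\<close>) where "\<zero>v \<equiv> \<zero>\<^bsub>M\<^esub>"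

lemma sc_zero_left [simp]: "v \<in> carrier M \<Longrightarrow> sc \<zero>\<^bsub>K\<^esub> v = \<zero>v"
proof -
  assume v: "v \<in> carrier M"
  have "sc \<zero>\<^bsub>K\<^esub> v = sc \<zero>\<^bsub>K\<^esub> v \<boxplus> sc \<zero>\<^bsub>K\<^esub> v" using sc_add_left[of "\<zero>\<^bsub>K\<^esub>" "\<zero>\<^bsub>K\<^esub>" v] v by simp
  then show ?thesis using v M.add.l_cancel_one'[of "sc \<zero>\<^bsub>K\<^esub> v" "sc \<zero>\<^bsub>K\<^esub> v"] by simp
qed

lemma sc_neg: "a \<in> carrier K \<Longrightarrow> v \<in> carrier M \<Longrightarrow> sc (\<ominus>\<^bsub>K\<^esub> a) v = \<boxminus> sc a v"
proof -
  assume a: "a \<in> carrier K" "v \<in> carrier M"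
  have "sc (\<ominus>\<^bsub>K\<^esub> a) v \<boxplus> sc a v = \<zero>v"
    using sc_add_left[of "\<ominus>\<^bsub>K\<^esub> a" a v] a by (simp add: K.l_neg)
  then show ?thesis using M.minus_equality[of "sc (\<ominus>\<^bsub>K\<^esub> a) v" "sc a v"] a by simp
qed

definition subspaces :: "'v set set" where
  "subspaces = {U. U \<subseteq> carrier M \<and> \<zero>v \<in> U \<and> (\<forall>u\<in>U. \<forall>w\<in>U. u \<boxplus> w \<in> U) \<and>
     (\<forall>a\<in>carrier K. \<forall>u\<in>U. sc a u \<in> U)}"

definition qdim :: "'v set \<Rightarrow> 'v set \<Rightarrow> nat \<Rightarrow> bool" where
  "qdim U W d \<longleftrightarrow> (\<exists>B. finite B \<and> B \<subseteq> U \<and> card B = d \<and>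
     (\<forall>u\<in>U. \<exists>!c. c \<in> B \<rightarrow>\<^sub>E carrier K \<and> u \<ominus>\<^bsub>M\<^esub> (\<Oplus>\<^bsub>M\<^esub>b\<in>B. sc (c b) b) \<in> W))"

lemma subspaceD:
  assumes "U \<in> subspaces"
  shows "U \<subseteq> carrier M" "\<And>u. u \<in> U \<Longrightarrow> u \<in> carrier M" "\<zero>v \<in> U" "\<And>u w. u \<in> U \<Longrightarrow> w \<in> U \<Longrightarrow> u \<boxplus> w \<in> U"
    "\<And>a u. a \<in> carrier K \<Longrightarrow> u \<in> U \<Longrightarrow> sc a u \<in> U"
  using assms unfolding subspaces_def by blast+

lemma subspace_neg: "U \<in> subspaces \<Longrightarrow> u \<in> U \<Longrightarrow> \<boxminus> u \<in> U"
  using subspaceD(5)[of U "\<ominus>\<^bsub>K\<^esub> \<one>\<^bsub>K\<^esub>" u] subspaceD(2)[of U u] sc_neg[of "\<one>\<^bsub>K\<^esub>" u] by simp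

lemma subspace_cancel: "U \<in> subspaces \<Longrightarrow> u \<in> U \<Longrightarrow> v \<in> carrier M \<Longrightarrow> u \<boxplus> v \<in> U \<Longrightarrow> v \<in> U"
  using subspaceD(4)[of U "\<boxminus> u" "u \<boxplus> v"] subspace_neg[of U u] subspaceD(2)[of U u] M.r_neg1[of u v] by simp

lemma subspace_sc_cancel:
  assumes "U \<in> subspaces" "a \<in> carrier K" "a \<noteq> \<zero>\<^bsub>K\<^esub>" "v \<in> carrier M" "sc a v \<in> U"
  shows "v \<in> U"
proof -
  have u: "a \<in> Units K" using assms K.field_Units by blast
  then have "inv\<^bsub>K\<^esub> a \<in> carrier K" "inv\<^bsub>K\<^esub> a \<otimes>\<^bsub>K\<^esub> a = \<one>\<^bsub>K\<^esub>" by simp_all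
  then show ?thesis using subspaceD(5)[OF assms(1), of "inv\<^bsub>K\<^esub> a" "sc a v"] sc_mult[of "inv\<^bsub>K\<^esub> a" a v] assms by simp
qed

lemma set_add_iff: "x \<in> U <+>\<^bsub>M\<^esub> W \<longleftrightarrow> (\<exists>u\<in>U. \<exists>w\<in>W. x = u \<boxplus> w)"
  by (auto simp: set_add_def')

lemma subspace_Int: "U \<in> subspaces \<Longrightarrow> W \<in> subspaces \<Longrightarrow> U \<inter> W \<in> subspaces"
  unfolding subspaces_def by blast

lemma subspace_set_add:
  assumes U: "U \<in> subspaces" and W: "W \<in> subspaces" shows "U <+>\<^bsub>M\<^esub> W \<in> subspaces"
  unfolding subspaces_def
proof (intro CollectI conjI ballI)
  note u = subspaceD[OF U] and w = subspaceD[OF W]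
  show "U <+>\<^bsub>M\<^esub> W \<subseteq> carrier M" using u w by (auto simp: set_add_iff)
  show "\<zero>v \<in> U <+>\<^bsub>M\<^esub> W" using u(3) w(3) unfolding set_add_iff by (metis M.r_zero M.zero_closed)
  fix x assume "x \<in> U <+>\<^bsub>M\<^esub> W"
  then obtain a b where x: "a \<in> U" "b \<in> W" "x = a \<boxplus> b" unfolding set_add_iff by blast
  { fix y assume "y \<in> U <+>\<^bsub>M\<^esub> W"
    then obtain c d where y: "c \<in> U" "d \<in> W" "y = c \<boxplus> d" unfolding set_add_iff by blast
    have "x \<boxplus> y = (a \<boxplus> c) \<boxplus> (b \<boxplus> d)" unfolding x y using u(2) w(2) x y by (simp add: M.a_ac)
    then show "x \<boxplus> y \<in> U <+>\<^bsub>M\<^esub> W" unfolding set_add_iff using u(4) w(4) x y by blast }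
  fix k assume k: "k \<in> carrier K"
  then have "sc k x = sc k a \<boxplus> sc k b" using x u(2) w(2) by (simp add: sc_add_right)
  then show "sc k x \<in> U <+>\<^bsub>M\<^esub> W" unfolding set_add_iff using u(5)[OF k] w(5)[OF k] x by blast
qed

lemma set_add_ub:
  assumes U: "U \<in> subspaces" and W: "W \<in> subspaces" shows "U \<subseteq> U <+>\<^bsub>M\<^esub> W" "W \<subseteq> U <+>\<^bsub>M\<^esub> W"
  using subspaceD[OF U] subspaceD[OF W] unfolding subset_iff set_add_iff by (metis M.r_zero, metis M.l_zero)

lemma set_add_least:
  assumes "X \<in> subspaces" "U \<subseteq> X" "W \<subseteq> X" shows "U <+>\<^bsub>M\<^esub> W \<subseteq> X"
  using subspaceD(4)[OF assms(1)] assms(2,3) unfolding subset_iff set_add_iff by blast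

lemma set_add_modular:
  assumes X: "X \<in> subspaces" and U: "U \<in> subspaces" "U \<subseteq> X" and W: "W \<in> subspaces"
  shows "X \<inter> (U <+>\<^bsub>M\<^esub> W) \<subseteq> U <+>\<^bsub>M\<^esub> (X \<inter> W)"
proof
  fix x assume "x \<in> X \<inter> (U <+>\<^bsub>M\<^esub> W)"
  then obtain u w where x: "x \<in> X" "u \<in> U" "w \<in> W" "x = u \<boxplus> w" unfolding set_add_iff Int_iff by blast
  then have "w \<in> X" using subspace_cancel[OF X, of u w] U(2) subspaceD(2)[OF W] by blast
  then show "x \<in> U <+>\<^bsub>M\<^esub> (X \<inter> W)" unfolding set_add_iff using x by blast
qed

definition span1 :: "'v set \<Rightarrow> 'v \<Rightarrow> 'v set" where
  "span1 W v = {x. \<exists>w\<in>W. \<exists>a\<in>carrier K. x = w \<boxplus> sc a v}"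

lemma span1_subspace:
  assumes W: "W \<in> subspaces" and v: "v \<in> carrier M" shows "span1 W v \<in> subspaces"
  unfolding subspaces_def
proof (intro CollectI conjI ballI)
  note w = subspaceD[OF W]
  show "span1 W v \<subseteq> carrier M" using w(2) v by (auto simp: span1_def)
  show "\<zero>v \<in> span1 W v" unfolding span1_def using w(3) v
    by (intro CollectI bexI[of _ "\<zero>v"] bexI[of _ "\<zero>\<^bsub>K\<^esub>"]) simp_all
  fix x assume "x \<in> span1 W v"
  then obtain a b where x: "a \<in> W" "b \<in> carrier K" "x = a \<boxplus> sc b v" unfolding span1_def by blast
  { fix y assume "y \<in> span1 W v"
    then obtain c d where y: "c \<in> W" "d \<in> carrier K" "y = c \<boxplus> sc d v" unfolding span1_def by blast
    have "x \<boxplus> y = (a \<boxplus> c) \<boxplus> sc (b \<oplus>\<^bsub>K\<^esub> d) v" unfolding x y using w(2) x y v by (simp add: M.a_ac sc_add_left)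
    then show "x \<boxplus> y \<in> span1 W v" unfolding span1_def using w(4) x y by blast }
  fix k assume k: "k \<in> carrier K"
  then have "sc k x = sc k a \<boxplus> sc (k \<otimes>\<^bsub>K\<^esub> b) v" using x w(2) v by (simp add: sc_add_right sc_mult)
  then show "sc k x \<in> span1 W v" unfolding span1_def using w(5)[OF k] x k by blast
qed

lemma span1_ub:
  assumes W: "W \<in> subspaces" and v: "v \<in> carrier M" shows "W \<subseteq> span1 W v" "v \<in> span1 W v"
proof -
  show "W \<subseteq> span1 W v"
  proof
    fix w assume "w \<in> W"
    moreover from this have "w = w \<boxplus> sc \<zero>\<^bsub>K\<^esub> v" using subspaceD(2)[OF W] v by simp
    ultimately show "w \<in> span1 W v" unfolding span1_def using K.zero_closed by blast
  qed
  have "v = \<zero>v \<boxplus> sc \<one>\<^bsub>K\<^esub> v" using v by simp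
  then show "v \<in> span1 W v" unfolding span1_def using subspaceD(3)[OF W] K.one_closed by blast
qed

lemma span1_least:
  assumes "X \<in> subspaces" "W \<subseteq> X" "v \<in> X" shows "span1 W v \<subseteq> X"
  using subspaceD(4,5)[OF assms(1)] assms(2,3) unfolding span1_def by blast

lemma covers_span1:
  assumes W: "W \<in> subspaces" and v: "v \<in> carrier M" "v \<notin> W"
  shows "covers subspaces W (span1 W v)"
  unfolding covers_def
proof (intro conjI ballI impI)
  show "W \<in> subspaces" "span1 W v \<in> subspaces" using W span1_subspace v by blast+
  show "W \<subset> span1 W v" using span1_ub[OF W v(1)] v(2) by blast
  fix Z assume Z: "Z \<in> subspaces" "W \<subseteq> Z" "Z \<subseteq> span1 W v"
  show "Z = W \<or> Z = span1 W v"
  proof (cases "Z \<subseteq> W")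
    case False
    then obtain z where z: "z \<in> Z" "z \<notin> W" by blast
    then obtain w a where wa: "w \<in> W" "a \<in> carrier K" "z = w \<boxplus> sc a v" using Z(3) unfolding span1_def by blast
    have "a \<noteq> \<zero>\<^bsub>K\<^esub>" using z(2) wa v(1) subspaceD(2)[OF W] by auto
    moreover have "sc a v \<in> Z" using subspace_cancel[OF Z(1), of w "sc a v"] wa z v Z(2) by auto
    ultimately have "v \<in> Z" using subspace_sc_cancel[OF Z(1) wa(2)] v by blast
    then show ?thesis using span1_least[OF Z(1,2)] Z(3) by blast
  qed (use Z in blast)
qed

text \<open>Together with \<open>covers_span1\<close> this identifies covers with extensions by a
  single vector.\<close>

lemma covers_eq_span1:
  assumes c: "covers subspaces W U" and x: "x \<in> U" "x \<notin> W"
  shows "U = span1 W x"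
proof -
  have S: "W \<in> subspaces" "U \<in> subspaces" "W \<subset> U" using c unfolding covers_def by blast+
  have xc: "x \<in> carrier M" using subspaceD(2)[OF S(2) x(1)] .
  have "span1 W x \<subseteq> U" by (rule span1_least) (use S x in blast)+
  then have "span1 W x = W \<or> span1 W x = U"
    using c span1_subspace[OF S(1) xc] span1_ub(1)[OF S(1) xc] unfolding covers_def by blast
  then show ?thesis using span1_ub(2)[OF S(1) xc] x(2) by blast
qed

lemma coeff_unique:
  assumes U: "U \<in> subspaces" and x: "x \<in> carrier M" "x \<notin> U" and a: "a \<in> carrier K" "a' \<in> carrier K"
    and u: "u \<in> U" "u' \<in> U" and e: "u \<boxplus> sc a x = u' \<boxplus> sc a' x"
  shows "a = a'" "u = u'"
proof -
  have uc: "u \<in> carrier M" "u' \<in> carrier M" using u subspaceD(2)[OF U] by blast+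
  let ?d = "a \<oplus>\<^bsub>K\<^esub> \<ominus>\<^bsub>K\<^esub> a'"
  have "u \<boxplus> sc ?d x = (u \<boxplus> sc a x) \<boxplus> \<boxminus> sc a' x" using a x uc by (simp add: sc_add_left sc_neg M.a_assoc)
  also have "\<dots> = u'" unfolding e using a x uc by (simp add: M.a_assoc M.r_neg)
  finally have "u \<boxplus> sc ?d x \<in> U" using u(2) by simp
  then have "sc ?d x \<in> U" using subspace_cancel[OF U u(1)] a x by simp
  then have "?d = \<zero>\<^bsub>K\<^esub>" using subspace_sc_cancel[OF U, of ?d x] a x by auto
  then show "a = a'" using a K.minus_equality[of a "\<ominus>\<^bsub>K\<^esub> a'"] by simp
  then show "u = u'" using e a x uc M.add.right_cancel[of "sc a x" u u'] by simp
qed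

lemma vneg_zero [simp]: "\<boxminus> \<zero>v = \<zero>v"
  by (rule M.minus_equality) simp_all

section \<open>Dimensions of quotients\<close>

lemma qdim_refl: "U \<in> subspaces \<Longrightarrow> qdim U U 0"
  unfolding qdim_def using subspaceD(2)[of U]
  by (intro exI[of _ "{}"]) (auto simp: M.minus_eq)

lemma comb_closed:
  assumes "B \<subseteq> carrier M" "c \<in> B \<rightarrow>\<^sub>E carrier K"
  shows "(\<Oplus>\<^bsub>M\<^esub>b\<in>B. sc (c b) b) \<in> carrier M"
  by (rule M.finsum_closed) (use assms in \<open>auto simp: PiE_iff\<close>)

lemma comb_in_subspace:
  assumes U: "U \<in> subspaces" and B: "finite B" "B \<subseteq> U" and c: "c \<in> B \<rightarrow>\<^sub>E carrier K"
  shows "(\<Oplus>\<^bsub>M\<^esub>b\<in>B. sc (c b) b) \<in> U"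
  using B c
proof (induction B arbitrary: c rule: finite_induct)
  case empty then show ?case using subspaceD(3)[OF U] by simp
next
  case (insert y B)
  have Bc: "B \<subseteq> carrier M" "y \<in> carrier M" using insert.prems(1) subspaceD(1)[OF U] by auto
  have "(\<Oplus>\<^bsub>M\<^esub>b\<in>insert y B. sc (c b) b) = sc (c y) y \<boxplus> (\<Oplus>\<^bsub>M\<^esub>b\<in>B. sc (c b) b)"
    by (rule M.finsum_insert) (use insert Bc in \<open>auto simp: PiE_iff\<close>)
  moreover have "(\<Oplus>\<^bsub>M\<^esub>b\<in>B. sc (c b) b) = (\<Oplus>\<^bsub>M\<^esub>b\<in>B. sc (restrict c B b) b)"
    by (rule M.finsum_cong') (use insert Bc in \<open>auto simp: PiE_iff\<close>)
  moreover have "restrict c B \<in> B \<rightarrow>\<^sub>E carrier K" using insert.prems(2) by (intro restrict_PiE_iff[THEN iffD2]) auto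
  then have "(\<Oplus>\<^bsub>M\<^esub>b\<in>B. sc (restrict c B b) b) \<in> U" using insert.IH insert.prems(1) by blast
  moreover have "sc (c y) y \<in> U" using subspaceD(5)[OF U] insert.prems by auto
  ultimately show ?case using subspaceD(4)[OF U] by simp
qed

text \<open>A vector \<open>x\<close> of \<open>X\<close> outside \<open>U\<close> is added to the
  basis. In an expansion of \<open>u + a x\<close> modulo \<open>W\<close> the coefficient of
  \<open>x\<close> must be \<open>a\<close>, since otherwise \<open>x\<close> would lie in
  \<open>U\<close>; the other coefficients form an expansion of \<open>u\<close>.\<close>

lemma qdim_step:
  assumes W: "W \<in> subspaces" "W \<subseteq> U" and q: "qdim U W d" and c: "covers subspaces U X"
  shows "qdim X W (Suc d)"
proof -
  obtain B where B: "finite B" "B \<subseteq> U" "card B = d"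
    and Bu': "\<forall>u\<in>U. \<exists>!c. c \<in> B \<rightarrow>\<^sub>E carrier K \<and> u \<ominus>\<^bsub>M\<^esub> (\<Oplus>\<^bsub>M\<^esub>b\<in>B. sc (c b) b) \<in> W"
    using q unfolding qdim_def by (elim exE conjE)
  note Bu = bspec[OF Bu']
  have S: "U \<in> subspaces" "X \<in> subspaces" "U \<subset> X" using c unfolding covers_def by blast+
  obtain x where x: "x \<in> X" "x \<notin> U" using S(3) by blast
  have xc: "x \<in> carrier M" using subspaceD(2)[OF S(2) x(1)] .
  have xB: "x \<notin> B" using x(2) B(2) by blast
  have Bc: "B \<subseteq> carrier M" using B(2) subspaceD(1)[OF S(1)] by blast
  have Xe: "X = span1 U x" by (rule covers_eq_span1[OF c x])
  let ?sum = "\<lambda>B c. \<Oplus>\<^bsub>M\<^esub>b\<in>B. sc (c b) b"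
  have sum_ins: "?sum (insert x B) c = sc (c x) x \<boxplus> ?sum B (restrict c B)"
    if "c \<in> insert x B \<rightarrow>\<^sub>E carrier K" for c
  proof -
    have "?sum (insert x B) c = sc (c x) x \<boxplus> ?sum B c"
      by (rule M.finsum_insert) (use that B(1) xB Bc xc in \<open>auto simp: PiE_iff\<close>)
    moreover have "?sum B c = ?sum B (restrict c B)"
      by (rule M.finsum_cong') (use that Bc in \<open>auto simp: PiE_iff\<close>)
    ultimately show ?thesis by simp
  qed
  note sumU = comb_in_subspace[OF S(1) B(1,2)]
  have key: "(c \<in> insert x B \<rightarrow>\<^sub>E carrier K \<and> (u \<boxplus> sc a x) \<ominus>\<^bsub>M\<^esub> ?sum (insert x B) c \<in> W) \<longleftrightarrow>
      (c \<in> insert x B \<rightarrow>\<^sub>E carrier K \<and> c x = a \<and> u \<ominus>\<^bsub>M\<^esub> ?sum B (restrict c B) \<in> W)"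
    if u: "u \<in> U" and a: "a \<in> carrier K" for u a c
  proof (cases "c \<in> insert x B \<rightarrow>\<^sub>E carrier K")
    case c: True
    then have cx: "c x \<in> carrier K" by auto
    have r: "restrict c B \<in> B \<rightarrow>\<^sub>E carrier K" using c by (auto simp: PiE_iff)
    let ?s = "?sum B (restrict c B)"
    have sU: "?s \<in> U" and sc: "?s \<in> carrier M" using sumU[OF r] comb_closed[OF Bc r] by blast+
    have uc: "u \<in> carrier M" using subspaceD(2)[OF S(1) u] .
    have uU: "u \<ominus>\<^bsub>M\<^esub> ?s \<in> U" unfolding M.minus_eq using subspaceD(4)[OF S(1) u] subspace_neg[OF S(1) sU] by blast
    have e: "(u \<boxplus> sc a x) \<ominus>\<^bsub>M\<^esub> ?sum (insert x B) c = (u \<ominus>\<^bsub>M\<^esub> ?s) \<boxplus> sc (a \<oplus>\<^bsub>K\<^esub> \<ominus>\<^bsub>K\<^esub> c x) x"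
      unfolding sum_ins[OF c] using uc sc xc a cx by (simp add: M.minus_eq M.minus_add sc_add_left sc_neg M.a_ac)
    show ?thesis
    proof (cases "c x = a")
      case True
      have "(u \<boxplus> sc a x) \<ominus>\<^bsub>M\<^esub> ?sum (insert x B) c = u \<ominus>\<^bsub>M\<^esub> ?s"
        unfolding e using True uc sc xc a by (simp add: K.r_neg)
      then show ?thesis using True by simp
    next
      case False
      have "(u \<boxplus> sc a x) \<ominus>\<^bsub>M\<^esub> ?sum (insert x B) c \<notin> W"
      proof
        assume "(u \<boxplus> sc a x) \<ominus>\<^bsub>M\<^esub> ?sum (insert x B) c \<in> W"
        then have "(u \<ominus>\<^bsub>M\<^esub> ?s) \<boxplus> sc (a \<oplus>\<^bsub>K\<^esub> \<ominus>\<^bsub>K\<^esub> c x) x \<in> U" using e W(2) by auto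
        then have "sc (a \<oplus>\<^bsub>K\<^esub> \<ominus>\<^bsub>K\<^esub> c x) x \<in> U" using subspace_cancel[OF S(1) uU] a cx xc by simp
        moreover have "a \<oplus>\<^bsub>K\<^esub> \<ominus>\<^bsub>K\<^esub> c x \<in> carrier K" using a cx by simp
        ultimately have "a \<oplus>\<^bsub>K\<^esub> \<ominus>\<^bsub>K\<^esub> c x = \<zero>\<^bsub>K\<^esub>" using subspace_sc_cancel[OF S(1) _ _ xc] x(2) by blast
        then show False using False a cx K.minus_equality[of a "\<ominus>\<^bsub>K\<^esub> c x"] by simp
      qed
      then show ?thesis using False by blast
    qed
  qed blast
  show ?thesis unfolding qdim_def
  proof (intro exI[of _ "insert x B"] conjI ballI)
    show "finite (insert x B)" "card (insert x B) = Suc d" "insert x B \<subseteq> X" using B xB x S(3) by auto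
    fix v assume "v \<in> X"
    then obtain u a where v: "u \<in> U" "a \<in> carrier K" "v = u \<boxplus> sc a x" unfolding Xe span1_def by blast
    from Bu[OF v(1)] obtain c where c0: "c \<in> B \<rightarrow>\<^sub>E carrier K \<and> u \<ominus>\<^bsub>M\<^esub> ?sum B c \<in> W"
      and c1: "\<forall>c'. c' \<in> B \<rightarrow>\<^sub>E carrier K \<and> u \<ominus>\<^bsub>M\<^esub> ?sum B c' \<in> W \<longrightarrow> c' = c" by (rule ex1E)
    note c = conjunct1[OF c0] conjunct2[OF c0] c1[rule_format, OF conjI]
    show "\<exists>!c. c \<in> insert x B \<rightarrow>\<^sub>E carrier K \<and> v \<ominus>\<^bsub>M\<^esub> ?sum (insert x B) c \<in> W"
      unfolding v(3) key[OF v(1,2)]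
    proof (rule ex1I[of _ "c(x := a)"])
      have "restrict (c(x := a)) B = c" using c(1) xB by (auto simp: fun_eq_iff PiE_iff extensional_def)
      then show "c(x := a) \<in> insert x B \<rightarrow>\<^sub>E carrier K \<and> (c(x := a)) x = a \<and> u \<ominus>\<^bsub>M\<^esub> ?sum B (restrict (c(x := a)) B) \<in> W"
        using c(1,2) v(2) by (auto simp: PiE_iff extensional_def)
      fix c' assume c': "c' \<in> insert x B \<rightarrow>\<^sub>E carrier K \<and> c' x = a \<and> u \<ominus>\<^bsub>M\<^esub> ?sum B (restrict c' B) \<in> W"
      have "restrict c' B \<in> B \<rightarrow>\<^sub>E carrier K" using c' by (auto simp: PiE_iff)
      then have e: "restrict c' B = c" using c(3) c' by blast
      show "c' = c(x := a)"
      proof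
        fix b show "c' b = (c(x := a)) b"
          using c' fun_cong[OF e, of b] c(1) by (cases "b \<in> B"; cases "b = x") (auto simp: PiE_iff extensional_def)
      qed
    qed
  qed
qed

text \<open>Over a field with \<open>q\<close> elements \<open>U / W\<close> has
  \<open>q ^ d\<close> cosets, and \<open>q > 1\<close> makes the exponent unique.\<close>

lemma qdim_unique:
  assumes W: "W \<in> subspaces" and U: "U \<in> subspaces" and WU: "W \<subseteq> U" and q: "qdim U W d" "qdim U W d'"
  shows "d = d'"
proof -
  let ?\<kappa> = "\<lambda>u. {v \<in> U. v \<ominus>\<^bsub>M\<^esub> u \<in> W}"
  have card: "card (?\<kappa> ` U) = card (carrier K) ^ d" if q: "qdim U W d" for d
  proof -
    obtain B where B: "finite B" "B \<subseteq> U" "card B = d"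
      and Bu': "\<forall>u\<in>U. \<exists>!c. c \<in> B \<rightarrow>\<^sub>E carrier K \<and> u \<ominus>\<^bsub>M\<^esub> (\<Oplus>\<^bsub>M\<^esub>b\<in>B. sc (c b) b) \<in> W"
      using q unfolding qdim_def by (elim exE conjE)
    note Bu = bspec[OF Bu']
    let ?P = "B \<rightarrow>\<^sub>E carrier K" and ?\<sigma> = "\<lambda>c. \<Oplus>\<^bsub>M\<^esub>b\<in>B. sc (c b) b"
    define cf where "cf u = (THE c. c \<in> ?P \<and> u \<ominus>\<^bsub>M\<^esub> ?\<sigma> c \<in> W)" for u
    have cf: "cf u \<in> ?P" "u \<ominus>\<^bsub>M\<^esub> ?\<sigma> (cf u) \<in> W" if "u \<in> U" for u
      using theI'[OF Bu[OF that]] unfolding cf_def by blast+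
    have cfI: "cf u = c" if "u \<in> U" "c \<in> ?P" "u \<ominus>\<^bsub>M\<^esub> ?\<sigma> c \<in> W" for u c
      unfolding cf_def by (rule the1_equality[OF Bu[OF that(1)]]) (use that in blast)
    have sM: "?\<sigma> c \<in> carrier M" if "c \<in> ?P" for c
      by (rule comb_closed[OF _ that]) (use B(2) subspaceD(1)[OF U] in blast)
    note sU = comb_in_subspace[OF U B(1,2)]
    have self: "v \<ominus>\<^bsub>M\<^esub> v \<in> W" if "v \<in> carrier M" for v using that subspaceD(3)[OF W] by (simp add: M.minus_eq M.r_neg)
    have diff: "w \<ominus>\<^bsub>M\<^esub> v \<in> W" if "v \<in> carrier M" "w \<in> carrier M" "v \<ominus>\<^bsub>M\<^esub> w \<in> W" for v w
      using subspace_neg[OF W that(3)] that by (simp add: M.minus_eq M.minus_add M.a_comm)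
    have tr: "v \<ominus>\<^bsub>M\<^esub> x \<in> W" if "v \<in> carrier M" "w \<in> carrier M" "x \<in> carrier M" "v \<ominus>\<^bsub>M\<^esub> w \<in> W" "w \<ominus>\<^bsub>M\<^esub> x \<in> W" for v w x
    proof -
      have "v \<ominus>\<^bsub>M\<^esub> x = (v \<ominus>\<^bsub>M\<^esub> w) \<boxplus> (w \<ominus>\<^bsub>M\<^esub> x)"
        using that by (simp add: M.minus_eq M.a_assoc M.r_neg1)
      then show ?thesis using subspaceD(4)[OF W that(4,5)] by simp
    qed
    have "bij_betw (\<lambda>c. ?\<kappa> (?\<sigma> c)) ?P (?\<kappa> ` U)"
    proof (rule bij_betw_imageI)
      show "inj_on (\<lambda>c. ?\<kappa> (?\<sigma> c)) ?P"
      proof (rule inj_onI)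
        fix c c' assume c: "c \<in> ?P" "c' \<in> ?P" and e: "?\<kappa> (?\<sigma> c) = ?\<kappa> (?\<sigma> c')"
        have "?\<sigma> c \<in> ?\<kappa> (?\<sigma> c)" using sU sM self c by blast
        then have "?\<sigma> c \<ominus>\<^bsub>M\<^esub> ?\<sigma> c' \<in> W" using e by blast
        then have "cf (?\<sigma> c) = c'" by (rule cfI[OF sU[OF c(1)] c(2)])
        moreover have "cf (?\<sigma> c) = c" by (rule cfI[OF sU[OF c(1)] c(1) self[OF sM[OF c(1)]]])
        ultimately show "c = c'" by simp
      qed
      show "(\<lambda>c. ?\<kappa> (?\<sigma> c)) ` ?P = ?\<kappa> ` U"
      proof (intro equalityI subsetI)
        fix z assume "z \<in> ?\<kappa> ` U"
        then obtain u where u: "u \<in> U" "z = ?\<kappa> u" by blast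
        have uM: "u \<in> carrier M" using subspaceD(2)[OF U u(1)] .
        note s = sM[OF cf(1)[OF u(1)]]
        have "?\<kappa> u = ?\<kappa> (?\<sigma> (cf u))"
        proof (intro equalityI subsetI CollectI conjI)
          fix v assume v: "v \<in> ?\<kappa> u"
          then show "v \<in> U" by blast
          show "v \<ominus>\<^bsub>M\<^esub> ?\<sigma> (cf u) \<in> W"
            by (rule tr[OF _ uM s _ cf(2)[OF u(1)]]) (use v subspaceD(2)[OF U] in blast)+
        next
          fix v assume v: "v \<in> ?\<kappa> (?\<sigma> (cf u))"
          then show "v \<in> U" by blast
          show "v \<ominus>\<^bsub>M\<^esub> u \<in> W"
            by (rule tr[OF _ s uM _ diff[OF uM s cf(2)[OF u(1)]]]) (use v subspaceD(2)[OF U] in blast)+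
        qed
        then show "z \<in> (\<lambda>c. ?\<kappa> (?\<sigma> c)) ` ?P" using u cf(1) by blast
      next
        fix z assume "z \<in> (\<lambda>c. ?\<kappa> (?\<sigma> c)) ` ?P"
        then show "z \<in> ?\<kappa> ` U" using sU by blast
      qed
    qed
    from bij_betw_same_card[OF this] have "card (?\<kappa> ` U) = card ?P" by (rule sym)
    then show ?thesis using B by (simp add: card_PiE)
  qed
  have "{\<zero>\<^bsub>K\<^esub>, \<one>\<^bsub>K\<^esub>} \<subseteq> carrier K" by simp
  then have "card {\<zero>\<^bsub>K\<^esub>, \<one>\<^bsub>K\<^esub>} \<le> card (carrier K)" by (rule card_mono[OF fin])
  then have "1 < card (carrier K)" by simp
  moreover have "card (carrier K) ^ d = card (carrier K) ^ d'" using card[OF q(1)] card[OF q(2)] by simp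
  ultimately show ?thesis by (simp add: power_inject_exp)
qed

text \<open>The points of a projective line. With \<open>x\<close> in \<open>U\<close> outside
  \<open>W\<close> and \<open>y\<close> in \<open>X\<close> outside \<open>U\<close>, they are
  \<open>U\<close> and the spaces generated by \<open>W\<close> and \<open>a x + y\<close>, one for
  each scalar \<open>a\<close>.\<close>

lemma card_between:
  assumes c1: "covers subspaces W U" and c2: "covers subspaces U X"
  shows "finite {Y \<in> subspaces. W \<subset> Y \<and> Y \<subset> X} \<and>
    card {Y \<in> subspaces. W \<subset> Y \<and> Y \<subset> X} = Suc (card (carrier K))"
proof -
  have S: "W \<in> subspaces" "U \<in> subspaces" "X \<in> subspaces" "W \<subset> U" "U \<subset> X"
    using c1 c2 unfolding covers_def by blast+
  obtain x where x: "x \<in> U" "x \<notin> W" using S(4) by blast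
  obtain y where y: "y \<in> X" "y \<notin> U" using S(5) by blast
  have xc: "x \<in> carrier M" and yc: "y \<in> carrier M" using subspaceD(2) S x y by blast+
  have Ue: "U = span1 W x" by (rule covers_eq_span1[OF c1 x])
  have Xe: "X = span1 U y" by (rule covers_eq_span1[OF c2 y])
  let ?p = "\<lambda>a. sc a x \<boxplus> y"
  let ?Y = "\<lambda>a. span1 W (?p a)"
  have pc: "?p a \<in> carrier M" if "a \<in> carrier K" for a using that xc yc by simp
  have ax: "sc a x \<in> U" if "a \<in> carrier K" for a using subspaceD(5)[OF S(2) that x(1)] .
  have pU: "?p a \<notin> U" if a: "a \<in> carrier K" for a
    using subspace_cancel[OF S(2) ax[OF a] yc] y(2) by blast
  have YS: "?Y a \<in> subspaces" if "a \<in> carrier K" for a by (rule span1_subspace[OF S(1) pc[OF that]])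
  have YU: "?Y a \<inter> U \<subseteq> W" if a: "a \<in> carrier K" for a
  proof
    fix z assume "z \<in> ?Y a \<inter> U"
    then obtain w b where w: "w \<in> W" "b \<in> carrier K" "z = w \<boxplus> sc b (?p a)" "z \<in> U" unfolding span1_def by blast
    have "sc b (?p a) \<in> U" using subspace_cancel[OF S(2), of w "sc b (?p a)"] w pc[OF a] S(4) by auto
    then have "b = \<zero>\<^bsub>K\<^esub>" using subspace_sc_cancel[OF S(2) w(2) _ pc[OF a]] pU[OF a] by blast
    then have "z = w" using w pc[OF a] subspaceD(2)[OF S(1)] by simp
    then show "z \<in> W" using w(1) by simp
  qed
  have mids: "{Y \<in> subspaces. W \<subset> Y \<and> Y \<subset> X} = insert U (?Y ` carrier K)"
  proof (intro equalityI subsetI)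
    fix Y assume "Y \<in> insert U (?Y ` carrier K)"
    then consider "Y = U" | a where "a \<in> carrier K" "Y = ?Y a" by blast
    then show "Y \<in> {Y \<in> subspaces. W \<subset> Y \<and> Y \<subset> X}"
    proof cases
      case 1 then show ?thesis using S by blast
    next
      case 2
      note s = span1_ub[OF S(1) pc[OF 2(1)]]
      have "?Y a \<subseteq> X"
      proof (rule span1_least[OF S(3)])
        show "?p a \<in> X" using subspaceD(4)[OF S(3)] ax[OF 2(1)] y(1) S(5) by blast
      qed (use S in blast)
      moreover have "x \<notin> ?Y a" using YU[OF 2(1)] x by blast
      ultimately have "?Y a \<subset> X" using x(1) S(5) by blast
      moreover have "W \<subset> ?Y a" using s pU[OF 2(1)] S(4) by blast
      ultimately show ?thesis using YS[OF 2(1)] 2(2) by blast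
    qed
  next
    fix Z assume "Z \<in> {Y \<in> subspaces. W \<subset> Y \<and> Y \<subset> X}"
    then have Z: "Z \<in> subspaces" "W \<subset> Z" "Z \<subset> X" by blast+
    show "Z \<in> insert U (?Y ` carrier K)"
    proof (cases "Z = U")
      case False
      have "\<not> Z \<subseteq> U" using coversD[OF c1 Z(1)] Z(2) False by blast
      then obtain z where z: "z \<in> Z" "z \<notin> U" by blast
      have "\<not> U \<subseteq> Z" using coversD[OF c2 Z(1)] Z(3) False by blast
      then have ZU: "Z \<inter> U = W" using coversD[OF c1 subspace_Int[OF Z(1) S(2)]] Z(2) S(4) by blast
      obtain u b where u: "u \<in> U" "b \<in> carrier K" "z = u \<boxplus> sc b y" using z(1) Z(3) Xe unfolding span1_def by blast
      obtain w a where w: "w \<in> W" "a \<in> carrier K" "u = w \<boxplus> sc a x" using u(1) Ue unfolding span1_def by blast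
      have uc: "u \<in> carrier M" "w \<in> carrier M" using u(1) w(1) subspaceD(2) S by blast+
      have b0: "b \<noteq> \<zero>\<^bsub>K\<^esub>" using z(2) u uc yc by auto
      then have "b \<in> Units K" using u(2) K.field_Units by blast
      then have bi: "inv\<^bsub>K\<^esub> b \<in> carrier K" "b \<otimes>\<^bsub>K\<^esub> inv\<^bsub>K\<^esub> b = \<one>\<^bsub>K\<^esub>" by simp_all
      \<comment> \<open>Dividing \<open>z = w + a x + b y\<close> by \<open>b\<close> suggests the
        normalised generator \<open>a' x + y\<close>.\<close>
      define a' where "a' = inv\<^bsub>K\<^esub> b \<otimes>\<^bsub>K\<^esub> a"
      have a': "a' \<in> carrier K" using bi w(2) by (simp add: a'_def)
      have "b \<otimes>\<^bsub>K\<^esub> a' = a" unfolding a'_def using bi u(2) w(2) by (simp add: K.m_assoc[symmetric])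
      then have "sc b (?p a') = sc a x \<boxplus> sc b y" using a' u(2) xc yc by (simp add: sc_add_right sc_mult[symmetric])
      then have "z = w \<boxplus> sc b (?p a')" unfolding u(3) w(3) using uc xc yc w(2) u(2) by (simp add: M.a_assoc)
      then have "sc b (?p a') \<in> Z"
        using subspace_cancel[OF Z(1), of w "sc b (?p a')"] z(1) w(1) Z(2) u(2) pc[OF a'] by auto
      then have pZ: "?p a' \<in> Z" using subspace_sc_cancel[OF Z(1) u(2) b0 pc[OF a']] by blast
      have "?Y a' \<subseteq> Z" by (rule span1_least[OF Z(1) _ pZ]) (use Z in blast)
      moreover have "Z \<subseteq> ?Y a'"
      proof
        fix t assume t: "t \<in> Z"
        then obtain v c where v: "v \<in> U" "c \<in> carrier K" "t = v \<boxplus> sc c y" using Z(3) Xe unfolding span1_def by blast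
        have vc: "v \<in> carrier M" using subspaceD(2)[OF S(2) v(1)] .
        \<comment> \<open>Subtracting \<open>c\<close> times the generator removes \<open>y\<close>
          from \<open>t\<close>; the rest lies in \<open>Z \<inter> U\<close>, which is
          \<open>W\<close>.\<close>
        define d where "d = \<ominus>\<^bsub>K\<^esub> c"
        have d: "d \<in> carrier K" using v(2) by (simp add: d_def)
        have "t \<boxplus> sc d (?p a') \<in> Z" using subspaceD(4)[OF Z(1) t subspaceD(5)[OF Z(1) d pZ]] .
        moreover have e: "t \<boxplus> sc d (?p a') = v \<boxplus> sc d (sc a' x)"
        proof -
          have "t \<boxplus> sc d (?p a') = (v \<boxplus> sc d (sc a' x)) \<boxplus> (sc c y \<boxplus> sc d y)"
            unfolding v(3) using vc v(2) d a' xc yc by (simp add: sc_add_right M.a_ac)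
          also have "sc c y \<boxplus> sc d y = \<zero>v" unfolding d_def using v(2) yc by (simp add: sc_neg M.r_neg)
          finally show ?thesis using vc d a' xc by simp
        qed
        moreover have "\<dots> \<in> U" using subspaceD(4)[OF S(2) v(1) subspaceD(5)[OF S(2) d ax[OF a']]] .
        ultimately have tW: "t \<boxplus> sc d (?p a') \<in> W" using ZU by auto
        have tc: "t \<in> carrier M" using subspaceD(2)[OF Z(1) t] .
        have "t = (t \<boxplus> sc d (?p a')) \<boxplus> sc c (?p a')"
        proof -
          have "sc d (?p a') \<boxplus> sc c (?p a') = \<zero>v"
            unfolding d_def using v(2) pc[OF a'] by (simp add: sc_neg M.l_neg)
          then show ?thesis using tc v(2) d pc[OF a'] by (simp add: M.a_assoc)
        qed
        then show "t \<in> ?Y a'" unfolding span1_def using tW v(2) by blast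
      qed
      ultimately show ?thesis using a' by blast
    qed simp
  qed
  have inj: "inj_on ?Y (carrier K)"
  proof (rule inj_onI)
    fix a a' assume a: "a \<in> carrier K" "a' \<in> carrier K" and e: "?Y a = ?Y a'"
    have "?p a \<in> ?Y a'" using span1_ub(2)[OF S(1) pc[OF a(1)]] e by simp
    then obtain w b where w: "w \<in> W" "b \<in> carrier K" "?p a = w \<boxplus> sc b (?p a')" unfolding span1_def by blast
    have wc: "w \<in> carrier M" using subspaceD(2)[OF S(1) w(1)] .
    have "sc a x \<boxplus> sc \<one>\<^bsub>K\<^esub> y = (w \<boxplus> sc (b \<otimes>\<^bsub>K\<^esub> a') x) \<boxplus> sc b y"
      using w(2,3) wc a xc yc by (simp add: sc_add_right sc_mult M.a_assoc)
    moreover have "w \<boxplus> sc (b \<otimes>\<^bsub>K\<^esub> a') x \<in> U"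
      using subspaceD(4)[OF S(2)] w ax[of "b \<otimes>\<^bsub>K\<^esub> a'"] a S(4) by auto
    ultimately have b: "\<one>\<^bsub>K\<^esub> = b" and e2: "sc a x = w \<boxplus> sc (b \<otimes>\<^bsub>K\<^esub> a') x"
      using coeff_unique[OF S(2) yc y(2) _ w(2) ax[OF a(1)]] K.one_closed by blast+
    have "b \<otimes>\<^bsub>K\<^esub> a' = a'" using b[symmetric] a by simp
    then have "\<zero>v \<boxplus> sc a x = w \<boxplus> sc a' x" using e2 a xc wc M.l_zero[of "sc a x"] by simp
    then show "a = a'" using coeff_unique(1)[OF S(1) xc x(2) a subspaceD(3)[OF S(1)] w(1)] by blast
  qed
  have "U \<notin> ?Y ` carrier K"
  proof
    assume "U \<in> ?Y ` carrier K"
    then obtain a where "a \<in> carrier K" "U = ?Y a" by blast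
    then show False using YU x by blast
  qed
  then show ?thesis unfolding mids using fin inj by (simp add: card_image)
qed

end

section \<open>Lattices over a finite field\<close>

locale laurent_lattices = K: field K for K :: "('a, 'b) ring_scheme" (structure) +
  fixes r :: nat
  assumes finK: "finite (carrier K)"
begin

abbreviation V where "V \<equiv> lat_space K r"
abbreviation scal where "scal c v \<equiv> laurent_monom K c 0 \<odot>\<^bsub>V\<^esub> v"

text \<open>Multiplication by a power of the indeterminate, given on coefficients so that no sum is
  involved; \<open>vsh_eq\<close> links it to the module structure.\<close>

definition vsh :: "int \<Rightarrow> (nat \<Rightarrow> int \<Rightarrow> 'a) \<Rightarrow> nat \<Rightarrow> int \<Rightarrow> 'a" where
  "vsh a v = (\<lambda>t\<in>{..<r}. \<lambda>m. v t (m - a))"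

abbreviation lsh :: "int \<Rightarrow> (nat \<Rightarrow> int \<Rightarrow> 'a) set \<Rightarrow> (nat \<Rightarrow> int \<Rightarrow> 'a) set" where
  "lsh a U \<equiv> vsh a ` U"

lemma V_mem: "v \<in> carrier V \<longleftrightarrow> v \<in> extensional {..<r} \<and>
    (\<forall>t<r. (\<forall>m. v t m \<in> carrier K) \<and> finite {m. v t m \<noteq> \<zero>})"
  by (auto simp: free_module_def laurent_def PiE_iff)

lemma V_memD:
  assumes "v \<in> carrier V" "t < r"
  shows "v t m \<in> carrier K" "finite {m. v t m \<noteq> \<zero>}"
  using assms V_mem by blast+

lemma V_eqI:
  assumes "v \<in> carrier V" "w \<in> carrier V" "\<And>t m. t < r \<Longrightarrow> v t m = w t m"
  shows "v = w"
proof
  fix t show "v t = w t"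
    using assms by (cases "t < r") (auto simp: V_mem extensional_def fun_eq_iff)
qed

lemma V_I:
  assumes "\<And>t m. t < r \<Longrightarrow> F t m \<in> carrier K" "\<And>t. t < r \<Longrightarrow> finite {m. F t m \<noteq> \<zero>}"
  shows "(\<lambda>t\<in>{..<r}. F t) \<in> carrier V"
  using assms by (simp add: V_mem)

lemma V_add: "v \<oplus>\<^bsub>V\<^esub> w = (\<lambda>t\<in>{..<r}. \<lambda>m. v t m \<oplus> w t m)"
  by (simp add: free_module_def laurent_def)

lemma V_zero: "\<zero>\<^bsub>V\<^esub> = (\<lambda>t\<in>{..<r}. \<lambda>m. \<zero>)"
  by (simp add: free_module_def laurent_def)

lemma V_smult: "f \<odot>\<^bsub>V\<^esub> v = (\<lambda>t\<in>{..<r}. \<lambda>m. \<Oplus>i\<in>{i. f i \<noteq> \<zero>}. f i \<otimes> v t (m - i))"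
  by (simp add: free_module_def laurent_def)

lemma V_add_at [simp]: "t < r \<Longrightarrow> (v \<oplus>\<^bsub>V\<^esub> w) t m = v t m \<oplus> w t m"
  by (simp add: V_add)

lemma V_zero_at [simp]: "t < r \<Longrightarrow> \<zero>\<^bsub>V\<^esub> t m = \<zero>"
  by (simp add: V_zero)

lemma vsh_at [simp]: "t < r \<Longrightarrow> vsh a v t m = v t (m - a)"
  by (simp add: vsh_def)

lemma monom_smult:
  assumes "c \<in> carrier K" "v \<in> carrier V"
  shows "laurent_monom K c d \<odot>\<^bsub>V\<^esub> v = (\<lambda>t\<in>{..<r}. \<lambda>m. c \<otimes> v t (m - d))"
proof -
  have "(\<Oplus>i\<in>{i. laurent_monom K c d i \<noteq> \<zero>}. laurent_monom K c d i \<otimes> v t (m - i)) = c \<otimes> v t (m - d)"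
    if "t < r" for t m
  proof (cases "c = \<zero>")
    case True
    then show ?thesis using V_memD[OF assms(2) that] by (simp add: laurent_monom_def)
  next
    case False
    then have "{i. laurent_monom K c d i \<noteq> \<zero>} = {d}" by (auto simp: laurent_monom_def)
    then show ?thesis using V_memD[OF assms(2) that] assms(1) by (simp add: laurent_monom_def)
  qed
  then show ?thesis unfolding V_smult by (auto simp: restrict_def fun_eq_iff)
qed

lemma scal_at [simp]: "c \<in> carrier K \<Longrightarrow> v \<in> carrier V \<Longrightarrow> t < r \<Longrightarrow> scal c v t m = c \<otimes> v t m"
  by (simp add: monom_smult)

lemma vsh_eq: "v \<in> carrier V \<Longrightarrow> laurent_monom K \<one> a \<odot>\<^bsub>V\<^esub> v = vsh a v"
  unfolding monom_smult[OF K.one_closed] vsh_def using V_memD by (auto simp: restrict_def fun_eq_iff)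

lemma V_add_closed: "v \<in> carrier V \<Longrightarrow> w \<in> carrier V \<Longrightarrow> v \<oplus>\<^bsub>V\<^esub> w \<in> carrier V"
  unfolding V_add
proof (rule V_I)
  fix t assume v: "v \<in> carrier V" "w \<in> carrier V" and t: "t < r"
  show "v t m \<oplus> w t m \<in> carrier K" for m using V_memD v t by simp
  have "{m. v t m \<oplus> w t m \<noteq> \<zero>} \<subseteq> {m. v t m \<noteq> \<zero>} \<union> {m. w t m \<noteq> \<zero>}" by auto
  then show "finite {m. v t m \<oplus> w t m \<noteq> \<zero>}" using V_memD(2) v t by (meson finite_UnI finite_subset)
qed

lemma V_zero_closed: "\<zero>\<^bsub>V\<^esub> \<in> carrier V"
  unfolding V_zero by (rule V_I) simp_all

lemma scal_closed: "c \<in> carrier K \<Longrightarrow> v \<in> carrier V \<Longrightarrow> scal c v \<in> carrier V"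
  unfolding monom_smult
proof (rule V_I)
  fix t assume c: "c \<in> carrier K" and v: "v \<in> carrier V" and t: "t < r"
  show "c \<otimes> v t (m - 0) \<in> carrier K" for m using V_memD v t c by simp
  have "{m. c \<otimes> v t (m - 0) \<noteq> \<zero>} \<subseteq> {m. v t m \<noteq> \<zero>}" using c by auto
  then show "finite {m. c \<otimes> v t (m - 0) \<noteq> \<zero>}" using V_memD(2) v t by (meson finite_subset)
qed

lemma vsh_closed: "v \<in> carrier V \<Longrightarrow> vsh a v \<in> carrier V"
  unfolding vsh_def
proof (rule V_I)
  fix t assume v: "v \<in> carrier V" and t: "t < r"
  show "v t (m - a) \<in> carrier K" for m using V_memD v t by simp
  have "{m. v t (m - a) \<noteq> \<zero>} \<subseteq> (\<lambda>m. m + a) ` {m. v t m \<noteq> \<zero>}"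
    by (auto intro!: image_eqI[where x = "_ - a"])
  then show "finite {m. v t (m - a) \<noteq> \<zero>}" using V_memD(2)[OF v t] by (meson finite_imageI finite_subset)
qed

lemma V_group: "abelian_group V"
proof (rule abelian_groupI)
  fix x assume x: "x \<in> carrier V"
  have nc: "scal (\<ominus> \<one>) x \<in> carrier V" by (rule scal_closed) (use x in simp_all)
  have "scal (\<ominus> \<one>) x \<oplus>\<^bsub>V\<^esub> x = \<zero>\<^bsub>V\<^esub>"
  proof (rule V_eqI[OF V_add_closed[OF nc x] V_zero_closed])
    fix t m assume t: "t < r"
    then show "(scal (\<ominus> \<one>) x \<oplus>\<^bsub>V\<^esub> x) t m = \<zero>\<^bsub>V\<^esub> t m"
      using V_memD[OF x t] x by (simp add: K.l_minus K.l_neg)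
  qed
  then show "\<exists>y\<in>carrier V. y \<oplus>\<^bsub>V\<^esub> x = \<zero>\<^bsub>V\<^esub>" using nc by blast
  show "\<zero>\<^bsub>V\<^esub> \<oplus>\<^bsub>V\<^esub> x = x"
    by (rule V_eqI) (use x V_add_closed V_zero_closed V_memD in simp_all)
  fix y assume y: "y \<in> carrier V"
  show "x \<oplus>\<^bsub>V\<^esub> y \<in> carrier V" by (rule V_add_closed[OF x y])
  show "x \<oplus>\<^bsub>V\<^esub> y = y \<oplus>\<^bsub>V\<^esub> x"
    by (rule V_eqI) (use x y V_add_closed V_memD in \<open>simp_all add: K.a_comm\<close>)
  fix z assume z: "z \<in> carrier V"
  show "x \<oplus>\<^bsub>V\<^esub> y \<oplus>\<^bsub>V\<^esub> z = x \<oplus>\<^bsub>V\<^esub> (y \<oplus>\<^bsub>V\<^esub> z)"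
    by (rule V_eqI) (use x y z V_add_closed V_memD in \<open>simp_all add: K.a_assoc\<close>)
qed (rule V_zero_closed)

sublocale vs: fin_vs K V "\<lambda>c v. laurent_monom K c 0 \<odot>\<^bsub>V\<^esub> v"
proof (rule fin_vs.intro[OF K.field_axioms V_group], unfold_locales)
  fix v assume v: "v \<in> carrier V"
  show "scal \<one> v = v" by (rule V_eqI) (use v V_memD scal_closed in simp_all)
  fix a assume a: "a \<in> carrier K"
  show "scal a v \<in> carrier V" by (rule scal_closed[OF a v])
  { fix w assume w: "w \<in> carrier V"
    show "scal a (v \<oplus>\<^bsub>V\<^esub> w) = scal a v \<oplus>\<^bsub>V\<^esub> scal a w"
      by (rule V_eqI) (use a v w V_memD scal_closed V_add_closed in \<open>simp_all add: K.r_distr\<close>) }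
  fix b assume b: "b \<in> carrier K"
  show "scal (a \<oplus> b) v = scal a v \<oplus>\<^bsub>V\<^esub> scal b v"
    by (rule V_eqI) (use a b v V_memD scal_closed V_add_closed in \<open>simp_all add: K.l_distr\<close>)
  show "scal (a \<otimes> b) v = scal a (scal b v)"
    by (rule V_eqI) (use a b v V_memD scal_closed in \<open>simp_all add: K.m_assoc\<close>)
qed (rule finK)

lemma quot_dim_eq: "quot_dim K r = vs.qdim"
  by (intro ext) (simp add: quot_dim_def vs.qdim_def)

abbreviation SS where "SS \<equiv> vs.subspaces"

lemma vsh_add: "v \<in> carrier V \<Longrightarrow> vsh a (vsh b v) = vsh (a + b) v"
  by (rule V_eqI) (simp_all add: vsh_closed algebra_simps)

lemma vsh_0: "v \<in> carrier V \<Longrightarrow> vsh 0 v = v"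
  by (rule V_eqI) (simp_all add: vsh_closed)

lemma SS_V: "U \<in> SS \<Longrightarrow> v \<in> U \<Longrightarrow> v \<in> carrier V"
  by (rule vs.subspaceD(2))

lemma lsh_add: "U \<in> SS \<Longrightarrow> lsh a (lsh b U) = lsh (a + b) U"
  unfolding image_image by (rule image_cong) (auto simp: vsh_add SS_V)

lemma lsh_0: "U \<in> SS \<Longrightarrow> lsh 0 U = U"
  using image_cong[of U U "vsh 0" id] by (simp add: vsh_0 SS_V)

lemma lsh_SS:
  assumes U: "U \<in> SS" shows "lsh a U \<in> SS"
  unfolding vs.subspaces_def
proof (intro CollectI conjI ballI)
  show "lsh a U \<subseteq> carrier V" using SS_V[OF U] vsh_closed by blast
  have "vsh a \<zero>\<^bsub>V\<^esub> = \<zero>\<^bsub>V\<^esub>" by (rule V_eqI) (simp_all add: vsh_closed V_zero_closed)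
  then show "\<zero>\<^bsub>V\<^esub> \<in> lsh a U" using vs.subspaceD(3)[OF U] by force
  fix x assume "x \<in> lsh a U"
  then obtain u where u: "u \<in> U" "x = vsh a u" by blast
  note uV = SS_V[OF U u(1)]
  { fix y assume "y \<in> lsh a U"
    then obtain w where w: "w \<in> U" "y = vsh a w" by blast
    note wV = SS_V[OF U w(1)]
    have "x \<oplus>\<^bsub>V\<^esub> y = vsh a (u \<oplus>\<^bsub>V\<^esub> w)" unfolding u w
      by (rule V_eqI) (simp_all add: vsh_closed V_add_closed uV wV)
    then show "x \<oplus>\<^bsub>V\<^esub> y \<in> lsh a U" using vs.subspaceD(4)[OF U u(1) w(1)] by blast }
  fix k assume k: "k \<in> carrier K"
  have "scal k x = vsh a (scal k u)" unfolding u
    by (rule V_eqI) (simp_all add: vsh_closed scal_closed uV k)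
  then show "scal k x \<in> lsh a U" using vs.subspaceD(5)[OF U k u(1)] by blast
qed

definition supp_space :: "(nat \<Rightarrow> int \<Rightarrow> bool) \<Rightarrow> (nat \<Rightarrow> int \<Rightarrow> 'a) set" where
  "supp_space P = {v \<in> carrier V. \<forall>t<r. \<forall>m. \<not> P t m \<longrightarrow> v t m = \<zero>}"

lemma supp_space_SS: "supp_space P \<in> SS"
  unfolding vs.subspaces_def supp_space_def
  by (auto simp: V_zero_closed V_add_closed scal_closed)

definition unit_vec :: "nat \<Rightarrow> int \<Rightarrow> nat \<Rightarrow> int \<Rightarrow> 'a" where
  "unit_vec t m = (\<lambda>s\<in>{..<r}. \<lambda>k. if s = t \<and> k = m then \<one> else \<zero>)"

lemma unit_vec_closed: "unit_vec t m \<in> carrier V"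
  unfolding unit_vec_def
proof (rule V_I)
  fix s show "finite {k. (if s = t \<and> k = m then \<one> else \<zero>) \<noteq> \<zero>}" by (rule finite_subset[of _ "{m}"]) auto
qed simp

lemma unit_vec_at [simp]: "s < r \<Longrightarrow> unit_vec t m s k = (if s = t \<and> k = m then \<one> else \<zero>)"
  by (simp add: unit_vec_def)

lemma vsh_unit_vec: "vsh a (unit_vec t m) = unit_vec t (m + a)"
  by (rule V_eqI) (auto simp: unit_vec_closed vsh_closed)

text \<open>Induction on the number of nonzero coefficients, which is finite; deleting one
  coefficient subtracts a multiple of a unit vector that lies in \<open>U\<close>.\<close>

lemma supp_space_span:
  assumes U: "U \<in> SS" and u: "\<And>t m. t < r \<Longrightarrow> P t m \<Longrightarrow> unit_vec t m \<in> U"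
  shows "supp_space P \<subseteq> U"
proof
  fix v assume "v \<in> supp_space P"
  then show "v \<in> U"
  proof (induction "card (SIGMA t:{..<r}. {m. v t m \<noteq> \<zero>})" arbitrary: v rule: less_induct)
    case less
    let ?Z = "\<lambda>v. SIGMA t:{..<r}. {m. v t m \<noteq> \<zero>}"
    have vV: "v \<in> carrier V" and vP: "\<And>t m. t < r \<Longrightarrow> v t m \<noteq> \<zero> \<Longrightarrow> P t m"
      using less(2) unfolding supp_space_def by auto
    have fin: "finite (?Z v)" using V_memD(2)[OF vV] by auto
    show ?case
    proof (cases "?Z v = {}")
      case True
      have "v = \<zero>\<^bsub>V\<^esub>" by (rule V_eqI[OF vV V_zero_closed]) (use True in auto)
      then show ?thesis using vs.subspaceD(3)[OF U] by simp
    next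
      case False
      then obtain t m where tm: "t < r" "v t m \<noteq> \<zero>" by auto
      define w where "w = (\<lambda>s\<in>{..<r}. \<lambda>k. if s = t \<and> k = m then \<zero> else v s k)"
      have wV: "w \<in> carrier V" unfolding w_def
      proof (rule V_I)
        fix s assume s: "s < r"
        show "(if s = t \<and> k = m then \<zero> else v s k) \<in> carrier K" for k using V_memD(1)[OF vV s] by simp
        show "finite {k. (if s = t \<and> k = m then \<zero> else v s k) \<noteq> \<zero>}"
          by (rule finite_subset[OF _ V_memD(2)[OF vV s]]) auto
      qed
      have wat: "s < r \<Longrightarrow> w s k = (if s = t \<and> k = m then \<zero> else v s k)" for s k by (simp add: w_def)
      have "?Z w \<subset> ?Z v"
      proof (rule psubsetI)
        show "?Z w \<subseteq> ?Z v" by (auto simp: wat split: if_splits)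
        have "(t, m) \<in> ?Z v" "(t, m) \<notin> ?Z w" using tm by (simp_all add: wat)
        then show "?Z w \<noteq> ?Z v" by blast
      qed
      then have "card (?Z w) < card (?Z v)" by (rule psubset_card_mono[OF fin])
      moreover have "w \<in> supp_space P" using less(2) wV unfolding supp_space_def by (auto simp: wat)
      ultimately have wU: "w \<in> U" by (rule less(1))
      have c: "v t m \<in> carrier K" using V_memD(1)[OF vV tm(1)] .
      have "v = w \<oplus>\<^bsub>V\<^esub> scal (v t m) (unit_vec t m)"
      proof (rule V_eqI[OF vV])
        show "w \<oplus>\<^bsub>V\<^esub> scal (v t m) (unit_vec t m) \<in> carrier V"
          using V_add_closed wV scal_closed c unit_vec_closed by blast
        fix s k assume s: "s < r"
        show "v s k = (w \<oplus>\<^bsub>V\<^esub> scal (v t m) (unit_vec t m)) s k"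
          using c s V_memD(1)[OF vV s] by (auto simp: wat unit_vec_closed)
      qed
      moreover have "\<dots> \<in> U"
        using vs.subspaceD(4)[OF U wU vs.subspaceD(5)[OF U c u[OF tm(1) vP[OF tm]]]] .
      ultimately show ?thesis by simp
    qed
  qed
qed

lemma lsh_supp_space: "lsh a (supp_space P) = supp_space (\<lambda>t m. P t (m - a))"
proof (intro equalityI subsetI)
  fix v assume "v \<in> lsh a (supp_space P)"
  then show "v \<in> supp_space (\<lambda>t m. P t (m - a))" by (auto simp: supp_space_def vsh_closed)
next
  fix v assume "v \<in> supp_space (\<lambda>t m. P t (m - a))"
  then have v: "v \<in> carrier V" "\<And>t m. t < r \<Longrightarrow> \<not> P t (m - a) \<Longrightarrow> v t m = \<zero>" by (auto simp: supp_space_def)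
  have "vsh (- a) v t m = \<zero>" if "t < r" "\<not> P t m" for t m using v(2)[of t "m + a"] that by simp
  then have "vsh (- a) v \<in> supp_space P" using vsh_closed[OF v(1)] by (simp add: supp_space_def)
  moreover have "vsh a (vsh (- a) v) = v" using vsh_add[OF v(1)] vsh_0[OF v(1)] by simp
  ultimately show "v \<in> lsh a (supp_space P)" by (metis imageI)
qed

abbreviation box :: "int \<Rightarrow> (nat \<Rightarrow> int \<Rightarrow> 'a) set" where
  "box a \<equiv> supp_space (\<lambda>t m. a \<le> m)"

lemma box_mono: "a \<le> b \<Longrightarrow> box b \<subseteq> box a"
  by (auto simp: supp_space_def)

lemma lsh_box: "lsh a (box b) = box (a + b)"
  unfolding lsh_supp_space by (auto simp: supp_space_def algebra_simps)

lemma lsh_stable: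
  assumes U: "U \<in> SS" and s: "lsh 1 U \<subseteq> U" shows "u \<in> U \<Longrightarrow> vsh (int m) u \<in> U"
proof (induction m)
  case 0 then show ?case using vsh_0 SS_V[OF U] by simp
next
  case (Suc m)
  then have "vsh 1 (vsh (int m) u) \<in> U" using s by blast
  then show ?case using vsh_add[of u 1 "int m"] SS_V[OF U] Suc by simp
qed

text \<open>The conclusion has the shape of the right side of \<open>V_smult\<close>: a Laurent
  polynomial acts as a finite combination of shifts. Closure of a subspace under scalars thus
  reduces to closure under the shifts that occur.\<close>

lemma comb_in:
  assumes U: "U \<in> SS" and "finite I" "\<And>i. i \<in> I \<Longrightarrow> c i \<in> carrier K" "\<And>i. i \<in> I \<Longrightarrow> vsh i v \<in> U"
    and v: "v \<in> carrier V"
  shows "(\<lambda>t\<in>{..<r}. \<lambda>m. \<Oplus>i\<in>I. c i \<otimes> v t (m - i)) \<in> U"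
  using assms(2-4)
proof (induction I rule: finite_induct)
  case empty then show ?case using vs.subspaceD(3)[OF U] by (simp only: V_zero K.finsum_empty)
next
  case (insert i I)
  let ?s = "\<lambda>I. \<lambda>t\<in>{..<r}. \<lambda>m. \<Oplus>i\<in>I. c i \<otimes> v t (m - i)"
  have i: "c i \<in> carrier K" using insert.prems by simp
  have eq: "?s (insert i I) = scal (c i) (vsh i v) \<oplus>\<^bsub>V\<^esub> ?s I"
  proof (rule ext)
    fix t show "?s (insert i I) t = (scal (c i) (vsh i v) \<oplus>\<^bsub>V\<^esub> ?s I) t"
    proof (cases "t < r")
      case True
      have "(\<Oplus>i\<in>insert i I. c i \<otimes> v t (m - i)) = c i \<otimes> v t (m - i) \<oplus> (\<Oplus>i\<in>I. c i \<otimes> v t (m - i))" for m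
        by (rule K.finsum_insert) (use insert V_memD(1)[OF v True] in auto)
      then show ?thesis using True i v by (simp add: V_add fun_eq_iff vsh_closed)
    qed (simp add: V_add)
  qed
  have sI: "?s I \<in> U" by (rule insert.IH) (use insert.prems in blast)+
  have vi: "vsh i v \<in> U" using insert.prems by blast
  show ?case unfolding eq by (rule vs.subspaceD(4)[OF U vs.subspaceD(5)[OF U i vi] sI])
qed

lemma submoduleI':
  assumes U: "U \<in> SS" and "\<And>f u. f \<in> carrier R \<Longrightarrow> u \<in> U \<Longrightarrow> f \<odot>\<^bsub>V\<^esub> u \<in> U"
  shows "submodule U R V"
proof (intro submodule.intro subgroup.intro submodule_axioms.intro)
  show "U \<subseteq> carrier (add_monoid V)" using vs.subspaceD(1)[OF U] by simp
  show "x \<otimes>\<^bsub>add_monoid V\<^esub> y \<in> U" if "x \<in> U" "y \<in> U" for x y using vs.subspaceD(4)[OF U] that by simp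
  show "\<one>\<^bsub>add_monoid V\<^esub> \<in> U" using vs.subspaceD(3)[OF U] by simp
  show "inv\<^bsub>add_monoid V\<^esub> x \<in> U" if "x \<in> U" for x using vs.subspace_neg[OF U that] by (simp add: a_inv_def)
qed (use assms in blast)

lemma monom_in: "c \<in> carrier K \<Longrightarrow> laurent_monom K c d \<in> carrier (laurent K)"
  and monom_in_poly: "c \<in> carrier K \<Longrightarrow> 0 \<le> d \<Longrightarrow> laurent_monom K c d \<in> carrier (laurent_poly K)"
proof -
  have "finite {m. laurent_monom K c d m \<noteq> \<zero>}"
    by (rule finite_subset[of _ "{d}"]) (auto simp: laurent_monom_def)
  then show a: "c \<in> carrier K \<Longrightarrow> laurent_monom K c d \<in> carrier (laurent K)"
    by (simp add: laurent_def laurent_monom_def)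
  then show "c \<in> carrier K \<Longrightarrow> 0 \<le> d \<Longrightarrow> laurent_monom K c d \<in> carrier (laurent_poly K)"
    by (simp add: laurent_poly_def laurent_monom_def)
qed

lemma submodule_SS:
  assumes s: "submodule U R V" and R: "\<And>c. c \<in> carrier K \<Longrightarrow> laurent_monom K c 0 \<in> carrier R"
  shows "U \<in> SS"
proof -
  interpret submodule U R V by (rule s)
  show ?thesis unfolding vs.subspaces_def
    using subset one_closed m_closed smult_closed R by auto
qed

text \<open>Finitely many generators have exponents bounded below, which gives the outer box;
  generating the whole space over the Laurent polynomials puts a shift of each unit vector into
  \<open>L\<close>, which gives the inner one. Conversely, over a finite field only finitely many
  vectors have all their exponents in a given interval; those of \<open>L\<close> with exponents in
  \<open>b..<a\<close>, together with the unit vectors of exponent \<open>a\<close>, generate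
  \<open>L\<close>.\<close>

lemma lattice_iff:
  "lattice_in K r L \<longleftrightarrow> L \<in> SS \<and> lsh 1 L \<subseteq> L \<and> (\<exists>a b. box a \<subseteq> L \<and> L \<subseteq> box b)"
proof
  assume lat: "lattice_in K r L"
  then have sub: "submodule L (laurent_poly K) V" by (simp add: lattice_in_def)
  have LS: "L \<in> SS" by (rule submodule_SS[OF sub monom_in_poly]) simp_all
  have smul: "f \<odot>\<^bsub>V\<^esub> u \<in> L" if "f \<in> carrier (laurent_poly K)" "u \<in> L" for f u
    using submodule.smult_closed[OF sub] that by blast
  have st: "lsh 1 L \<subseteq> L"
  proof
    fix x assume "x \<in> lsh 1 L"
    then obtain u where u: "u \<in> L" "x = vsh 1 u" by blast
    then show "x \<in> L" using smul[OF monom_in_poly[OF K.one_closed, of 1] u(1)] vsh_eq[OF SS_V[OF LS u(1)]] by simp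
  qed
  obtain G where G: "finite G" "G \<subseteq> carrier V" "L = gen_submodule (laurent_poly K) V G"
    using lat unfolding lattice_in_def by blast
  have "\<exists>b. G \<subseteq> box b"
  proof -
    have fin: "finite (\<Union>v\<in>G. \<Union>t\<in>{..<r}. {m. v t m \<noteq> \<zero>})" using G(1,2) V_memD(2) by blast
    define b where "b = Min (insert 0 (\<Union>v\<in>G. \<Union>t\<in>{..<r}. {m. v t m \<noteq> \<zero>}))"
    have b: "b \<le> m" if "v \<in> G" "t < r" "v t m \<noteq> \<zero>" for v t m
      unfolding b_def by (rule Min_le) (use fin that in auto)
    have "G \<subseteq> box b" using b G(2) unfolding supp_space_def by blast
    then show ?thesis ..
  qed
  then obtain b where b: "G \<subseteq> box b" ..
  have "submodule (box b) (laurent_poly K) V"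
  proof (rule submoduleI'[OF supp_space_SS])
    fix f u assume f: "f \<in> carrier (laurent_poly K)" and u: "u \<in> box b"
    show "f \<odot>\<^bsub>V\<^esub> u \<in> box b" unfolding V_smult
    proof (rule comb_in[OF supp_space_SS])
      show "finite {i. f i \<noteq> \<zero>}" "\<And>i. f i \<in> carrier K" using f by (simp_all add: laurent_poly_def laurent_def)
      show "u \<in> carrier V" using u by (simp add: supp_space_def)
      fix i assume "i \<in> {i. f i \<noteq> \<zero>}"
      then have "0 \<le> i" using f by (auto simp: laurent_poly_def not_le[symmetric])
      have "vsh i u \<in> box (i + b)" using u lsh_box by blast
      then show "vsh i u \<in> box b" using box_mono[of b "i + b"] \<open>0 \<le> i\<close> by auto
    qed
  qed
  then have Lb: "L \<subseteq> box b" unfolding G(3) gen_submodule_def using b by blast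
  \<comment> \<open>The vectors that enter \<open>L\<close> after multiplication by a high power of
    the indeterminate form a submodule over the Laurent polynomials that contains \<open>L\<close>,
    hence are all vectors.\<close>
  define H where "H = {v \<in> carrier V. \<exists>N::nat. vsh (int N) v \<in> L}"
  have up: "vsh (int N') v \<in> L" if "vsh (int N) v \<in> L" "N \<le> N'" "v \<in> carrier V" for N N' v
    using lsh_stable[OF LS st that(1), of "N' - N"] vsh_add[OF that(3)] that(2) by simp
  have HS: "H \<in> SS" unfolding vs.subspaces_def
  proof (intro CollectI conjI ballI)
    show "H \<subseteq> carrier V" unfolding H_def by blast
    show "\<zero>\<^bsub>V\<^esub> \<in> H" using vsh_0[OF V_zero_closed] vs.subspaceD(3)[OF LS] V_zero_closed
      unfolding H_def by (intro CollectI conjI exI[of _ 0]) simp_all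
    fix x assume "x \<in> H"
    then obtain N where x: "x \<in> carrier V" "vsh (int N) x \<in> L" unfolding H_def by blast
    { fix y assume "y \<in> H"
      then obtain N' where y: "y \<in> carrier V" "vsh (int N') y \<in> L" unfolding H_def by blast
      have "vsh (int (max N N')) (x \<oplus>\<^bsub>V\<^esub> y) = vsh (int (max N N')) x \<oplus>\<^bsub>V\<^esub> vsh (int (max N N')) y"
        by (rule V_eqI) (simp_all add: vsh_closed V_add_closed x y)
      moreover have "\<dots> \<in> L" using vs.subspaceD(4)[OF LS] up[OF x(2) _ x(1)] up[OF y(2) _ y(1)] by simp
      ultimately have "vsh (int (max N N')) (x \<oplus>\<^bsub>V\<^esub> y) \<in> L" by (simp only:)
      then show "x \<oplus>\<^bsub>V\<^esub> y \<in> H" unfolding H_def using V_add_closed[OF x(1) y(1)] by blast }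
    fix k assume k: "k \<in> carrier K"
    have "vsh (int N) (scal k x) = scal k (vsh (int N) x)"
      by (rule V_eqI) (simp_all add: vsh_closed scal_closed x k)
    then have "vsh (int N) (scal k x) \<in> L" using vs.subspaceD(5)[OF LS k x(2)] by (simp only:)
    then show "scal k x \<in> H" unfolding H_def using scal_closed[OF k x(1)] by blast
  qed
  have "submodule H (laurent K) V"
  proof (rule submoduleI'[OF HS])
    fix f u assume f: "f \<in> carrier (laurent K)" and u: "u \<in> H"
    then obtain N where N: "u \<in> carrier V" "vsh (int N) u \<in> L" unfolding H_def by blast
    show "f \<odot>\<^bsub>V\<^esub> u \<in> H" unfolding V_smult
    proof (rule comb_in[OF HS])
      show "finite {i. f i \<noteq> \<zero>}" "\<And>i. f i \<in> carrier K" using f by (simp_all add: laurent_def)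
      show "u \<in> carrier V" by (rule N)
      fix i :: int
      have "0 \<le> \<bar>i\<bar> + i" by linarith
      then have "vsh (int (nat \<bar>i\<bar>)) (vsh i u) = vsh (int (nat (\<bar>i\<bar> + i))) u" using vsh_add[OF N(1)] by simp
      then have "vsh (int N) (vsh (int (nat \<bar>i\<bar>)) (vsh i u)) = vsh (int (nat (\<bar>i\<bar> + i))) (vsh (int N) u)"
        using vsh_add[OF N(1)] by (simp add: add.commute)
      also have "\<dots> \<in> L" by (rule lsh_stable[OF LS st N(2)])
      finally have "vsh (int (N + nat \<bar>i\<bar>)) (vsh i u) \<in> L" using vsh_add[OF vsh_closed[OF N(1)]] by simp
      then show "vsh i u \<in> H" unfolding H_def using vsh_closed[OF N(1)] by blast
    qed
  qed
  moreover have "L \<subseteq> H"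
    unfolding H_def using SS_V[OF LS] vsh_0 by (auto intro!: exI[of _ "0 :: nat"])
  ultimately have "gen_submodule (laurent K) V L \<subseteq> H" unfolding gen_submodule_def by blast
  then have VH: "carrier V \<subseteq> H" using lat unfolding lattice_in_def by simp
  have "\<forall>t. \<exists>N::nat. unit_vec t (int N) \<in> L"
  proof
    fix t
    have "unit_vec t 0 \<in> H" using VH unit_vec_closed by blast
    then show "\<exists>N::nat. unit_vec t (int N) \<in> L" unfolding H_def by (auto simp: vsh_unit_vec)
  qed
  then obtain N :: "nat \<Rightarrow> nat" where N: "\<And>t. unit_vec t (int (N t)) \<in> L" by metis
  define a where "a = Max (N ` {..<r})"
  have Na: "N t \<le> a" if "t < r" for t unfolding a_def using that by (intro Max_ge) auto
  have "box (int a) \<subseteq> L"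
  proof (rule supp_space_span[OF LS])
    fix t m assume t: "t < r" "int a \<le> m"
    have "vsh (int (nat (m - int (N t)))) (unit_vec t (int (N t))) \<in> L" by (rule lsh_stable[OF LS st N])
    then show "unit_vec t m \<in> L" using Na[OF t(1)] t(2) by (simp add: vsh_unit_vec)
  qed
  then show "L \<in> SS \<and> lsh 1 L \<subseteq> L \<and> (\<exists>a b. box a \<subseteq> L \<and> L \<subseteq> box b)" using LS st Lb by blast
next
  assume "L \<in> SS \<and> lsh 1 L \<subseteq> L \<and> (\<exists>a b. box a \<subseteq> L \<and> L \<subseteq> box b)"
  then obtain a b where LS: "L \<in> SS" and st: "lsh 1 L \<subseteq> L" and a: "box a \<subseteq> L" and b: "L \<subseteq> box b" by blast
  have sub: "submodule L (laurent_poly K) V"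
  proof (rule submoduleI'[OF LS])
    fix f u assume f: "f \<in> carrier (laurent_poly K)" and u: "u \<in> L"
    show "f \<odot>\<^bsub>V\<^esub> u \<in> L" unfolding V_smult
    proof (rule comb_in[OF LS])
      show "finite {i. f i \<noteq> \<zero>}" "\<And>i. f i \<in> carrier K" using f by (simp_all add: laurent_poly_def laurent_def)
      show "u \<in> carrier V" by (rule SS_V[OF LS u])
      fix i assume "i \<in> {i. f i \<noteq> \<zero>}"
      then have "0 \<le> i" using f by (auto simp: laurent_poly_def not_le[symmetric])
      then show "vsh i u \<in> L" using lsh_stable[OF LS st u, of "nat i"] by simp
    qed
  qed
  \<comment> \<open>The outer box bounds the exponents in \<open>L\<close> below by
    \<open>b\<close>, so those in \<open>S1\<close> lie in \<open>b..<a\<close> and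
    \<open>S1\<close> is finite.\<close>
  define S1 where "S1 = {v \<in> L. \<forall>t<r. \<forall>m\<ge>a. v t m = \<zero>}"
  define G where "G = S1 \<union> (\<lambda>t. unit_vec t a) ` {..<r}"
  have "S1 \<subseteq> {..<r} \<rightarrow>\<^sub>E {f. \<forall>m. (m \<in> {b..<a} \<longrightarrow> f m \<in> carrier K) \<and> (m \<notin> {b..<a} \<longrightarrow> f m = \<zero>)}"
  proof
    fix v assume v: "v \<in> S1"
    then have vV: "v \<in> carrier V" and vb: "v \<in> box b" using SS_V[OF LS] b unfolding S1_def by blast+
    have "v t m = \<zero>" if "t < r" "m \<notin> {b..<a}" for t m
      using v vb that unfolding S1_def supp_space_def by (cases "b \<le> m") auto
    then show "v \<in> {..<r} \<rightarrow>\<^sub>E {f. \<forall>m. (m \<in> {b..<a} \<longrightarrow> f m \<in> carrier K) \<and> (m \<notin> {b..<a} \<longrightarrow> f m = \<zero>)}"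
      using vV by (auto simp: V_mem PiE_iff)
  qed
  moreover have "finite ({..<r} \<rightarrow>\<^sub>E {f. \<forall>m. (m \<in> {b..<a} \<longrightarrow> f m \<in> carrier K) \<and> (m \<notin> {b..<a} \<longrightarrow> f m = \<zero>)})"
    by (intro finite_PiE finite_set_of_finite_funs) (simp_all add: finK)
  ultimately have finG: "finite G" unfolding G_def using finite_subset by blast
  have ua: "unit_vec t a \<in> L" if "t < r" for t
  proof -
    have "unit_vec t a \<in> box a" unfolding supp_space_def by (auto simp: unit_vec_closed)
    then show ?thesis using a by blast
  qed
  have GL: "G \<subseteq> L" unfolding G_def S1_def using ua by auto
  have GV: "G \<subseteq> carrier V" using GL vs.subspaceD(1)[OF LS] by blast
  have "L = gen_submodule (laurent_poly K) V G"
  proof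
    show "gen_submodule (laurent_poly K) V G \<subseteq> L" unfolding gen_submodule_def using sub GL by blast
    show "L \<subseteq> gen_submodule (laurent_poly K) V G"
      unfolding gen_submodule_def
    proof (rule Inter_greatest, clarify)
      fix H u assume H: "submodule H (laurent_poly K) V" "G \<subseteq> H" and u: "u \<in> L"
      have HS: "H \<in> SS" by (rule submodule_SS[OF H(1) monom_in_poly]) simp_all
      have bH: "box a \<subseteq> H"
      proof (rule supp_space_span[OF HS])
        fix t m assume t: "t < r" "a \<le> m"
        have "unit_vec t a \<in> H" using H(2) t(1) unfolding G_def by blast
        then have "laurent_monom K \<one> (m - a) \<odot>\<^bsub>V\<^esub> unit_vec t a \<in> H"
          using submodule.smult_closed[OF H(1)] monom_in_poly[OF K.one_closed, of "m - a"] t(2) by simp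
        then show "unit_vec t m \<in> H" using vsh_eq[OF unit_vec_closed] by (simp add: vsh_unit_vec)
      qed
      have uV: "u \<in> carrier V" by (rule SS_V[OF LS u])
      \<comment> \<open>\<open>u\<close> is split at exponent \<open>a\<close>. The upper part
        \<open>w\<close> is in the inner box, so the lower part \<open>z\<close> is again in
        \<open>L\<close> and is one of the generators.\<close>
      define w where "w = (\<lambda>t\<in>{..<r}. \<lambda>m. if a \<le> m then u t m else \<zero>)"
      define z where "z = (\<lambda>t\<in>{..<r}. \<lambda>m. if a \<le> m then \<zero> else u t m)"
      have wV: "w \<in> carrier V" and zV: "z \<in> carrier V"
        unfolding w_def z_def
        by (auto intro!: V_I simp: V_memD(1)[OF uV] intro: finite_subset[OF _ V_memD(2)[OF uV]])
      have uwz: "u = w \<oplus>\<^bsub>V\<^esub> z"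
        by (rule V_eqI[OF uV V_add_closed[OF wV zV]]) (use V_memD[OF uV] in \<open>simp add: w_def z_def\<close>)
      have wb: "w \<in> box a" using wV unfolding supp_space_def by (simp add: w_def)
      then have "z \<in> L" using vs.subspace_cancel[OF LS _ zV] a u uwz by blast
      then have "z \<in> S1" unfolding S1_def by (simp add: z_def)
      then have "z \<in> H" using H(2) unfolding G_def by blast
      then show "u \<in> H" unfolding uwz using vs.subspaceD(4)[OF HS] bH wb by blast
    qed
  qed
  moreover have "gen_submodule (laurent K) V L = carrier V"
  proof
    have "submodule (carrier V) (laurent K) V"
    proof (rule submoduleI')
      show c: "carrier V \<in> SS" using supp_space_SS[of "\<lambda>t m. True"] by (simp add: supp_space_def)
      fix f u assume f: "f \<in> carrier (laurent K)" and u: "u \<in> carrier V"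
      show "f \<odot>\<^bsub>V\<^esub> u \<in> carrier V" unfolding V_smult
        by (rule comb_in[OF c]) (use f u vsh_closed in \<open>auto simp: laurent_def\<close>)
    qed
    then show "gen_submodule (laurent K) V L \<subseteq> carrier V"
      unfolding gen_submodule_def using vs.subspaceD(1)[OF LS] by blast
    show "carrier V \<subseteq> gen_submodule (laurent K) V L"
      unfolding gen_submodule_def
    proof (rule Inter_greatest, clarify)
      fix H v assume H: "submodule H (laurent K) V" "L \<subseteq> H" and v: "v \<in> carrier V"
      have HS: "H \<in> SS" by (rule submodule_SS[OF H(1) monom_in])
      have "supp_space (\<lambda>t m. True) \<subseteq> H"
      proof (rule supp_space_span[OF HS])
        fix t and m :: int assume t: "t < r"
        have "laurent_monom K \<one> (m - a) \<odot>\<^bsub>V\<^esub> unit_vec t a \<in> H"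
          using submodule.smult_closed[OF H(1) monom_in[OF K.one_closed]] ua[OF t] H(2) by blast
        then show "unit_vec t m \<in> H" using vsh_eq[OF unit_vec_closed] by (simp add: vsh_unit_vec)
      qed
      then show "v \<in> H" using v by (auto simp: supp_space_def)
    qed
  qed
  ultimately show "lattice_in K r L" unfolding lattice_in_def using sub finG GV by blast
qed

abbreviation Lats where "Lats \<equiv> {L. lattice_in K r L}"

lemma flags_iff: "L \<in> flags n K r \<longleftrightarrow> periodic_flag Lats lsh n L"
proof -
  have "(\<lambda>v. laurent_eps K \<odot>\<^bsub>V\<^esub> v) ` L i = lsh 1 (L i)" if "lattice_in K r (L i)" for i
    using that SS_V by (intro image_cong) (auto simp: lattice_iff vsh_eq)
  then show ?thesis unfolding flags_def periodic_flag_def mem_Collect_eq by metis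
qed

end

section \<open>The standard complete flag and the instance of the abstract geometry\<close>

locale laurent_lattices_pos = laurent_lattices +
  assumes r_pos: "r > 0"
begin

text \<open>The vector \<open>unit_vec t m\<close> occupies place \<open>t - r m\<close> of the flag.\<close>
definition std_flag :: "int \<Rightarrow> (nat \<Rightarrow> int \<Rightarrow> 'a) set" where
  "std_flag k = supp_space (\<lambda>t m. int t - int r * m \<le> k)"

lemma box_std_flag: "box (\<bar>k\<bar> + 1) \<subseteq> std_flag k" "std_flag k \<subseteq> box (- \<bar>k\<bar>)"
proof -
  have "int t - int r * m \<le> k" if "t < r" "\<bar>k\<bar> + 1 \<le> m" for t m
  proof -
    have "int r * 1 \<le> int r * (m - \<bar>k\<bar>)" by (rule mult_left_mono) (use that in auto)
    moreover have "1 * \<bar>k\<bar> \<le> int r * \<bar>k\<bar>" by (rule mult_right_mono) (use r_pos in auto)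
    ultimately have "int r + \<bar>k\<bar> \<le> int r * m" by (simp add: algebra_simps)
    then show ?thesis using that(1) by linarith
  qed
  then show "box (\<bar>k\<bar> + 1) \<subseteq> std_flag k" unfolding std_flag_def supp_space_def by blast
  have "- \<bar>k\<bar> \<le> m" if "t < r" "int t - int r * m \<le> k" for t m
  proof (rule ccontr)
    assume "\<not> - \<bar>k\<bar> \<le> m"
    then have "int r * m \<le> int r * (- \<bar>k\<bar> - 1)" by (intro mult_left_mono) auto
    moreover have "1 * (\<bar>k\<bar> + 1) \<le> int r * (\<bar>k\<bar> + 1)" by (rule mult_right_mono) (use r_pos in auto)
    ultimately have "int r * m \<le> - \<bar>k\<bar> - 1" by (simp add: algebra_simps)
    then show False using that(2) by linarith
  qed
  then show "std_flag k \<subseteq> box (- \<bar>k\<bar>)" unfolding std_flag_def supp_space_def by blast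
qed

lemma std_flag_shift: "std_flag (k - int r) = lsh 1 (std_flag k)"
  unfolding std_flag_def lsh_supp_space by (simp add: algebra_simps)

lemma std_flag_mono: "k \<le> k' \<Longrightarrow> std_flag k \<subseteq> std_flag k'"
  unfolding std_flag_def supp_space_def by auto

text \<open>Place \<open>k\<close> is taken by exactly one vector \<open>unit_vec t m\<close>, with
  \<open>t\<close> the remainder of \<open>k\<close> modulo \<open>r\<close> and \<open>- m\<close>
  the quotient, so consecutive members differ by one basis vector.\<close>

lemma std_flag_covers: "covers SS (std_flag (k - 1)) (std_flag k)"
proof -
  define t where "t = nat (k mod int r)"
  define m where "m = - (k div int r)"
  have k0: "0 \<le> k mod int r" "k mod int r < int r" using r_pos by simp_all
  have t: "t < r" "int t - int r * m = k" unfolding t_def m_def using k0 by (simp_all add: nat_less_iff)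
  have r0: "int r \<noteq> 0" using r_pos by simp
  have uniq: "s = t \<and> j = m" if "s < r" "int s - int r * j = k" for s j
  proof -
    have k: "k = int s + (- j) * int r" using that(2) by (simp add: mult.commute)
    have "k div int r = - j" "k mod int r = int s"
      unfolding k div_mult_self1[OF r0] mod_mult_self1 using that(1) by simp_all
    then show ?thesis unfolding t_def m_def by simp
  qed
  let ?u = "unit_vec t m" and ?W = "std_flag (k - 1)"
  have W: "?W \<in> SS" and U: "std_flag k \<in> SS" unfolding std_flag_def by (rule supp_space_SS)+
  have uU: "?u \<in> std_flag k" unfolding std_flag_def supp_space_def using t by (auto simp: unit_vec_closed)
  have uW: "?u \<notin> ?W"
  proof
    assume "?u \<in> ?W"
    then have "\<And>s j. s < r \<Longrightarrow> \<not> int s - int r * j \<le> k - 1 \<Longrightarrow> ?u s j = \<zero>"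
      unfolding std_flag_def supp_space_def by blast
    from this[of t m] show False using t by simp
  qed
  have "std_flag k = vs.span1 ?W ?u"
  proof
    show "vs.span1 ?W ?u \<subseteq> std_flag k"
      by (rule vs.span1_least[OF U std_flag_mono uU]) simp
    note s = vs.span1_ub[OF W unit_vec_closed[of t m]]
    show "std_flag k \<subseteq> vs.span1 ?W ?u" unfolding std_flag_def[of k]
    proof (rule supp_space_span[OF vs.span1_subspace[OF W unit_vec_closed]])
      fix s' j assume j: "s' < r" "int s' - int r * j \<le> k"
      show "unit_vec s' j \<in> vs.span1 ?W ?u"
      proof (cases "int s' - int r * j = k")
        case True then show ?thesis using uniq[OF j(1) True] s(2) by simp
      next
        case False
        then have "unit_vec s' j \<in> ?W" unfolding std_flag_def supp_space_def using j by (auto simp: unit_vec_closed)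
        then show ?thesis using s(1) by blast
      qed
    qed
  qed
  then show ?thesis using vs.covers_span1[OF W unit_vec_closed uW] by simp
qed

lemma std_flag_complete: "complete_flag SS Lats lsh r std_flag"
  unfolding complete_flag_def periodic_flag_def
proof (intro conjI allI)
  fix i
  show "std_flag i \<in> Lats"
  proof (intro CollectI lattice_iff[THEN iffD2] conjI)
    show "std_flag i \<in> SS" unfolding std_flag_def by (rule supp_space_SS)
    show "lsh 1 (std_flag i) \<subseteq> std_flag i"
      unfolding std_flag_shift[symmetric] by (rule std_flag_mono) simp
    show "\<exists>a b. box a \<subseteq> std_flag i \<and> std_flag i \<subseteq> box b" using box_std_flag by blast
  qed
qed (simp_all add: std_flag_covers std_flag_shift std_flag_mono)

lemma flag_geometry:
  assumes n: "n > 0"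
  shows "flag_geometry SS Lats (set_add V) vs.qdim lsh n r (card (carrier K))"
proof
  show "0 < n" "0 < r" by (fact n r_pos)+
  show "0 < card (carrier K)" using finK K.zero_closed by (auto simp: card_gt_0_iff)
  fix U W assume U: "U \<in> SS"
  show "lsh 0 U = U" by (rule lsh_0[OF U])
  show "lsh a (lsh b U) = lsh (a + b) U" for a b by (rule lsh_add[OF U])
  show "lsh a U \<in> SS" for a by (rule lsh_SS[OF U])
  show "vs.qdim U U 0" by (rule vs.qdim_refl[OF U])
  assume W: "W \<in> SS"
  show "U \<inter> W \<in> SS" by (rule vs.subspace_Int[OF U W])
  show "U <+>\<^bsub>V\<^esub> W \<in> SS" by (rule vs.subspace_set_add[OF U W])
  show "U \<subseteq> U <+>\<^bsub>V\<^esub> W" "W \<subseteq> U <+>\<^bsub>V\<^esub> W" by (rule vs.set_add_ub[OF U W])+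
  fix X assume X: "X \<in> SS"
  show "U <+>\<^bsub>V\<^esub> W \<subseteq> X" if "U \<subseteq> X" "W \<subseteq> X" by (rule vs.set_add_least[OF X that])
  show "X \<inter> (U <+>\<^bsub>V\<^esub> W) \<subseteq> U <+>\<^bsub>V\<^esub> (X \<inter> W)" if "U \<subseteq> X" by (rule vs.set_add_modular[OF X U that W])
next
  fix U W :: "(nat \<Rightarrow> int \<Rightarrow> 'a) set" and a assume "U \<subseteq> W"
  then show "lsh a U \<subseteq> lsh a W" by (rule image_mono)
next
  fix U assume U: "U \<in> Lats"
  then show "U \<in> SS" by (simp add: lattice_iff)
next
  fix U a assume U: "U \<in> Lats"
  then obtain c d where l: "U \<in> SS" "lsh 1 U \<subseteq> U" "box c \<subseteq> U" "U \<subseteq> box d" by (auto simp: lattice_iff)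
  have "lsh 1 (lsh a U) = lsh a (lsh 1 U)" using lsh_add[OF l(1)] by (simp add: add.commute)
  then have "lsh 1 (lsh a U) \<subseteq> lsh a U" using image_mono[OF l(2)] by simp
  moreover have "box (a + c) \<subseteq> lsh a U" "lsh a U \<subseteq> box (a + d)"
    using image_mono[OF l(3), of "vsh a"] image_mono[OF l(4), of "vsh a"] by (simp_all add: lsh_box)
  ultimately show "lsh a U \<in> Lats" using lsh_SS[OF l(1)] by (auto simp: lattice_iff)
next
  fix U W assume "U \<in> Lats" "W \<in> Lats"
  then obtain a b where l: "U \<subseteq> box a" "box b \<subseteq> W" by (auto simp: lattice_iff)
  have "lsh (int (nat (b - a))) U \<subseteq> lsh (int (nat (b - a))) (box a)" by (rule image_mono[OF l(1)])
  also have "\<dots> = box (int (nat (b - a)) + a)" by (rule lsh_box)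
  also have "\<dots> \<subseteq> box b" by (rule box_mono) simp
  finally show "\<exists>m::nat. lsh (int m) U \<subseteq> W" using l(2) by blast
next
  fix U X Y assume a: "U \<in> Lats" "X \<in> Lats" "Y \<in> SS" "U \<subseteq> Y" "Y \<subseteq> X" "lsh 1 X \<subseteq> U"
  obtain c where c: "box c \<subseteq> U" using a(1) unfolding mem_Collect_eq lattice_iff by blast
  obtain d where d: "X \<subseteq> box d" using a(2) unfolding mem_Collect_eq lattice_iff by blast
  have "lsh 1 Y \<subseteq> lsh 1 X" by (rule image_mono[OF a(5)])
  then have "lsh 1 Y \<subseteq> Y" using a(4,6) by (meson order_trans)
  moreover have "box c \<subseteq> Y" "Y \<subseteq> box d" using c d a(4,5) by (meson order_trans)+
  ultimately show "Y \<in> Lats" using a(3) unfolding mem_Collect_eq lattice_iff by blast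
next
  fix U X W assume "covers SS W U" "covers SS U X"
  then show "finite {Y \<in> SS. W \<subset> Y \<and> Y \<subset> X} \<and> card {Y \<in> SS. W \<subset> Y \<and> Y \<subset> X} = Suc (card (carrier K))"
    by (rule vs.card_between)
next
  fix U X W d assume "W \<in> SS" "W \<subseteq> U" "vs.qdim U W d" "covers SS U X"
  then show "vs.qdim X W (Suc d)" by (rule vs.qdim_step)
next
  fix U W d d' assume "W \<in> SS" "U \<in> SS" "W \<subseteq> U" "vs.qdim U W d" "vs.qdim U W d'"
  then show "d = d'" by (rule vs.qdim_unique)
next
  show "\<exists>L. complete_flag SS Lats lsh r L" using std_flag_complete by blast
qed

lemma flag_orbit_iff:
  assumes n: "n > 0"
  shows "(L, L') \<in> flag_orbit n K r A \<longleftrightarrow> flag_geometry.orb Lats (set_add V) vs.qdim lsh n L L' A"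
  unfolding flag_orbit_def flag_geometry.orb_def[OF flag_geometry[OF n]] flags_iff quot_dim_eq by simp

end

section \<open>Prime fields and the structure polynomials\<close>

lemma ex_prime_field:
  assumes p: "prime (p :: nat)"
  shows "\<exists>K :: nat ring. field K \<and> finite (carrier K) \<and> card (carrier K) = p"
proof -
  define K :: "nat ring" where
    "K = \<lparr>carrier = {..<p}, monoid.mult = (\<lambda>a b. a * b mod p), one = 1, zero = 0, add = (\<lambda>a b. (a + b) mod p)\<rparr>"
  have p1: "1 < p" using p by (rule prime_gt_1_nat)
  have "cring K"
  proof (rule cringI)
    show "abelian_group K"
    proof (rule abelian_groupI)
      fix x assume x: "x \<in> carrier K"
      have "(p - x) mod p \<in> carrier K" "((p - x) mod p + x) mod p = 0" using x p1 by (simp_all add: K_def mod_simps)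
      then show "\<exists>y\<in>carrier K. y \<oplus>\<^bsub>K\<^esub> x = \<zero>\<^bsub>K\<^esub>"
        by (intro bexI[of _ "(p - x) mod p"]) (simp_all add: K_def)
    qed (use p1 in \<open>auto simp: K_def mod_simps algebra_simps\<close>)
    show "comm_monoid K"
      by (rule comm_monoidI) (use p1 in \<open>auto simp: K_def mod_simps algebra_simps\<close>)
  qed (use p1 in \<open>auto simp: K_def mod_simps algebra_simps\<close>)
  moreover have "\<exists>b\<in>carrier K. a \<otimes>\<^bsub>K\<^esub> b = \<one>\<^bsub>K\<^esub>" if a: "a \<in> carrier K" "a \<noteq> \<zero>\<^bsub>K\<^esub>" for a
  proof -
    have ndvd: "\<not> p dvd a" using a unfolding K_def by (auto dest: dvd_imp_le)
    have "inj_on (\<lambda>b. a * b mod p) {..<p}"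
    proof (rule linorder_inj_onI')
      fix x y :: nat assume xy: "x \<in> {..<p}" "y \<in> {..<p}" "x < y"
      show "a * x mod p \<noteq> a * y mod p"
      proof
        assume "a * x mod p = a * y mod p"
        then have "p dvd a * y - a * x" using xy(3) by (intro mod_eq_dvd_iff_nat[THEN iffD1]) (auto intro: mult_left_mono)
        then have "p dvd a * (y - x)" by (simp add: diff_mult_distrib2)
        then have "p dvd y - x" using p ndvd by (simp add: prime_dvd_mult_iff)
        then show False using xy by (auto dest: dvd_imp_le)
      qed
    qed
    moreover have "(\<lambda>b. a * b mod p) ` {..<p} \<subseteq> {..<p}" using p1 by auto
    ultimately have "(\<lambda>b. a * b mod p) ` {..<p} = {..<p}" by (intro endo_inj_surj) simp_all
    then have "1 \<in> (\<lambda>b. a * b mod p) ` {..<p}" using p1 by simp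
    then show ?thesis unfolding K_def by auto
  qed
  ultimately have "field K" by (intro cring.cring_fieldI2) (auto simp: K_def)
  moreover have "finite (carrier K)" "card (carrier K) = p" by (simp_all add: K_def)
  ultimately show ?thesis by blast
qed

text \<open>Two candidates agree at all primes, because over each prime field the orbit of
  \<open>C\<close> is nonempty and the count fixes the value. A nonzero difference would have only
  finitely many roots.\<close>

lemma struct_poly_eqI:
  assumes Q: "\<And>(K :: nat ring) L L''. field K \<Longrightarrow> finite (carrier K) \<Longrightarrow> (L, L'') \<in> flag_orbit n K r C \<Longrightarrow>
      poly Q (int (card (carrier K))) =
      int (card {L' \<in> flags n K r. (L, L') \<in> flag_orbit n K r A \<and> (L', L'') \<in> flag_orbit n K r B})"
    and ne: "\<And>K :: nat ring. field K \<Longrightarrow> finite (carrier K) \<Longrightarrow> \<exists>L L''. (L, L'') \<in> flag_orbit n K r C"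
  shows "struct_poly n r A B C = Q"
  unfolding struct_poly_def
proof (rule the_equality)
  show "\<forall>K :: nat ring. field K \<and> finite (carrier K) \<longrightarrow>
     (\<forall>L L''. (L, L'') \<in> flag_orbit n K r C \<longrightarrow>
        poly Q (int (card (carrier K))) =
        int (card {L' \<in> flags n K r. (L, L') \<in> flag_orbit n K r A \<and> (L', L'') \<in> flag_orbit n K r B}))"
    using Q by blast
  fix R assume R: "\<forall>K :: nat ring. field K \<and> finite (carrier K) \<longrightarrow>
     (\<forall>L L''. (L, L'') \<in> flag_orbit n K r C \<longrightarrow>
        poly R (int (card (carrier K))) =
        int (card {L' \<in> flags n K r. (L, L') \<in> flag_orbit n K r A \<and> (L', L'') \<in> flag_orbit n K r B}))"
  show "R = Q"
  proof (rule ccontr)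
    assume "R \<noteq> Q"
    then have fin: "finite {x. poly (R - Q) x = 0}" by (intro poly_roots_finite) simp
    have "poly (R - Q) (int x) = 0" if x: "prime x" for x
    proof -
      obtain K :: "nat ring" where K: "field K" "finite (carrier K)" "card (carrier K) = x"
        using ex_prime_field[OF x] by blast
      obtain L L'' where o: "(L, L'') \<in> flag_orbit n K r C" using ne[OF K(1,2)] by blast
      then show ?thesis using R[rule_format, of K L L''] Q[OF K(1,2) o] K by simp
    qed
    then have "int ` {x. prime x} \<subseteq> {x. poly (R - Q) x = 0}" by blast
    then have "finite (int ` {x :: nat. prime x})" using fin finite_subset by blast
    then have "finite {x :: nat. prime x}" by (rule finite_imageD) simp
    then show False using primes_infinite by simp
  qed
qed

text \<open>The polynomials \<open>p g\<close> are chosen before any field is fixed, so that their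
  sum satisfies the defining condition for all fields at once. At 1 each of them contributes 1 or
  0.\<close>

theorem struct_poly_at_1:
  assumes n: "n > 0" and r: "r > 0" and P: "f \<in> pmaps n r" "h \<in> pmaps n r"
    and lm: "lexmono f h" and A: "A \<in> Theta_r n r"
  shows "poly (struct_poly n r A B (rmat f h)) 1 =
    int (card {g \<in> pmaps n r. rmat f g = A \<and> rmat g h = B})"
proof -
  let ?C = "rmat f h"
  have AT: "A \<in> Theta n" using A by (simp add: Theta_r_def)
  define p where "p g = (SOME p. count_poly r B g h p)" for g
  have p: "count_poly r B g h (p g)" if "g \<in> pmaps n r" for g
    unfolding p_def using someI_ex[OF count_poly_ex[OF n r that, rule_format]] .
  let ?G = "{g. g \<in> pmaps n r \<and> rmat f g = A}"
  have "struct_poly n r A B ?C = (\<Sum>g\<in>?G. p g)"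
  proof (rule struct_poly_eqI)
    fix K :: "nat ring" assume K: "field K" "finite (carrier K)"
    interpret laurent_lattices_pos K r
      using K r by (simp add: laurent_lattices_pos_def laurent_lattices_pos_axioms_def
          laurent_lattices_def laurent_lattices_axioms_def)
    interpret G: flag_geometry SS Lats "set_add V" vs.qdim lsh n r "card (carrier K)" by (rule flag_geometry[OF n])
    { fix L L'' assume o: "(L, L'') \<in> flag_orbit n K r ?C"
      have e: "{L' \<in> flags n K r. (L, L') \<in> flag_orbit n K r A \<and> (L', L'') \<in> flag_orbit n K r B} =
          {L'. G.orb L L' A \<and> G.orb L' L'' B}"
        by (auto simp: flag_orbit_iff[OF n] flags_iff G.orb_def)
      show "poly (\<Sum>g\<in>?G. p g) (int (card (carrier K))) =
          int (card {L' \<in> flags n K r. (L, L') \<in> flag_orbit n K r A \<and> (L', L'') \<in> flag_orbit n K r B})"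
        unfolding e poly_sum
        by (rule G.orbit_count[OF _ P lm refl AT p, symmetric]) (use o in \<open>simp add: flag_orbit_iff[OF n]\<close>) }
    obtain L L'' where "G.orb L L'' ?C" using G.ex_orb[OF P lexmono_fst[OF lm]] by auto
    then show "\<exists>L L''. (L, L'') \<in> flag_orbit n K r ?C" using flag_orbit_iff[OF n] by blast
  qed
  then have "poly (struct_poly n r A B ?C) 1 = (\<Sum>g\<in>?G. poly (p g) 1)" by (simp add: poly_sum)
  also have "\<dots> = (\<Sum>g\<in>?G. if rmat g h = B then 1 else 0)"
    by (rule sum.cong[OF refl]) (use count_poly_at_1[OF p] in simp)
  also have "\<dots> = int (card {g \<in> pmaps n r. rmat f g = A \<and> rmat g h = B})"
    using finite_pmaps_rmat[OF n r AT P(1)]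
    by (simp add: sum.If_cases Int_def conj_ac)
  finally show ?thesis .
qed

section \<open>Leading terms in the affine Schur algebra\<close>

definition offd :: "zmat \<Rightarrow> zmat" where
  "offd C = (\<lambda>i j. if i = j then 0 else C i j)"

lemma rmat_zperiodic: "f \<in> pmaps n r \<Longrightarrow> g \<in> pmaps n r \<Longrightarrow> zperiodic n (rmat f g)"
  unfolding zperiodic_def using rmat_periodic by blast

lemma offd_zperiodic: "zperiodic n A \<Longrightarrow> zperiodic n (offd A)"
  by (simp add: zperiodic_def offd_def)

definition zdeg :: "nat \<Rightarrow> zmat \<Rightarrow> nat" where
  "zdeg n C = mat_sigma n (offd C)"

text \<open>A unit of an off-diagonal entry is a point on which \<open>f\<close> and
  \<open>h\<close> differ, taken once per period.\<close>

lemma zdeg_rmat: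
  assumes f: "f \<in> pmaps n r" and h: "h \<in> pmaps n r" and n: "n > 0" and r: "r > 0"
  shows "zdeg n (rmat f h) = card {k \<in> {0..<int r}. f k \<noteq> h k}"
proof -
  have row: "(\<Sum>j | offd (rmat f h) i j \<noteq> 0. offd (rmat f h) i j) = card {k. f k = i \<and> h k \<noteq> i}" for i
  proof -
    have s: "{j. offd (rmat f h) i j \<noteq> 0} = h ` {k. f k = i \<and> h k \<noteq> i}"
      using rmat_pos_iff[OF f n r, of h i] by (auto simp: offd_def)
    have "card {k. f k = i \<and> h k \<noteq> i} =
        (\<Sum>j\<in>h ` {k. f k = i \<and> h k \<noteq> i}. card {k \<in> {k. f k = i \<and> h k \<noteq> i}. h k = j})"
      by (rule card_fibres) (use finite_fibre_conj[OF f n r] in auto)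
    also have "\<dots> = (\<Sum>j | offd (rmat f h) i j \<noteq> 0. offd (rmat f h) i j)"
      unfolding s by (rule sum.cong[OF refl]) (auto simp: offd_def rmat_def intro!: arg_cong[where f = card])
    finally show ?thesis by simp
  qed
  have "zdeg n (rmat f h) = (\<Sum>i=1..int n. card {k. f k = i \<and> h k \<noteq> i})"
    unfolding zdeg_def mat_sigma_def row ..
  also have "\<dots> = (\<Sum>i=1..int n. card {k \<in> {k. 1 \<le> f k \<and> f k \<le> int n \<and> f k \<noteq> h k}. f k = i})"
    by (rule sum.cong[OF refl], rule arg_cong[where f = card]) auto
  also have "\<dots> = card {k. 1 \<le> f k \<and> f k \<le> int n \<and> f k \<noteq> h k}"
    by (rule card_fibres[symmetric]) (use finite_fund[OF f n r] in auto)
  also have "\<dots> = card {k \<in> {0..<int r}. f k \<noteq> h k}"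
  proof (rule pmaps_fund_card[OF f n r])
    fix k show "(f (k mod int r) \<noteq> h (k mod int r)) = (f k \<noteq> h k)"
      using pmaps_eq_of_mod[OF f, of k] pmaps_eq_of_mod[OF h, of k] by simp
  qed
  finally show ?thesis .
qed

lemma moved_mod:
  assumes "f \<in> pmaps n r" "g \<in> pmaps n r"
  shows "f (k mod int r) = g (k mod int r) \<longleftrightarrow> f k = g k"
  using pmaps_eq_of_mod[OF assms(1), of k] pmaps_eq_of_mod[OF assms(2), of k] by simp

text \<open>If passing from \<open>f\<close> to \<open>h\<close> through \<open>g\<close> moves as many points as possible, then no point
  is moved twice.\<close>
lemma offd_compose:
  assumes P: "f \<in> pmaps n r" "g \<in> pmaps n r" "h \<in> pmaps n r" and n: "n > 0" and r: "r > 0"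
  shows "zdeg n (rmat f h) \<le> zdeg n (rmat f g) + zdeg n (rmat g h)"
    and "zdeg n (rmat f h) = zdeg n (rmat f g) + zdeg n (rmat g h) \<Longrightarrow> f k = g k \<or> g k = h k"
    and "zdeg n (rmat f h) = zdeg n (rmat f g) + zdeg n (rmat g h) \<Longrightarrow>
      offd (rmat f h) = mat_add (offd (rmat f g)) (offd (rmat g h))"
proof -
  note z = zdeg_rmat[OF P(1,3) n r] zdeg_rmat[OF P(1,2) n r] zdeg_rmat[OF P(2,3) n r]
  let ?A = "{k \<in> {0..<int r}. f k \<noteq> g k}" and ?B = "{k \<in> {0..<int r}. g k \<noteq> h k}"
    and ?C = "{k \<in> {0..<int r}. f k \<noteq> h k}"
  have fin: "finite ?A" "finite ?B" by (rule finite_subset[OF Collect_restrict], simp)+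
  have "card ?C \<le> card (?A \<union> ?B)" by (rule card_mono[OF finite_UnI[OF fin]]) auto
  then have le: "card ?C \<le> card (?A \<union> ?B)" "card (?A \<union> ?B) + card (?A \<inter> ?B) = card ?A + card ?B"
    using card_Un_Int[OF fin] by simp_all
  then show "zdeg n (rmat f h) \<le> zdeg n (rmat f g) + zdeg n (rmat g h)" unfolding z by linarith
  show one: "f k = g k \<or> g k = h k"
    if "zdeg n (rmat f h) = zdeg n (rmat f g) + zdeg n (rmat g h)" for k
  proof -
    have "card (?A \<inter> ?B) = 0" using that le unfolding z by linarith
    then have "?A \<inter> ?B = {}" using fin by simp
    moreover have "k mod int r \<in> {0..<int r}" using r by simp
    ultimately have "f (k mod int r) = g (k mod int r) \<or> g (k mod int r) = h (k mod int r)" by blast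
    then show ?thesis using moved_mod P by metis
  qed
  show "offd (rmat f h) = mat_add (offd (rmat f g)) (offd (rmat g h))"
    if e: "zdeg n (rmat f h) = zdeg n (rmat f g) + zdeg n (rmat g h)"
  proof (intro ext)
    fix i j
    show "offd (rmat f h) i j = mat_add (offd (rmat f g)) (offd (rmat g h)) i j"
    proof (cases "i = j")
      case False
      have "{k. f k = i \<and> h k = j} = {k. f k = i \<and> g k = j} \<union> {k. g k = i \<and> h k = j}"
        using one[OF e] False by force
      moreover have "{k. f k = i \<and> g k = j} \<inter> {k. g k = i \<and> h k = j} = {}" using False by auto
      ultimately have "rmat f h i j = rmat f g i j + rmat g h i j"
        using finite_fibre_conj[OF P(1) n r] finite_fibre_conj[OF P(2) n r]
        by (simp add: rmat_def card_Un_disjoint)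
      then show ?thesis using False by (simp add: offd_def mat_add_def)
    qed (simp add: offd_def mat_add_def)
  qed
qed

text \<open>Of the points that go from \<open>i\<close> to \<open>j\<close>, an arbitrary set
  \<open>T i j\<close> of \<open>O1 i j\<close> points moves in the first step and the rest in the
  second. The diagonals of \<open>O1\<close> and \<open>O2\<close> vanish because their sum is an
  off-diagonal part.\<close>

lemma offd_split:
  assumes P: "f \<in> pmaps n r" "h \<in> pmaps n r" and n: "n > 0" and r: "r > 0"
    and O: "zperiodic n O1" "zperiodic n O2" and e: "offd (rmat f h) = mat_add O1 O2"
  obtains g where "g \<in> pmaps n r" "offd (rmat f g) = O1" "offd (rmat g h) = O2"
proof -
  have sum: "i \<noteq> j \<Longrightarrow> rmat f h i j = O1 i j + O2 i j" and diag: "O1 i i = 0" "O2 i i = 0" for i j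
    using fun_cong[OF fun_cong[OF e, of i], of j] fun_cong[OF fun_cong[OF e, of i], of i]
    by (auto simp: offd_def mat_add_def)
  define T where "T i j = (SOME T. T \<subseteq> {k. f k = i \<and> h k = j} \<and> card T = O1 i j)" for i j
  have T: "T i j \<subseteq> {k. f k = i \<and> h k = j} \<and> card (T i j) = O1 i j" for i j
    unfolding T_def
  proof (rule someI_ex)
    have "O1 i j \<le> card {k. f k = i \<and> h k = j}"
    proof (cases "i = j")
      case True then show ?thesis using diag(1)[of i] by simp
    next
      case False then show ?thesis using sum[OF False] by (simp add: rmat_def)
    qed
    then show "\<exists>T. T \<subseteq> {k. f k = i \<and> h k = j} \<and> card T = O1 i j"
      by (rule obtain_subset_with_card_n) blast
  qed
  note T = conjunct1[OF T] conjunct2[OF T]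
  \<comment> \<open>The sets \<open>T i j\<close> are chosen independently for all \<open>i\<close>,
    so they need not be periodic. Only those with \<open>i\<close> in \<open>1..n\<close> are used,
    and \<open>rep k\<close> is the translate of \<open>k\<close> whose value under \<open>f\<close>
    lies in that range.\<close>
  define rep where "rep k = k - ((f k - 1) div int n) * int r" for k
  define U where "U = {k. 1 \<le> f (rep k) \<and> f (rep k) \<le> int n \<and> rep k \<in> T (f (rep k)) (h (rep k))}"
  define g where "g k = (if k \<in> U then h k else f k)" for k
  have rep_add: "rep (k + int r) = rep k" for k
  proof -
    have "f (k + int r) - 1 = (f k - 1) + 1 * int n" using P(1) by (simp add: pmaps_def)
    then have "(f (k + int r) - 1) div int n = (f k - 1) div int n + 1"
      using n by (simp only: div_mult_self1)
    then show ?thesis unfolding rep_def by (simp add: algebra_simps)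
  qed
  have gP: "g \<in> pmaps n r" using P unfolding pmaps_def g_def U_def by (simp add: rep_add)
  have rep_id: "rep k = k" if "1 \<le> f k" "f k \<le> int n" for k
    using that n unfolding rep_def by (simp add: div_pos_pos_trivial)
  have inU: "k \<in> U \<longleftrightarrow> k \<in> T (f k) (h k)" if "1 \<le> f k" "f k \<le> int n" for k
    using rep_id[OF that] that unfolding U_def by simp
  have fT: "finite (T i j)" for i j using finite_subset[OF T(1) finite_fibre_conj[OF P(1) n r]] .
  have "offd (rmat f g) = O1"
  proof (rule zperiodic_eqI[OF n offd_zperiodic[OF rmat_zperiodic[OF P(1) gP]] O(1)])
    fix i j assume i: "1 \<le> i" "i \<le> int n"
    show "offd (rmat f g) i j = O1 i j"
    proof (cases "i = j")
      case False
      have "{k. f k = i \<and> g k = j} = T i j"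
        using inU T(1)[of i j] i False unfolding g_def by (auto split: if_splits)
      then show ?thesis using False T(2) by (simp add: offd_def rmat_def)
    qed (simp add: offd_def diag)
  qed
  moreover have "offd (rmat g h) = O2"
  proof (rule zperiodic_eqI[OF n offd_zperiodic[OF rmat_zperiodic[OF gP P(2)]] O(2)])
    fix i j assume i: "1 \<le> i" "i \<le> int n"
    show "offd (rmat g h) i j = O2 i j"
    proof (cases "i = j")
      case False
      have "{k. g k = i \<and> h k = j} = {k. f k = i \<and> h k = j} - T i j"
        using inU T(1)[of i j] i False unfolding g_def by (auto split: if_splits)
      then have "rmat g h i j = rmat f h i j - O1 i j"
        using card_Diff_subset[OF fT T(1)] T(2) by (simp add: rmat_def)
      then show ?thesis using False sum[OF False] by (simp add: offd_def)
    qed (simp add: offd_def diag)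
  qed
  ultimately show thesis using that gP by blast
qed

subsection \<open>Products of nonnegative elements\<close>

definition nonneg_elt :: "nat \<Rightarrow> nat \<Rightarrow> (zmat \<Rightarrow>\<^sub>0 rat) \<Rightarrow> bool" where
  "nonneg_elt n r x \<longleftrightarrow> Poly_Mapping.keys x \<subseteq> Theta_r n r \<and> (\<forall>A. Poly_Mapping.lookup x A \<ge> 0)"

lemma rmat_le_r:
  assumes f: "f \<in> pmaps n r" and n: "n > 0" and r: "r > 0" and i: "1 \<le> i" "i \<le> int n"
  shows "rmat f h i j \<le> r"
proof -
  have "rmat f h i j \<le> card {k. 1 \<le> f k \<and> f k \<le> int n \<and> True}"
    unfolding rmat_def by (rule card_mono) (use finite_fund[OF f n r, of 1 "int n" "\<lambda>_. True"] i in auto)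
  also have "\<dots> = card {k \<in> {0..<int r}. True}" by (rule pmaps_fund_card[OF f n r refl])
  also have "{k \<in> {0..<int r}. True} = {0..<int r}" by auto
  finally show ?thesis by simp
qed

text \<open>A nonzero constant requires an intermediate map. In rows \<open>1..n\<close> the support
  of \<open>C\<close> therefore lies in the finite composite \<open>N\<close> of the supports of
  \<open>A\<close> and \<open>B\<close>, and the entries are at most \<open>r\<close>. Without
  finiteness the sum in \<open>basis_mult\<close> would default to 0.\<close>

lemma finite_struct_supp:
  assumes n: "n > 0" and r: "r > 0" and A: "A \<in> Theta_r n r" and B: "B \<in> Theta_r n r"
  shows "finite {C \<in> Theta_r n r. poly (struct_poly n r A B C) 1 \<noteq> 0}" (is "finite ?F")
proof -
  have row: "finite {j. A i j \<noteq> 0}" "finite {j. B i j \<noteq> 0}" for i using A B by (auto simp: Theta_r_def Theta_def)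
  define N where "N = (SIGMA i:{1..int n}. \<Union>m\<in>{m. A i m \<noteq> 0}. {j. B m j \<noteq> 0})"
  have finN: "finite N" unfolding N_def using row by auto
  let ?\<rho> = "\<lambda>C. restrict (\<lambda>(i, j). C i j) N"
  have C: "C i j \<le> r \<and> (C i j \<noteq> 0 \<longrightarrow> (i, j) \<in> N)" if C: "C \<in> ?F" and i: "1 \<le> i" "i \<le> int n" for C i j
  proof -
    have "C \<in> Theta_r n r" using C by simp
    then obtain f h where P: "f \<in> pmaps n r" "h \<in> pmaps n r" "lexmono f h" and e: "rmat f h = C"
      by (rule ex_lexmono_rmat[OF _ n r])
    have "card {g \<in> pmaps n r. rmat f g = A \<and> rmat g h = B} \<noteq> 0"
      using C struct_poly_at_1[OF n r P A, of B] e by auto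
    then have "{g \<in> pmaps n r. rmat f g = A \<and> rmat g h = B} \<noteq> {}" by (metis card.empty)
    then obtain g where g: "g \<in> pmaps n r" "rmat f g = A" "rmat g h = B" by blast
    have "(i, j) \<in> N" if "C i j \<noteq> 0"
    proof -
      have "rmat f h i j \<noteq> 0" using that e by simp
      then obtain k where k: "f k = i" "h k = j" using rmat_pos_iff[OF P(1) n r, of h i j] by blast
      have "A i (g k) \<noteq> 0" "B (g k) j \<noteq> 0"
        using rmat_pos_iff[OF P(1) n r, of g i "g k"] rmat_pos_iff[OF g(1) n r, of h "g k" j] g k by blast+
      then show ?thesis unfolding N_def using i by auto
    qed
    then show ?thesis using rmat_le_r[OF P(1) n r i, of h j] e by blast
  qed
  have "finite (?\<rho> ` ?F)"
  proof (rule finite_subset)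
    show "?\<rho> ` ?F \<subseteq> N \<rightarrow>\<^sub>E {..r}"
    proof (rule image_subsetI)
      fix D assume D: "D \<in> ?F"
      have "D i j \<le> r" if "(i, j) \<in> N" for i j
        using C[OF D, of i j] that unfolding N_def by simp
      then show "?\<rho> D \<in> N \<rightarrow>\<^sub>E {..r}" unfolding restrict_PiE_iff by auto
    qed
    show "finite (N \<rightarrow>\<^sub>E {..r})" using finN by (simp add: finite_PiE)
  qed
  moreover have "inj_on ?\<rho> ?F"
  proof (rule inj_onI)
    fix C D assume CD: "C \<in> ?F" "D \<in> ?F" "?\<rho> C = ?\<rho> D"
    show "C = D"
    proof (rule zperiodic_eqI[OF n])
      show "zperiodic n C" "zperiodic n D" using CD by (auto simp: Theta_r_def Theta_zperiodic)
      fix i j assume i: "1 \<le> i" "i \<le> int n"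
      show "C i j = D i j"
      proof (cases "(i, j) \<in> N")
        case True then show ?thesis using fun_cong[OF CD(3), of "(i, j)"] by simp
      next
        case False then show ?thesis using C[OF CD(1) i] C[OF CD(2) i] by (metis)
      qed
    qed
  qed
  ultimately show ?thesis by (rule finite_imageD)
qed

lemma lookup_basis_mult:
  assumes n: "n > 0" and r: "r > 0" and A: "A \<in> Theta_r n r" and B: "B \<in> Theta_r n r"
  shows "Poly_Mapping.lookup (basis_mult n r A B) C =
    (if C \<in> Theta_r n r then of_int (poly (struct_poly n r A B C) 1) else 0)"
proof -
  have "Poly_Mapping.lookup (basis_mult n r A B) C =
      (\<Sum>D | D \<in> Theta_r n r \<and> poly (struct_poly n r A B D) 1 \<noteq> 0.
         if D = C then of_int (poly (struct_poly n r A B D) 1) else 0)"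
    unfolding basis_mult_def lookup_sum by (rule sum.cong[OF refl]) (simp add: lookup_single when_def)
  then show ?thesis using finite_struct_supp[OF assms] by (simp add: sum.delta)
qed

lemma mult_affine_schur: "x \<otimes>\<^bsub>affine_schur n r\<^esub> y =
    (\<Sum>A\<in>Poly_Mapping.keys x. \<Sum>B\<in>Poly_Mapping.keys y.
        rat_scale (Poly_Mapping.lookup x A * Poly_Mapping.lookup y B) (basis_mult n r A B))"
  by (simp add: affine_schur_def)

lemma lookup_mult_rmat:
  assumes n: "n > 0" and r: "r > 0" and x: "nonneg_elt n r x" and y: "nonneg_elt n r y"
    and P: "f \<in> pmaps n r" "h \<in> pmaps n r" "lexmono f h"
  shows "Poly_Mapping.lookup (x \<otimes>\<^bsub>affine_schur n r\<^esub> y) (rmat f h) =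
    (\<Sum>A\<in>Poly_Mapping.keys x. \<Sum>B\<in>Poly_Mapping.keys y. Poly_Mapping.lookup x A * Poly_Mapping.lookup y B *
       of_nat (card {g \<in> pmaps n r. rmat f g = A \<and> rmat g h = B}))"
  unfolding mult_affine_schur lookup_sum lookup_rat_scale
proof (intro sum.cong refl)
  fix A B assume "A \<in> Poly_Mapping.keys x" "B \<in> Poly_Mapping.keys y"
  then have AB: "A \<in> Theta_r n r" "B \<in> Theta_r n r" using x y by (auto simp: nonneg_elt_def)
  show "Poly_Mapping.lookup x A * Poly_Mapping.lookup y B * Poly_Mapping.lookup (basis_mult n r A B) (rmat f h) =
      Poly_Mapping.lookup x A * Poly_Mapping.lookup y B * of_nat (card {g \<in> pmaps n r. rmat f g = A \<and> rmat g h = B})"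
    using rmat_in_Theta_r[OF P(1,2) n r] struct_poly_at_1[OF n r P AB(1), of B]
    by (simp add: lookup_basis_mult[OF n r AB])
qed

lemma nonneg_mult:
  assumes n: "n > 0" and r: "r > 0" and x: "nonneg_elt n r x" and y: "nonneg_elt n r y"
  shows "nonneg_elt n r (x \<otimes>\<^bsub>affine_schur n r\<^esub> y)"
proof -
  have "Poly_Mapping.lookup (x \<otimes>\<^bsub>affine_schur n r\<^esub> y) C \<ge> 0 \<and>
      (C \<notin> Theta_r n r \<longrightarrow> Poly_Mapping.lookup (x \<otimes>\<^bsub>affine_schur n r\<^esub> y) C = 0)" for C
  proof (cases "C \<in> Theta_r n r")
    case True
    then obtain f h where P: "f \<in> pmaps n r" "h \<in> pmaps n r" "lexmono f h" and e: "rmat f h = C"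
      by (rule ex_lexmono_rmat[OF _ n r])
    have "Poly_Mapping.lookup (x \<otimes>\<^bsub>affine_schur n r\<^esub> y) C \<ge> 0"
      unfolding e[symmetric] lookup_mult_rmat[OF n r x y P]
      by (intro sum_nonneg mult_nonneg_nonneg) (use x y in \<open>simp_all add: nonneg_elt_def\<close>)
    then show ?thesis using True by simp
  next
    case False
    have "Poly_Mapping.lookup (x \<otimes>\<^bsub>affine_schur n r\<^esub> y) C = 0"
      unfolding mult_affine_schur lookup_sum lookup_rat_scale
    proof (intro sum.neutral ballI)
      fix A B assume "A \<in> Poly_Mapping.keys x" "B \<in> Poly_Mapping.keys y"
      then have AB: "A \<in> Theta_r n r" "B \<in> Theta_r n r" using x y by (auto simp: nonneg_elt_def)
      show "Poly_Mapping.lookup x A * Poly_Mapping.lookup y B * Poly_Mapping.lookup (basis_mult n r A B) C = 0"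
        using False by (simp add: lookup_basis_mult[OF n r AB])
    qed
    then show ?thesis by simp
  qed
  then show ?thesis unfolding nonneg_elt_def by (auto simp: in_keys_iff)
qed

text \<open>All terms of the double sum are nonnegative, so nothing cancels. The pair has to be
  sorted for \<open>struct_poly_at_1\<close> to apply; every matrix in \<open>Theta_r n r\<close>
  has a sorted pair by \<open>ex_lexmono_rmat\<close>.\<close>

lemma keys_mult_iff:
  assumes n: "n > 0" and r: "r > 0" and x: "nonneg_elt n r x" and y: "nonneg_elt n r y"
    and P: "f \<in> pmaps n r" "h \<in> pmaps n r" "lexmono f h"
  shows "rmat f h \<in> Poly_Mapping.keys (x \<otimes>\<^bsub>affine_schur n r\<^esub> y) \<longleftrightarrow>
    (\<exists>g\<in>pmaps n r. rmat f g \<in> Poly_Mapping.keys x \<and> rmat g h \<in> Poly_Mapping.keys y)"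
proof -
  let ?N = "\<lambda>A B. {g \<in> pmaps n r. rmat f g = A \<and> rmat g h = B}"
  let ?t = "\<lambda>A B. Poly_Mapping.lookup x A * Poly_Mapping.lookup y B * of_nat (card (?N A B))"
  have fin: "finite (?N A B)" if "A \<in> Theta_r n r" for A B
  proof (rule finite_subset)
    show "?N A B \<subseteq> {g \<in> pmaps n r. rmat f g = A}" by blast
    show "finite {g \<in> pmaps n r. rmat f g = A}"
      using finite_pmaps_rmat[OF n r _ P(1), of A] that by (simp add: Theta_r_def)
  qed
  have nn: "0 \<le> ?t A B" for A B using x y by (simp add: nonneg_elt_def)
  have pos: "?t A B \<noteq> 0 \<longleftrightarrow> ?N A B \<noteq> {}" if "A \<in> Poly_Mapping.keys x" "B \<in> Poly_Mapping.keys y" for A B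
  proof -
    have "A \<in> Theta_r n r" using x that by (auto simp: nonneg_elt_def)
    then have "card (?N A B) = 0 \<longleftrightarrow> ?N A B = {}" by (simp only: card_eq_0_iff fin) simp
    then show ?thesis using that by (simp add: in_keys_iff)
  qed
  have "rmat f h \<in> Poly_Mapping.keys (x \<otimes>\<^bsub>affine_schur n r\<^esub> y) \<longleftrightarrow>
      (\<Sum>A\<in>Poly_Mapping.keys x. \<Sum>B\<in>Poly_Mapping.keys y. ?t A B) \<noteq> 0"
    unfolding in_keys_iff lookup_mult_rmat[OF n r x y P] ..
  also have "\<dots> \<longleftrightarrow> (\<exists>A\<in>Poly_Mapping.keys x. (\<Sum>B\<in>Poly_Mapping.keys y. ?t A B) \<noteq> 0)"
    by (subst sum_nonneg_eq_0_iff) (auto intro!: sum_nonneg nn)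
  also have "\<dots> \<longleftrightarrow> (\<exists>A\<in>Poly_Mapping.keys x. \<exists>B\<in>Poly_Mapping.keys y. ?t A B \<noteq> 0)"
    by (subst sum_nonneg_eq_0_iff) (auto intro!: nn)
  also have "\<dots> \<longleftrightarrow> (\<exists>A\<in>Poly_Mapping.keys x. \<exists>B\<in>Poly_Mapping.keys y. ?N A B \<noteq> {})" using pos by blast
  also have "\<dots> \<longleftrightarrow> (\<exists>g\<in>pmaps n r. rmat f g \<in> Poly_Mapping.keys x \<and> rmat g h \<in> Poly_Mapping.keys y)" by blast
  finally show ?thesis .
qed

text \<open>\<open>A\<close> is the off-diagonal part of the leading terms of \<open>x\<close>, and \<open>d\<close> their degree; every
  matrix with this off-diagonal part has to occur.\<close>
definition leads :: "nat \<Rightarrow> nat \<Rightarrow> (zmat \<Rightarrow>\<^sub>0 rat) \<Rightarrow> zmat \<Rightarrow> nat \<Rightarrow> bool" where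
  "leads n r x A d \<longleftrightarrow> nonneg_elt n r x \<and> zperiodic n A \<and>
     (\<forall>C\<in>Poly_Mapping.keys x. zdeg n C < d \<or> zdeg n C = d \<and> offd C = A) \<and>
     (\<forall>C\<in>Theta_r n r. offd C = A \<longrightarrow> C \<in> Poly_Mapping.keys x)"

text \<open>The degree bound and the shape of the terms of top degree come from
  \<open>offd_compose\<close>. Conversely \<open>offd_split\<close> factors a matrix with the right
  off-diagonal part through an intermediate map; both factors then occur because
  \<open>leads\<close> demands all matrices with the given off-diagonal part.\<close>

lemma leads_mult:
  assumes n: "n > 0" and r: "r > 0" and x: "leads n r x A d" and y: "leads n r y B e"
  shows "leads n r (x \<otimes>\<^bsub>affine_schur n r\<^esub> y) (mat_add A B) (d + e)"
  unfolding leads_def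
proof (intro conjI ballI impI)
  have nx: "nonneg_elt n r x" and ny: "nonneg_elt n r y" and pA: "zperiodic n A" and pB: "zperiodic n B"
    using x y by (simp_all add: leads_def)
  show nxy: "nonneg_elt n r (x \<otimes>\<^bsub>affine_schur n r\<^esub> y)" by (rule nonneg_mult[OF n r nx ny])
  show "zperiodic n (mat_add A B)" using pA pB by (simp add: zperiodic_def mat_add_def)
  { fix C assume C: "C \<in> Poly_Mapping.keys (x \<otimes>\<^bsub>affine_schur n r\<^esub> y)"
    then have "C \<in> Theta_r n r" using nxy by (auto simp: nonneg_elt_def)
    then obtain f h where P: "f \<in> pmaps n r" "h \<in> pmaps n r" "lexmono f h" and eC: "rmat f h = C"
      by (rule ex_lexmono_rmat[OF _ n r])
    obtain g where g: "g \<in> pmaps n r" "rmat f g \<in> Poly_Mapping.keys x" "rmat g h \<in> Poly_Mapping.keys y"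
      using keys_mult_iff[OF n r nx ny P] C eC by auto
    have 1: "zdeg n (rmat f g) < d \<or> zdeg n (rmat f g) = d \<and> offd (rmat f g) = A"
      and 2: "zdeg n (rmat g h) < e \<or> zdeg n (rmat g h) = e \<and> offd (rmat g h) = B"
      using x y g unfolding leads_def by blast+
    note c = offd_compose[OF P(1) g(1) P(2) n r]
    show "zdeg n C < d + e \<or> zdeg n C = d + e \<and> offd C = mat_add A B"
    proof (cases "zdeg n C < d + e")
      case False
      have "zdeg n C \<le> zdeg n (rmat f g) + zdeg n (rmat g h)" using c(1) eC by simp
      moreover have "zdeg n (rmat f g) \<le> d" "zdeg n (rmat g h) \<le> e" using 1 2 by auto
      ultimately have "zdeg n (rmat f g) = d" "zdeg n (rmat g h) = e" "zdeg n C = d + e" using False by linarith+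
      then show ?thesis using 1 2 c(3) eC by simp
    qed simp }
  fix C assume C: "C \<in> Theta_r n r" "offd C = mat_add A B"
  obtain f h where P: "f \<in> pmaps n r" "h \<in> pmaps n r" "lexmono f h" and eC: "rmat f h = C"
    by (rule ex_lexmono_rmat[OF C(1) n r])
  obtain g where g: "g \<in> pmaps n r" "offd (rmat f g) = A" "offd (rmat g h) = B"
    by (rule offd_split[OF P(1,2) n r pA pB]) (use C(2) eC in blast)+
  have "rmat f g \<in> Poly_Mapping.keys x" "rmat g h \<in> Poly_Mapping.keys y"
    using x y g rmat_in_Theta_r[OF P(1) g(1) n r] rmat_in_Theta_r[OF g(1) P(2) n r] unfolding leads_def by blast+
  then show "C \<in> Poly_Mapping.keys (x \<otimes>\<^bsub>affine_schur n r\<^esub> y)"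
    using keys_mult_iff[OF n r nx ny P] g(1) eC by blast
qed

section \<open>Leading terms of the identity and of the generators\<close>

lemma finite_aff_comps:
  assumes n: "n > 0" shows "finite (aff_comps n r)"
proof -
  let ?\<rho> = "\<lambda>l :: int \<Rightarrow> nat. restrict l {1..int n}"
  have "?\<rho> ` aff_comps n r \<subseteq> {1..int n} \<rightarrow>\<^sub>E {..r}"
  proof (rule image_subsetI)
    fix l assume l: "l \<in> aff_comps n r"
    have "l i \<le> r" if "i \<in> {1..int n}" for i
      using member_le_sum[OF that, of l] l by (simp add: aff_comps_def)
    then show "?\<rho> l \<in> {1..int n} \<rightarrow>\<^sub>E {..r}" unfolding restrict_PiE_iff by simp
  qed
  then have "finite (?\<rho> ` aff_comps n r)" by (rule finite_subset) (simp add: finite_PiE)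
  moreover have "inj_on ?\<rho> (aff_comps n r)"
  proof (rule inj_onI)
    fix l m assume lm: "l \<in> aff_comps n r" "m \<in> aff_comps n r" "?\<rho> l = ?\<rho> m"
    have "diag_mat l = diag_mat m"
    proof (rule zperiodic_eqI[OF n])
      show "zperiodic n (diag_mat l)" "zperiodic n (diag_mat m)"
        using lm by (auto simp: zperiodic_def diag_mat_def aff_comps_def)
      fix i j assume "1 \<le> i" "i \<le> int n"
      then show "diag_mat l i j = diag_mat m i j" using fun_cong[OF lm(3), of i] by (auto simp: diag_mat_def)
    qed
    then have "diag_mat l i i = diag_mat m i i" for i by simp
    then show "l = m" by (auto simp: diag_mat_def)
  qed
  ultimately show ?thesis by (rule finite_imageD)
qed

lemma lookup_sum_basis:
  assumes "finite X"
  shows "Poly_Mapping.lookup (\<Sum>l\<in>X. basis_elt (F l)) C = of_nat (card {l \<in> X. F l = C})"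
proof -
  have "Poly_Mapping.lookup (\<Sum>l\<in>X. basis_elt (F l)) C = (\<Sum>l\<in>X. if F l = C then 1 else 0)"
    unfolding lookup_sum by (rule sum.cong[OF refl]) (simp add: lookup_single when_def)
  then show ?thesis using assms by (simp add: sum.If_cases Int_def)
qed

lemma keys_sum_basis:
  assumes "finite X"
  shows "Poly_Mapping.keys (\<Sum>l\<in>X. basis_elt (F l)) = F ` X"
  using assms by (auto simp: in_keys_iff lookup_sum_basis card_eq_0_iff)

lemma mat_sigma_offd:
  assumes "C \<in> Theta n"
  shows "mat_sigma n C = zdeg n C + (\<Sum>i=1..int n. C i i)"
proof -
  have "(\<Sum>j | C i j \<noteq> 0. C i j) = (\<Sum>j | offd C i j \<noteq> 0. offd C i j) + C i i" for i
  proof -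
    have fin: "finite {j. C i j \<noteq> 0}" using assms by (simp add: Theta_def)
    have "(\<Sum>j | C i j \<noteq> 0. C i j) = (\<Sum>j\<in>insert i {j. C i j \<noteq> 0}. C i j)"
      by (rule sum.mono_neutral_left) (use fin in auto)
    also have "\<dots> = C i i + (\<Sum>j\<in>insert i {j. C i j \<noteq> 0} - {i}. C i j)"
      by (rule sum.remove) (use fin in auto)
    also have "insert i {j. C i j \<noteq> 0} - {i} = {j. offd C i j \<noteq> 0}" by (auto simp: offd_def)
    also have "(\<Sum>j | offd C i j \<noteq> 0. C i j) = (\<Sum>j | offd C i j \<noteq> 0. offd C i j)"
      by (rule sum.cong[OF refl]) (auto simp: offd_def split: if_splits)
    finally show ?thesis by simp
  qed
  then show ?thesis unfolding mat_sigma_def zdeg_def by (simp add: sum.distrib)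
qed

lemma offd_diag_eq:
  assumes "offd A = offd B" "\<And>i. A i i = B i i" shows "A = B"
proof (intro ext)
  fix i j show "A i j = B i j"
    using fun_cong[OF fun_cong[OF assms(1), of i], of j] assms(2) by (cases "i = j") (auto simp: offd_def)
qed

lemma diag_mat_Theta_r: "l \<in> aff_comps n r \<Longrightarrow> diag_mat l \<in> Theta_r n r"
proof -
  assume l: "l \<in> aff_comps n r"
  have s: "{j. diag_mat l i j \<noteq> 0} \<subseteq> {i}" for i by (auto simp: diag_mat_def)
  have "(\<Sum>j | diag_mat l i j \<noteq> 0. diag_mat l i j) = (\<Sum>j\<in>{i}. diag_mat l i j)" for i
    by (rule sum.mono_neutral_left) (use s in auto)
  then have "mat_sigma n (diag_mat l) = (\<Sum>i=1..int n. l i)" by (simp add: mat_sigma_def diag_mat_def)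
  moreover have "finite {j. diag_mat l i j \<noteq> 0}" for i by (rule finite_subset[OF s]) simp
  ultimately show ?thesis using l by (simp add: Theta_r_def Theta_def aff_comps_def) (simp add: diag_mat_def)
qed

lemma leads_one:
  assumes n: "n > 0"
  shows "leads n r \<one>\<^bsub>affine_schur n r\<^esub> (\<lambda>i j. 0) 0"
proof -
  note fin = finite_aff_comps[OF n, of r]
  have one: "\<one>\<^bsub>affine_schur n r\<^esub> = (\<Sum>l\<in>aff_comps n r. basis_elt (diag_mat l))" by (simp add: affine_schur_def)
  have o: "offd (diag_mat l) = (\<lambda>i j. 0)" for l by (intro ext) (simp add: offd_def diag_mat_def)
  show ?thesis unfolding leads_def nonneg_elt_def one keys_sum_basis[OF fin] lookup_sum_basis[OF fin]
  proof (intro conjI ballI impI allI)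
    show "diag_mat ` aff_comps n r \<subseteq> Theta_r n r" using diag_mat_Theta_r by blast
    show "zperiodic n (\<lambda>i j. 0)" by (simp add: zperiodic_def)
    fix C assume "C \<in> diag_mat ` aff_comps n r"
    then show "zdeg n C < 0 \<or> zdeg n C = 0 \<and> offd C = (\<lambda>i j. 0)" using o by (auto simp: zdeg_def mat_sigma_def)
  next
    fix C assume C: "C \<in> Theta_r n r" "offd C = (\<lambda>i j. 0)"
    then have T: "C \<in> Theta n" "mat_sigma n C = r" by (auto simp: Theta_r_def)
    define l where "l i = C i i" for i
    have "zdeg n C = 0" by (simp add: zdeg_def C(2) mat_sigma_def)
    then have "l \<in> aff_comps n r" using mat_sigma_offd[OF T(1)] T unfolding l_def by (simp add: aff_comps_def Theta_def)
    moreover have "C = diag_mat l" by (rule offd_diag_eq) (simp_all add: C(2) o, simp add: diag_mat_def l_def)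
    ultimately show "C \<in> diag_mat ` aff_comps n r" by blast
  qed simp
qed

lemma E_mat_row:
  "E_mat n i j k l = (if int n dvd k - i \<and> l = j + (k - i) then 1 else 0)"
  unfolding E_mat_def by (auto simp: dvd_def algebra_simps)

lemma E_mat_zperiodic: "zperiodic n (E_mat n i j)"
  unfolding zperiodic_def E_mat_row
proof (intro allI)
  fix k l
  have "k + int n - i = (k - i) + int n" by simp
  then have "int n dvd k + int n - i \<longleftrightarrow> int n dvd k - i" by (simp only: dvd_add_triv_right_iff)
  then show "(if int n dvd k + int n - i \<and> l + int n = j + (k + int n - i) then 1 else 0) =
      (if int n dvd k - i \<and> l = j + (k - i) then 1 else (0 :: nat))" by auto
qed

lemma E_mat_fund:
  assumes "1 \<le> i" "i \<le> int n" "1 \<le> k" "k \<le> int n"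
  shows "E_mat n i j k l = (if k = i \<and> l = j then 1 else 0)"
proof -
  have "int n dvd k - i \<longleftrightarrow> k = i"
  proof
    assume "int n dvd k - i"
    show "k = i"
    proof (rule ccontr)
      assume "k \<noteq> i"
      then have "\<bar>int n\<bar> \<le> \<bar>k - i\<bar>" using \<open>int n dvd k - i\<close> by (intro dvd_imp_le_int) simp_all
      then show False using assms by linarith
    qed
  qed simp
  then show ?thesis unfolding E_mat_row by auto
qed

lemma E_mat_Theta: "E_mat n i j \<in> Theta n"
proof -
  have "finite {l. E_mat n i j k l \<noteq> 0}" for k
    by (rule finite_subset[of _ "{j + (k - i)}"]) (auto simp: E_mat_row)
  then show ?thesis using E_mat_zperiodic by (auto simp: Theta_def zperiodic_def)
qed

lemma mat_sigma_E_mat: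
  assumes i: "1 \<le> i" "i \<le> int n" shows "mat_sigma n (E_mat n i j) = 1"
proof -
  have "mat_sigma n (E_mat n i j) = (\<Sum>k=1..int n. if k = i then 1 else 0)"
    unfolding mat_sigma_def
  proof (rule sum.cong[OF refl])
    fix k assume "k \<in> {1..int n}"
    then have e: "E_mat n i j k l = (if k = i \<and> l = j then 1 else 0)" for l using E_mat_fund[OF i] by simp
    show "(\<Sum>l | E_mat n i j k l \<noteq> 0. E_mat n i j k l) = (if k = i then 1 else 0)"
      unfolding e by (cases "k = i") simp_all
  qed
  also have "\<dots> = 1" using i by simp
  finally show ?thesis .
qed

text \<open>All terms share the off-diagonal part \<open>E_mat n i j\<close>, of degree 1. A matrix
  of size \<open>r\<close> with this part has diagonal sum \<open>r - 1\<close>, hence is one of the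
  terms.\<close>

lemma leads_E:
  assumes n: "n > 0" and r: "r > 0" and i: "1 \<le> i" "i \<le> int n" "i \<noteq> j"
  shows "leads n r (E_elt n r i j) (E_mat n i j) 1"
proof -
  note fin = finite_aff_comps[OF n, of "r - 1"]
  let ?F = "\<lambda>l. mat_add (E_mat n i j) (diag_mat l)"
  have x: "E_elt n r i j = (\<Sum>l\<in>aff_comps n (r - 1). basis_elt (?F l))" using r by (simp add: E_elt_def)
  have E0: "E_mat n i j k k = 0" for k using i(3) by (auto simp: E_mat_row)
  have o: "offd (?F l) = E_mat n i j" for l using E0 by (auto simp: offd_def mat_add_def diag_mat_def fun_eq_iff)
  have oE: "offd (E_mat n i j) = E_mat n i j" using E0 by (auto simp: offd_def fun_eq_iff)
  have deg: "zdeg n C = 1" if "offd C = E_mat n i j" for C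
    unfolding zdeg_def that by (rule mat_sigma_E_mat[OF i(1,2)])
  have F: "?F l \<in> Theta_r n r" if l: "l \<in> aff_comps n (r - 1)" for l
  proof -
    have lT: "diag_mat l \<in> Theta n" using diag_mat_Theta_r[OF l] by (simp add: Theta_r_def)
    have "finite {j'. ?F l k j' \<noteq> 0}" for k
      by (rule finite_subset[of _ "{j'. E_mat n i j k j' \<noteq> 0} \<union> {j'. diag_mat l k j' \<noteq> 0}"])
        (use lT E_mat_Theta in \<open>auto simp: mat_add_def Theta_def\<close>)
    then have T: "?F l \<in> Theta n" using lT E_mat_Theta[of n i j] by (auto simp: mat_add_def Theta_def)
    have "mat_sigma n (?F l) = 1 + (\<Sum>k=1..int n. l k)"
      unfolding mat_sigma_offd[OF T] deg[OF o] using E0 by (simp add: mat_add_def diag_mat_def)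
    then show ?thesis using T l r by (simp add: Theta_r_def aff_comps_def)
  qed
  show ?thesis unfolding leads_def nonneg_elt_def x keys_sum_basis[OF fin] lookup_sum_basis[OF fin]
  proof (intro conjI ballI impI allI)
    show "?F ` aff_comps n (r - 1) \<subseteq> Theta_r n r" using F by blast
    show "zperiodic n (E_mat n i j)" by (rule E_mat_zperiodic)
    fix C assume "C \<in> ?F ` aff_comps n (r - 1)"
    then show "zdeg n C < 1 \<or> zdeg n C = 1 \<and> offd C = E_mat n i j" using o deg by blast
  next
    fix C assume C: "C \<in> Theta_r n r" "offd C = E_mat n i j"
    then have T: "C \<in> Theta n" "mat_sigma n C = r" by (auto simp: Theta_r_def)
    define l where "l i = C i i" for i
    have "(\<Sum>k=1..int n. l k) = r - 1" using mat_sigma_offd[OF T(1)] T deg[OF C(2)] by (simp add: l_def)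
    then have "l \<in> aff_comps n (r - 1)" using T by (simp add: aff_comps_def Theta_def l_def)
    moreover have "C = ?F l" by (rule offd_diag_eq) (simp_all add: C(2) o, simp add: mat_add_def E0 diag_mat_def l_def)
    ultimately show "C \<in> ?F ` aff_comps n (r - 1)" by blast
  qed simp
qed

section \<open>Powers and ordered products\<close>

lemma leads_pow:
  assumes n: "n > 0" and r: "r > 0" and x: "leads n r x A d"
  shows "leads n r (x [^]\<^bsub>affine_schur n r\<^esub> (a :: nat)) (\<lambda>i j. a * A i j) (a * d)"
proof (induction a)
  case 0 then show ?case using leads_one[OF n] by (simp add: nat_pow_def)
next
  case (Suc a)
  have "mat_add (\<lambda>i j. a * A i j) A = (\<lambda>i j. Suc a * A i j)" by (intro ext) (simp add: mat_add_def)
  moreover have "x [^]\<^bsub>affine_schur n r\<^esub> Suc a = x [^]\<^bsub>affine_schur n r\<^esub> a \<otimes>\<^bsub>affine_schur n r\<^esub> x"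
    by (simp add: nat_pow_def)
  ultimately show ?case using leads_mult[OF n r Suc x] by (simp add: add.commute)
qed

lemma leads_foldr:
  assumes n: "n > 0" and r: "r > 0" and xs: "\<And>p. p \<in> set xs \<Longrightarrow> 1 \<le> fst p \<and> fst p \<le> int n \<and> fst p \<noteq> snd p"
  shows "leads n r (foldr (\<lambda>(i, j) x. (E_elt n r i j [^]\<^bsub>affine_schur n r\<^esub> A i j) \<otimes>\<^bsub>affine_schur n r\<^esub> x) xs
      \<one>\<^bsub>affine_schur n r\<^esub>)
    (\<lambda>k l. \<Sum>p\<leftarrow>xs. A (fst p) (snd p) * E_mat n (fst p) (snd p) k l) (\<Sum>p\<leftarrow>xs. A (fst p) (snd p))"
  using xs
proof (induction xs)
  case Nil then show ?case using leads_one[OF n] by simp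
next
  case (Cons p xs)
  obtain i j where p: "p = (i, j)" by (cases p)
  have i: "1 \<le> i" "i \<le> int n" "i \<noteq> j" using Cons.prems[of p] p by auto
  have IH: "leads n r (foldr (\<lambda>(i, j) x. (E_elt n r i j [^]\<^bsub>affine_schur n r\<^esub> A i j) \<otimes>\<^bsub>affine_schur n r\<^esub> x) xs
      \<one>\<^bsub>affine_schur n r\<^esub>)
    (\<lambda>k l. \<Sum>p\<leftarrow>xs. A (fst p) (snd p) * E_mat n (fst p) (snd p) k l) (\<Sum>p\<leftarrow>xs. A (fst p) (snd p))"
    by (rule Cons.IH) (use Cons.prems in auto)
  show ?case using leads_mult[OF n r leads_pow[OF n r leads_E[OF n r i], of "A i j"] IH]
    by (simp add: p mat_add_def)
qed

text \<open>The description in \<open>ordered_list\<close> is justified by inserting elements one at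
  a time and, for uniqueness, by comparing heads: two different heads would each precede the other,
  against antisymmetry.\<close>

lemma ordered_list_props:
  assumes lin: "linear_order_on I R" and T: "finite T" "T \<subseteq> I"
  shows "set (ordered_list R T) = T" "distinct (ordered_list R T)"
proof -
  have re: "(x, x) \<in> R" if "x \<in> I" for x
    using lin that unfolding linear_order_on_def partial_order_on_def preorder_on_def refl_on_def by blast
  have tr: "(x, z) \<in> R" if "(x, y) \<in> R" "(y, z) \<in> R" for x y z
    using lin that unfolding linear_order_on_def partial_order_on_def preorder_on_def trans_def by blast
  have an: "x = y" if "(x, y) \<in> R" "(y, x) \<in> R" for x y
    using lin that unfolding linear_order_on_def partial_order_on_def antisym_def by blast
  have tot: "(x, y) \<in> R \<or> (y, x) \<in> R" if "x \<in> I" "y \<in> I" for x y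
    using lin that re unfolding linear_order_on_def total_on_def by (cases "x = y") blast+
  let ?Q = "\<lambda>T xs. set xs = T \<and> distinct xs \<and> sorted_wrt (\<lambda>x y. (x, y) \<in> R) xs"
  have "\<exists>xs. ?Q T xs" using T
  proof (induction T rule: finite_induct)
    case (insert a T)
    then obtain xs where xs: "?Q T xs" by auto
    let ?P = "\<lambda>x. (x, a) \<in> R"
    let ?ys = "filter ?P xs @ a # filter (\<lambda>x. \<not> ?P x) xs"
    have up: "(a, x) \<in> R" if "x \<in> T" "\<not> ?P x" for x using tot[of x a] insert.prems that by auto
    have "sorted_wrt (\<lambda>x y. (x, y) \<in> R) ?ys"
      unfolding sorted_wrt_append sorted_wrt.simps
      using xs up tr by (auto simp: sorted_wrt_filter)
    moreover have "set ?ys = insert a T" "distinct ?ys" using xs insert.hyps by auto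
    ultimately show ?case by blast
  qed (use sorted_wrt.simps(1) in auto)
  moreover have "xs = ys" if "?Q T xs" "?Q T ys" for xs ys
    using that
  proof (induction xs arbitrary: ys T)
    case (Cons x xs)
    then obtain y zs where ys: "ys = y # zs" by (cases ys) auto
    have "x = y"
    proof (rule ccontr)
      assume "x \<noteq> y"
      moreover have "x \<in> set ys" "y \<in> set (x # xs)" using Cons.prems ys by auto
      ultimately have "(y, x) \<in> R" "(x, y) \<in> R" using Cons.prems ys by auto
      then show False using an \<open>x \<noteq> y\<close> by blast
    qed
    moreover have "xs = zs"
      by (rule Cons.IH[of "T - {x}"]) (use Cons.prems ys \<open>x = y\<close> in auto)
    ultimately show ?case using ys by simp
  qed auto
  ultimately have "\<exists>!xs. ?Q T xs" by blast
  from theI'[OF this] show "set (ordered_list R T) = T" "distinct (ordered_list R T)"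
    unfolding ordered_list_def by blast+
qed

lemma finite_supp_rows:
  assumes "A \<in> Theta n" shows "finite {(i, j). 1 \<le> i \<and> i \<le> int n \<and> A i j \<noteq> 0}"
proof -
  have "{(i, j). 1 \<le> i \<and> i \<le> int n \<and> A i j \<noteq> 0} = (SIGMA i:{1..int n}. {j. A i j \<noteq> 0})" by auto
  moreover have "finite \<dots>" using assms by (intro finite_SigmaI) (auto simp: Theta_def)
  ultimately show ?thesis by simp
qed

text \<open>The relation \<open>P\<close> will be \<open><\<close> or \<open>>\<close>. The leading
  off-diagonal part of the product is the sum of the multiples \<open>A i j\<close> of
  \<open>E_mat n i j\<close> over rows \<open>1..n\<close>, which by periodicity is the part of
  \<open>A\<close> selected by \<open>P\<close>. Addition of matrices does not see the order of the
  factors, which is why any total order will do.\<close>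

lemma leads_E_prod:
  assumes n: "n > 0" and r: "r > 0" and A: "A \<in> Theta n" and lin: "linear_order_on I R"
    and I: "I = {(i, j). 1 \<le> i \<and> i \<le> int n \<and> P i j}" and P: "\<And>i j. P i j \<Longrightarrow> i \<noteq> j"
    and Pn: "\<And>i j. P (i + int n) (j + int n) = P i j"
  shows "leads n r (E_prod n r I R A) (\<lambda>i j. if P i j then A i j else 0)
    (mat_sigma n (\<lambda>i j. if P i j then A i j else 0))"
proof -
  let ?O = "\<lambda>i j. if P i j then A i j else 0"
  define T where "T = {(i, j) \<in> I. A i j \<noteq> 0}"
  have finT: "finite T" unfolding T_def I by (rule finite_subset[OF _ finite_supp_rows[OF A]]) auto
  have TI: "T \<subseteq> I" unfolding T_def by auto
  let ?xs = "ordered_list R T"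
  note xs = ordered_list_props[OF lin finT TI]
  have sum: "(\<Sum>p\<leftarrow>?xs. F p) = sum F T" for F :: "int \<times> int \<Rightarrow> nat"
    using sum_list_distinct_conv_sum_set[OF xs(2), of F] xs(1) by simp
  have 1: "leads n r (E_prod n r I R A)
    (\<lambda>k l. \<Sum>p\<leftarrow>?xs. A (fst p) (snd p) * E_mat n (fst p) (snd p) k l) (\<Sum>p\<leftarrow>?xs. A (fst p) (snd p))"
    unfolding E_prod_def T_def[symmetric]
  proof (rule leads_foldr[OF n r])
    fix p assume "p \<in> set ?xs"
    then have "p \<in> T" by (simp only: xs(1))
    then show "1 \<le> fst p \<and> fst p \<le> int n \<and> fst p \<noteq> snd p" using P unfolding T_def I by auto
  qed
  have O: "(\<lambda>k l. \<Sum>p\<leftarrow>?xs. A (fst p) (snd p) * E_mat n (fst p) (snd p) k l) = ?O"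
  proof (rule zperiodic_eqI[OF n])
    show "zperiodic n (\<lambda>k l. \<Sum>p\<leftarrow>?xs. A (fst p) (snd p) * E_mat n (fst p) (snd p) k l)"
      using 1 by (simp add: leads_def)
    show "zperiodic n ?O" using A by (simp add: zperiodic_def Pn Theta_def)
    fix k l assume k: "1 \<le> k" "k \<le> int n"
    have "(\<Sum>p\<leftarrow>?xs. A (fst p) (snd p) * E_mat n (fst p) (snd p) k l) = (\<Sum>p\<in>T. if p = (k, l) then A k l else 0)"
      unfolding sum by (rule sum.cong[OF refl]) (auto simp: T_def I E_mat_fund k split: if_splits)
    also have "\<dots> = ?O k l" using finT k by (auto simp: T_def I)
    finally show "(\<Sum>p\<leftarrow>?xs. A (fst p) (snd p) * E_mat n (fst p) (snd p) k l) = ?O k l" .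
  qed
  have "mat_sigma n ?O = (\<Sum>i=1..int n. \<Sum>j | ?O i j \<noteq> 0. A i j)"
    unfolding mat_sigma_def by (intro sum.cong refl) (auto split: if_splits)
  also have "\<dots> = (\<Sum>p\<in>(SIGMA i:{1..int n}. {j. ?O i j \<noteq> 0}). A (fst p) (snd p))"
  proof (subst sum.Sigma)
    show "\<forall>i\<in>{1..int n}. finite {j. ?O i j \<noteq> 0}"
    proof
      fix i show "finite {j. ?O i j \<noteq> 0}"
        by (rule finite_subset[of _ "{j. A i j \<noteq> 0}"]) (use A in \<open>auto simp: Theta_def\<close>)
    qed
  qed (simp_all add: case_prod_unfold)
  also have "(SIGMA i:{1..int n}. {j. ?O i j \<noteq> 0}) = T" by (auto simp: T_def I)
  finally have "(\<Sum>p\<leftarrow>?xs. A (fst p) (snd p)) = mat_sigma n ?O" using sum by simp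
  then show ?thesis using 1 O by simp
qed

section \<open>The basis\<close>

text \<open>The points with maximum \<open>i\<close> are those with both values \<open>i\<close>,
  counted by the diagonal entry, those that fall from \<open>i\<close> to some \<open>j < i\<close>,
  and those that rise from some \<open>j < i\<close> to \<open>i\<close>.\<close>

lemma bsigma_rmat:
  assumes f: "f \<in> pmaps n r" and h: "h \<in> pmaps n r" and n: "n > 0" and r: "r > 0"
  shows "bsigma (rmat f h) i = card {k. max (f k) (h k) = i}"
proof -
  let ?S = "{j. j < i \<and> rmat f h i j + rmat f h j i \<noteq> 0}"
  note fin = finite_fibre_conj[OF f n r]
  have finh: "finite {k. h k = i \<and> P k}" for P by (rule finite_fibre_conj[OF h n r])
  have fib: "rmat f h (f k) (h k) \<noteq> 0" for k using rmat_pos_iff[OF f n r, of h "f k" "h k"] by blast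
  have sub: "h ` {k. f k = i \<and> h k < i} \<subseteq> ?S" "f ` {k. h k = i \<and> f k < i} \<subseteq> ?S"
    using fib by (auto simp del: neq0_conv)
  have S: "?S \<subseteq> h ` {k. f k = i \<and> h k < i} \<union> f ` {k. h k = i \<and> f k < i}"
    using rmat_pos_iff[OF f n r, of h] by (auto simp: image_iff)
  then have finS: "finite ?S" using fin finh by (meson finite_UnI finite_imageI finite_subset)
  have 1: "card {k. f k = i \<and> h k < i} = (\<Sum>j\<in>?S. rmat f h i j)"
  proof -
    have "card {k. f k = i \<and> h k < i} = (\<Sum>j\<in>?S. card {k \<in> {k. f k = i \<and> h k < i}. h k = j})"
      by (rule card_fibres[OF fin finS sub(1)])
    also have "\<dots> = (\<Sum>j\<in>?S. rmat f h i j)"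
      by (rule sum.cong[OF refl]) (auto simp: rmat_def intro!: arg_cong[where f = card])
    finally show ?thesis .
  qed
  have 2: "card {k. h k = i \<and> f k < i} = (\<Sum>j\<in>?S. rmat f h j i)"
  proof -
    have "card {k. h k = i \<and> f k < i} = (\<Sum>j\<in>?S. card {k \<in> {k. h k = i \<and> f k < i}. f k = j})"
      by (rule card_fibres[OF finh finS sub(2)])
    also have "\<dots> = (\<Sum>j\<in>?S. rmat f h j i)"
      by (rule sum.cong[OF refl]) (auto simp: rmat_def intro!: arg_cong[where f = card])
    finally show ?thesis .
  qed
  have "{k. max (f k) (h k) = i} = {k. f k = i \<and> h k = i} \<union> ({k. f k = i \<and> h k < i} \<union> {k. h k = i \<and> f k < i})"
    by (auto simp: max_def)
  then have "card {k. max (f k) (h k) = i} =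
      card {k. f k = i \<and> h k = i} + (card {k. f k = i \<and> h k < i} + card {k. h k = i \<and> f k < i})"
    using fin[of i "\<lambda>k. h k = i"] fin[of i "\<lambda>k. h k < i"] finh[of "\<lambda>k. f k < i"]
    by (simp only:) (subst card_Un_disjoint; (subst card_Un_disjoint)?; auto)
  then show ?thesis unfolding 1 2 bsigma_def by (simp add: rmat_def sum.distrib)
qed

lemma rmat_self: "rmat g g = diag_mat (\<lambda>i. card {k. g k = i})"
proof (intro ext)
  fix i j
  show "rmat g g i j = diag_mat (\<lambda>i. card {k. g k = i}) i j"
  proof (cases "i = j")
    case False
    then have e: "{k. g k = i \<and> g k = j} = {}" by auto
    show ?thesis using False unfolding rmat_def diag_mat_def e by simp
  qed (simp add: rmat_def diag_mat_def)
qed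

lemma rmat_flip: "rmat g f j i = rmat f g i j"
  unfolding rmat_def by (rule arg_cong[where f = card]) blast

lemma rmat_column_card:
  assumes "f \<in> pmaps n r" "g \<in> pmaps n r" "f' \<in> pmaps n r" "g' \<in> pmaps n r" "n > 0" "r > 0"
    and "rmat f g = rmat f' g'"
  shows "card {k. g k = i} = card {k. g' k = i}"
proof -
  have "rmat g f = rmat g' f'" by (intro ext) (metis assms(7) rmat_flip)
  then show ?thesis using rmat_row_sum[OF assms(2,5,6), of f i] rmat_row_sum[OF assms(4,5,6), of f' i] by simp
qed

text \<open>This is how a diagonal basis element acts as an idempotent: passing through it leaves
  the map unchanged.\<close>

lemma rmat_diag_eq:
  assumes "g \<in> pmaps n r" "n > 0" "r > 0" and "rmat g g' = diag_mat l"
  shows "g = g'"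
proof
  fix k
  have "diag_mat l (g k) (g' k) \<noteq> 0" using rmat_pos_iff[OF assms(1-3), of g' "g k" "g' k"] assms(4) by auto
  then show "g k = g' k" by (auto simp: diag_mat_def split: if_splits)
qed

lemma max_pmaps: "f \<in> pmaps n r \<Longrightarrow> h \<in> pmaps n r \<Longrightarrow> (\<lambda>k. max (f k) (h k)) \<in> pmaps n r"
  by (auto simp: pmaps_def max_def)

text \<open>Going from \<open>f\<close> to the maximum moves exactly the points that
  \<open>h\<close> moves up, and to the same places.\<close>

lemma rmat_max_upper:
  "offd (rmat f (\<lambda>k. max (f k) (h k))) = (\<lambda>i j. if i < j then rmat f h i j else 0)"
proof (intro ext)
  fix i j :: int
  have 1: "i < j \<Longrightarrow> {k. f k = i \<and> max (f k) (h k) = j} = {k. f k = i \<and> h k = j}"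
    and "j < i \<Longrightarrow> {k. f k = i \<and> max (f k) (h k) = j} = {}" by (auto simp: max_def split: if_splits)
  then have 2: "j < i \<Longrightarrow> card {k. f k = i \<and> max (f k) (h k) = j} = 0" by (simp only: card.empty)
  from 1 have "i < j \<Longrightarrow> card {k. f k = i \<and> max (f k) (h k) = j} = card {k. f k = i \<and> h k = j}" by simp
  note this 2
  then show "offd (rmat f (\<lambda>k. max (f k) (h k))) i j = (if i < j then rmat f h i j else 0)"
    by (cases i j rule: linorder_cases) (simp_all add: offd_def rmat_def)
qed

lemma rmat_max_lower:
  "offd (rmat (\<lambda>k. max (f k) (h k)) h) = (\<lambda>i j. if j < i then rmat f h i j else 0)"
proof (intro ext)
  fix i j :: int
  have 1: "j < i \<Longrightarrow> {k. max (f k) (h k) = i \<and> h k = j} = {k. f k = i \<and> h k = j}"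
    and "i < j \<Longrightarrow> {k. max (f k) (h k) = i \<and> h k = j} = {}" by (auto simp: max_def split: if_splits)
  then have 2: "i < j \<Longrightarrow> card {k. max (f k) (h k) = i \<and> h k = j} = 0" by (simp only: card.empty)
  from 1 have "j < i \<Longrightarrow> card {k. max (f k) (h k) = i \<and> h k = j} = card {k. f k = i \<and> h k = j}" by simp
  note this 2
  then show "offd (rmat (\<lambda>k. max (f k) (h k)) h) i j = (if j < i then rmat f h i j else 0)"
    by (cases i j rule: linorder_cases) (simp_all add: offd_def rmat_def)
qed

lemma pbw_leading:
  assumes n: "n > 0" and r: "r > 0" and A: "A \<in> Theta_r n r"
    and lp: "linear_order_on (L_plus n) Rp" and lm: "linear_order_on (L_minus n) Rm"
  shows "Poly_Mapping.keys (pbw_elt n r Rp Rm A) \<subseteq> Theta_r n r" "A \<in> Poly_Mapping.keys (pbw_elt n r Rp Rm A)"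
    "\<And>C. C \<in> Poly_Mapping.keys (pbw_elt n r Rp Rm A) \<Longrightarrow> C = A \<or> zdeg n C < zdeg n A"
proof -
  let ?S = "affine_schur n r"
  let ?up = "\<lambda>i j. if i < j then A i j else 0" and ?lo = "\<lambda>i j. if j < i then A i j else 0"
  have T: "A \<in> Theta n" using A by (simp add: Theta_r_def)
  define x where "x = E_prod n r (L_plus n) Rp A"
  define y where "y = E_prod n r (L_minus n) Rm A"
  define z where "z = basis_elt (diag_mat (bsigma A))"
  have lx: "leads n r x ?up (mat_sigma n ?up)" unfolding x_def
    by (rule leads_E_prod[OF n r T lp, where P = "(<)"]) (auto simp: L_plus_def)
  have ly: "leads n r y ?lo (mat_sigma n ?lo)" unfolding y_def
    by (rule leads_E_prod[OF n r T lm, where P = "\<lambda>i j. j < i"]) (auto simp: L_minus_def)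
  have nx: "nonneg_elt n r x" and ny: "nonneg_elt n r y" using lx ly by (simp_all add: leads_def)
  obtain f h where P: "f \<in> pmaps n r" "h \<in> pmaps n r" "lexmono f h" and e: "rmat f h = A"
    by (rule ex_lexmono_rmat[OF A n r])
  \<comment> \<open>First move every point up to its final place if it is to move up, and then the others down.\<close>
  let ?m = "\<lambda>k. max (f k) (h k)"
  note mP = max_pmaps[OF P(1,2)]
  have sig: "rmat ?m ?m = diag_mat (bsigma A)"
    unfolding rmat_self e[symmetric] bsigma_rmat[OF P(1,2) n r] ..
  have zk: "Poly_Mapping.keys z = {diag_mat (bsigma A)}" unfolding z_def by simp
  have nz: "nonneg_elt n r z" unfolding nonneg_elt_def zk
    using rmat_in_Theta_r[OF mP mP n r] sig by (auto simp: z_def lookup_single when_def)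
  have nxz: "nonneg_elt n r (x \<otimes>\<^bsub>?S\<^esub> z)" by (rule nonneg_mult[OF n r nx nz])
  have pbw: "pbw_elt n r Rp Rm A = x \<otimes>\<^bsub>?S\<^esub> z \<otimes>\<^bsub>?S\<^esub> y" by (simp add: pbw_elt_def x_def y_def z_def)
  have npbw: "nonneg_elt n r (pbw_elt n r Rp Rm A)" unfolding pbw by (rule nonneg_mult[OF n r nxz ny])
  then show keys: "Poly_Mapping.keys (pbw_elt n r Rp Rm A) \<subseteq> Theta_r n r" by (simp add: nonneg_elt_def)
  \<comment> \<open>The idempotent keeps the terms of \<open>x\<close> whose column sums are
    \<open>bsigma A\<close>. The pairs met below need not be sorted, so the product rule is applied
    to a sorted pair with the same matrix; the column sums depend on the matrix only.\<close>
  have xz_iff: "rmat f' g' \<in> Poly_Mapping.keys (x \<otimes>\<^bsub>?S\<^esub> z) \<longleftrightarrow>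
      rmat f' g' \<in> Poly_Mapping.keys x \<and> (\<forall>i. card {k. g' k = i} = bsigma A i)"
    if Q: "f' \<in> pmaps n r" "g' \<in> pmaps n r" for f' g'
  proof -
    obtain f1 g1 where R: "f1 \<in> pmaps n r" "g1 \<in> pmaps n r" "lexmono f1 g1" and e1: "rmat f1 g1 = rmat f' g'"
      by (rule ex_lexmono_rmat[OF rmat_in_Theta_r[OF Q n r] n r])
    have "rmat f' g' \<in> Poly_Mapping.keys (x \<otimes>\<^bsub>?S\<^esub> z) \<longleftrightarrow>
        (\<exists>g\<in>pmaps n r. rmat f1 g \<in> Poly_Mapping.keys x \<and> rmat g g1 = diag_mat (bsigma A))"
      unfolding e1[symmetric] keys_mult_iff[OF n r nx nz R] zk by simp
    also have "\<dots> \<longleftrightarrow> rmat f1 g1 \<in> Poly_Mapping.keys x \<and> rmat g1 g1 = diag_mat (bsigma A)"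
      using rmat_diag_eq[OF _ n r] R(2) by blast
    also have "rmat g1 g1 = diag_mat (bsigma A) \<longleftrightarrow> (\<forall>i. card {k. g1 k = i} = bsigma A i)"
    proof
      assume a: "rmat g1 g1 = diag_mat (bsigma A)"
      show "\<forall>i. card {k. g1 k = i} = bsigma A i"
      proof
        fix i show "card {k. g1 k = i} = bsigma A i"
          using fun_cong[OF fun_cong[OF a, of i], of i] by (simp add: rmat_def diag_mat_def)
      qed
    qed (simp add: rmat_self)
    also have "(\<forall>i. card {k. g1 k = i} = bsigma A i) \<longleftrightarrow> (\<forall>i. card {k. g' k = i} = bsigma A i)"
      using rmat_column_card[OF R(1,2) Q n r e1] by simp
    finally show ?thesis unfolding e1 .
  qed
  have up: "rmat f ?m \<in> Poly_Mapping.keys x"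
    using lx rmat_in_Theta_r[OF P(1) mP n r] rmat_max_upper[of f h] unfolding leads_def e by blast
  have lo: "rmat ?m h \<in> Poly_Mapping.keys y"
    using ly rmat_in_Theta_r[OF mP P(2) n r] rmat_max_lower[of f h] unfolding leads_def e by blast
  have "rmat f ?m \<in> Poly_Mapping.keys (x \<otimes>\<^bsub>?S\<^esub> z)"
    using xz_iff[OF P(1) mP] up bsigma_rmat[OF P(1,2) n r] e by simp
  then have "rmat f h \<in> Poly_Mapping.keys (x \<otimes>\<^bsub>?S\<^esub> z \<otimes>\<^bsub>?S\<^esub> y)"
    unfolding keys_mult_iff[OF n r nxz ny P] using mP lo by blast
  then show "A \<in> Poly_Mapping.keys (pbw_elt n r Rp Rm A)" unfolding pbw e .
  have degA: "zdeg n A = mat_sigma n ?up + mat_sigma n ?lo"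
  proof -
    have "(\<Sum>j | offd A i j \<noteq> 0. offd A i j) = (\<Sum>j | ?up i j \<noteq> 0. ?up i j) + (\<Sum>j | ?lo i j \<noteq> 0. ?lo i j)" for i
    proof -
      have s: "{j. offd A i j \<noteq> 0} = {j. ?up i j \<noteq> 0} \<union> {j. ?lo i j \<noteq> 0}" by (auto simp: offd_def)
      have f: "finite {j. ?up i j \<noteq> 0}" "finite {j. ?lo i j \<noteq> 0}"
        by (rule finite_subset[of _ "{j. A i j \<noteq> 0}"], use T in \<open>auto simp: Theta_def\<close>)+
      have "(\<Sum>j | offd A i j \<noteq> 0. offd A i j) = (\<Sum>j | ?up i j \<noteq> 0. offd A i j) + (\<Sum>j | ?lo i j \<noteq> 0. offd A i j)"
        unfolding s by (rule sum.union_disjoint[OF f]) (auto split: if_splits)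
      also have "(\<Sum>j | ?up i j \<noteq> 0. offd A i j) = (\<Sum>j | ?up i j \<noteq> 0. ?up i j)"
        by (rule sum.cong[OF refl]) (auto simp: offd_def split: if_splits)
      also have "(\<Sum>j | ?lo i j \<noteq> 0. offd A i j) = (\<Sum>j | ?lo i j \<noteq> 0. ?lo i j)"
        by (rule sum.cong[OF refl]) (auto simp: offd_def split: if_splits)
      finally show ?thesis .
    qed
    then show ?thesis unfolding zdeg_def mat_sigma_def by (simp only: sum.distrib)
  qed
  fix C assume C: "C \<in> Poly_Mapping.keys (pbw_elt n r Rp Rm A)"
  then have "C \<in> Theta_r n r" using keys by blast
  then obtain f' h' where Q: "f' \<in> pmaps n r" "h' \<in> pmaps n r" "lexmono f' h'" and eC: "rmat f' h' = C"
    by (rule ex_lexmono_rmat[OF _ n r])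
  have "\<exists>g\<in>pmaps n r. rmat f' g \<in> Poly_Mapping.keys (x \<otimes>\<^bsub>?S\<^esub> z) \<and> rmat g h' \<in> Poly_Mapping.keys y"
    using C unfolding pbw eC[symmetric] keys_mult_iff[OF n r nxz ny Q] .
  then obtain g where g: "g \<in> pmaps n r" "rmat f' g \<in> Poly_Mapping.keys (x \<otimes>\<^bsub>?S\<^esub> z)" "rmat g h' \<in> Poly_Mapping.keys y"
    by blast
  have gx: "rmat f' g \<in> Poly_Mapping.keys x" and gs: "\<And>i. card {k. g k = i} = bsigma A i"
    using g(2) xz_iff[OF Q(1) g(1)] by blast+
  have 1: "zdeg n (rmat f' g) < mat_sigma n ?up \<or> zdeg n (rmat f' g) = mat_sigma n ?up \<and> offd (rmat f' g) = ?up"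
    using lx gx unfolding leads_def by blast
  have 2: "zdeg n (rmat g h') < mat_sigma n ?lo \<or> zdeg n (rmat g h') = mat_sigma n ?lo \<and> offd (rmat g h') = ?lo"
    using ly g(3) unfolding leads_def by blast
  note c = offd_compose[OF Q(1) g(1) Q(2) n r]
  show "C = A \<or> zdeg n C < zdeg n A"
  proof (cases "zdeg n C < zdeg n A")
    case False
    have "zdeg n C \<le> zdeg n (rmat f' g) + zdeg n (rmat g h')" using c(1) eC by simp
    moreover have "zdeg n (rmat f' g) \<le> mat_sigma n ?up" "zdeg n (rmat g h') \<le> mat_sigma n ?lo" using 1 2 by auto
    ultimately have d: "zdeg n (rmat f' g) = mat_sigma n ?up" "zdeg n (rmat g h') = mat_sigma n ?lo"
      "zdeg n C = zdeg n (rmat f' g) + zdeg n (rmat g h')" using False degA by linarith+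
    have o: "offd (rmat f' g) = ?up" "offd (rmat g h') = ?lo" using 1 2 d by auto
    have d': "zdeg n (rmat f' h') = zdeg n (rmat f' g) + zdeg n (rmat g h')" using d(3) eC by simp
    have "offd C = mat_add ?up ?lo" using c(3)[OF d'] o eC by simp
    also have "\<dots> = offd A" by (auto simp: mat_add_def offd_def fun_eq_iff)
    finally have off: "offd C = offd A" .
    \<comment> \<open>The first step only raises points and the second only lowers them, so
      \<open>g\<close> is above both maps; no point moves twice, so at each point it equals one of
      them.\<close>
    have gm: "g k = max (f' k) (h' k)" for k
    proof -
      have "f' k \<le> g k"
      proof (rule ccontr)
        assume a: "\<not> f' k \<le> g k"
        have "rmat f' g (f' k) (g k) \<noteq> 0" using rmat_pos_iff[OF Q(1) n r, of g "f' k" "g k"] by blast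
        then have "offd (rmat f' g) (f' k) (g k) \<noteq> 0" using a by (simp add: offd_def)
        then have "?up (f' k) (g k) \<noteq> 0" unfolding o(1) .
        then show False using a by (simp split: if_splits)
      qed
      moreover have "h' k \<le> g k"
      proof (rule ccontr)
        assume a: "\<not> h' k \<le> g k"
        have "rmat g h' (g k) (h' k) \<noteq> 0" using rmat_pos_iff[OF g(1) n r, of h' "g k" "h' k"] by blast
        then have "offd (rmat g h') (g k) (h' k) \<noteq> 0" using a by (simp add: offd_def)
        then have "?lo (g k) (h' k) \<noteq> 0" unfolding o(2) .
        then show False using a by (simp split: if_splits)
      qed
      moreover have "f' k = g k \<or> g k = h' k" by (rule c(2)[OF d'])
      ultimately show ?thesis by auto
    qed
    have bs: "bsigma C i = bsigma A i" for i
      using gs[of i] bsigma_rmat[OF Q(1,2) n r, of i] unfolding gm eC by simp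
    \<comment> \<open>In the formula for \<open>bsigma\<close> the off-diagonal contributions now
      agree, so equal values leave equal diagonal entries.\<close>
    have "C i i = A i i" for i
    proof -
      have "C i j = A i j" "C j i = A j i" if "j < i" for j
        using fun_cong[OF fun_cong[OF off, of i], of j] fun_cong[OF fun_cong[OF off, of j], of i] that
        by (simp_all add: offd_def)
      then have "(\<Sum>j | j < i \<and> C i j + C j i \<noteq> 0. C i j + C j i) = (\<Sum>j | j < i \<and> A i j + A j i \<noteq> 0. A i j + A j i)"
        by (intro sum.cong) auto
      then show ?thesis using bs[of i] unfolding bsigma_def by linarith
    qed
    then show ?thesis using offd_diag_eq[OF off] by blast
  qed simp
qed

section \<open>Triangular families of finitely supported functions\<close>

lemma rat_combination:
  "x = (\<Sum>A\<in>Poly_Mapping.keys x. rat_scale (Poly_Mapping.lookup x A) (Poly_Mapping.single A 1))"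
proof (rule poly_mapping_eqI)
  fix C
  have "Poly_Mapping.lookup (\<Sum>A\<in>Poly_Mapping.keys x. rat_scale (Poly_Mapping.lookup x A) (Poly_Mapping.single A 1)) C =
      (\<Sum>A\<in>Poly_Mapping.keys x. if A = C then Poly_Mapping.lookup x C else 0)"
    unfolding lookup_sum by (rule sum.cong[OF refl]) (simp add: lookup_rat_scale lookup_single when_def)
  then show "Poly_Mapping.lookup x C =
      Poly_Mapping.lookup (\<Sum>A\<in>Poly_Mapping.keys x. rat_scale (Poly_Mapping.lookup x A) (Poly_Mapping.single A 1)) C"
    by (simp add: in_keys_iff)
qed

text \<open>In a linear relation, a member of largest degree has a key that no other member of the
  relation has. For the span, the single basis elements are solved for by induction on the
  degree.\<close>

lemma triangular_basis:
  fixes b :: "'a \<Rightarrow> 'a \<Rightarrow>\<^sub>0 rat" and deg :: "'a \<Rightarrow> nat"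
  assumes keys: "\<And>A. A \<in> T \<Longrightarrow> Poly_Mapping.keys (b A) \<subseteq> T" and diag: "\<And>A. A \<in> T \<Longrightarrow> A \<in> Poly_Mapping.keys (b A)"
    and low: "\<And>A C. A \<in> T \<Longrightarrow> C \<in> Poly_Mapping.keys (b A) \<Longrightarrow> C = A \<or> deg C < deg A"
  shows "inj_on b T \<and> rat_vs.independent (b ` T) \<and> rat_vs.span (b ` T) = {x. Poly_Mapping.keys x \<subseteq> T}"
proof (intro conjI)
  show inj: "inj_on b T"
  proof (rule inj_onI)
    fix A B assume A: "A \<in> T" and B: "B \<in> T" and e: "b A = b B"
    show "A = B" using low[OF A, of B] low[OF B, of A] diag[OF A] diag[OF B] e by (metis less_asym)
  qed
  show "rat_vs.independent (b ` T)"
    unfolding rat_vs.independent_explicit_finite_subsets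
  proof (intro allI impI ballI, rule ccontr)
    fix S u v assume S: "S \<subseteq> b ` T" "finite S" and 0: "(\<Sum>v\<in>S. rat_scale (u v) v) = 0" and v: "v \<in> S" "u v \<noteq> 0"
    define a where "a = inv_into T b"
    have a: "a w \<in> T \<and> b (a w) = w" if "w \<in> S" for w
      using that S(1) unfolding a_def by (metis f_inv_into_f inv_into_into subsetD)
    let ?V = "{w \<in> S. u w \<noteq> 0}"
    have fin: "finite ?V" "?V \<noteq> {}" using S(2) v by auto
    then have "Max ((\<lambda>w. deg (a w)) ` ?V) \<in> (\<lambda>w. deg (a w)) ` ?V" by (intro Max_in) auto
    then obtain w where w: "w \<in> ?V" "deg (a w) = Max ((\<lambda>w. deg (a w)) ` ?V)" by auto
    have mx: "deg (a w') \<le> deg (a w)" if "w' \<in> ?V" for w' unfolding w(2) using fin that by (intro Max_ge) auto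
    have wS: "w \<in> S" using w(1) by simp
    have "0 = (\<Sum>v\<in>S. u v * Poly_Mapping.lookup v (a w))"
      using arg_cong[OF 0, of "\<lambda>x. Poly_Mapping.lookup x (a w)"] by (simp add: lookup_sum lookup_rat_scale)
    also have "\<dots> = u w * Poly_Mapping.lookup w (a w) + (\<Sum>v\<in>S - {w}. u v * Poly_Mapping.lookup v (a w))"
      by (rule sum.remove[OF S(2) wS])
    also have "(\<Sum>v\<in>S - {w}. u v * Poly_Mapping.lookup v (a w)) = 0"
    proof (rule sum.neutral, rule ballI, rule ccontr)
      fix w' assume w': "w' \<in> S - {w}" and nz: "u w' * Poly_Mapping.lookup w' (a w) \<noteq> 0"
      then have w'V: "w' \<in> ?V" and k: "a w \<in> Poly_Mapping.keys (b (a w'))" using a by (auto simp: in_keys_iff)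
      have "a w \<noteq> a w'" using a[OF wS] a[of w'] w' by auto
      then have "deg (a w) < deg (a w')" using low[OF _ k] a[of w'] w' by blast
      then show False using mx[OF w'V] by simp
    qed
    finally have "Poly_Mapping.lookup w (a w) = 0" using w(1) by simp
    moreover have "a w \<in> Poly_Mapping.keys w" using diag[of "a w"] a[OF wS] by simp
    ultimately show False by (simp add: in_keys_iff)
  qed
  show "rat_vs.span (b ` T) = {x. Poly_Mapping.keys x \<subseteq> T}"
  proof
    have "rat_vs.subspace {x. Poly_Mapping.keys x \<subseteq> T}"
    proof (rule rat_vs.subspaceI)
      fix x y :: "'a \<Rightarrow>\<^sub>0 rat" and c
      show "0 \<in> {x :: 'a \<Rightarrow>\<^sub>0 rat. Poly_Mapping.keys x \<subseteq> T}" by simp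
      assume x: "x \<in> {x. Poly_Mapping.keys x \<subseteq> T}"
      show "rat_scale c x \<in> {x. Poly_Mapping.keys x \<subseteq> T}"
        using x by (auto simp: in_keys_iff lookup_rat_scale)
      assume "y \<in> {x. Poly_Mapping.keys x \<subseteq> T}"
      then show "x + y \<in> {x. Poly_Mapping.keys x \<subseteq> T}" using x Poly_Mapping.keys_add[of x y] by blast
    qed
    then show "rat_vs.span (b ` T) \<subseteq> {x. Poly_Mapping.keys x \<subseteq> T}"
      by (intro rat_vs.span_minimal) (use keys in auto)
    have single: "basis C \<in> rat_vs.span (b ` T)" if "basis = (\<lambda>C. Poly_Mapping.single C 1)" "C \<in> T" for C basis
      using that
    proof (induction "deg C" arbitrary: C rule: less_induct)
      case less
      let ?k = "Poly_Mapping.keys (b C)" and ?l = "Poly_Mapping.lookup (b C)"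
      have bas: "basis D = Poly_Mapping.single D 1" for D using less.prems(1) by simp
      have "b C = (\<Sum>A\<in>?k. rat_scale (?l A) (Poly_Mapping.single A 1))"
        by (rule rat_combination)
      also have "\<dots> = rat_scale (?l C) (basis C) + (\<Sum>A\<in>?k - {C}. rat_scale (?l A) (basis A))"
        unfolding bas by (rule sum.remove) (use diag[OF less.prems(2)] in simp_all)
      finally have e: "b C - (\<Sum>A\<in>?k - {C}. rat_scale (?l A) (basis A)) = rat_scale (?l C) (basis C)"
        by (rule diff_eq_eq[THEN iffD2])
      have "rat_scale (?l C) (basis C) \<in> rat_vs.span (b ` T)"
        unfolding e[symmetric]
      proof (rule rat_vs.span_diff[OF rat_vs.span_base rat_vs.span_sum[OF rat_vs.span_scale]])
        show "b C \<in> b ` T" using less.prems by blast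
        fix A assume A: "A \<in> ?k - {C}"
        then have "deg A < deg C" "A \<in> T" using low[OF less.prems(2)] keys[OF less.prems(2)] by blast+
        then show "basis A \<in> rat_vs.span (b ` T)" using less.hyps less.prems(1) by blast
      qed
      from rat_vs.span_scale[OF this, of "inverse (?l C)"] have "rat_scale (inverse (?l C) * ?l C) (basis C) \<in> rat_vs.span (b ` T)"
        by simp
      moreover have "?l C \<noteq> 0" using diag[OF less.prems(2)] by (simp add: in_keys_iff)
      ultimately show ?case by simp
    qed
    show "{x. Poly_Mapping.keys x \<subseteq> T} \<subseteq> rat_vs.span (b ` T)"
    proof
      fix x :: "'a \<Rightarrow>\<^sub>0 rat" assume x: "x \<in> {x. Poly_Mapping.keys x \<subseteq> T}"
      have "(\<Sum>A\<in>Poly_Mapping.keys x. rat_scale (Poly_Mapping.lookup x A) (Poly_Mapping.single A 1)) \<in> rat_vs.span (b ` T)"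
        by (intro rat_vs.span_sum rat_vs.span_scale single[OF refl]) (use x in blast)
      then show "x \<in> rat_vs.span (b ` T)" using rat_combination[of x] by simp
    qed
  qed
qed

subsection \<open>The degenerate case \<open>r = 0\<close>\<close>

lemma Theta_r_0:
  assumes n: "n > 0" shows "Theta_r n 0 = {\<lambda>i j. 0}"
proof (intro equalityI subsetI)
  fix A assume "A \<in> Theta_r n 0"
  then have A: "A \<in> Theta n" "mat_sigma n A = 0" by (simp_all add: Theta_r_def)
  have "A = (\<lambda>i j. 0)"
  proof (rule zperiodic_eqI[OF n Theta_zperiodic[OF A(1)]])
    fix i j assume i: "1 \<le> i" "i \<le> int n"
    have fin: "finite {j. A i j \<noteq> 0}" using A(1) by (simp add: Theta_def)
    have "(\<Sum>j | A i j \<noteq> 0. A i j) = 0"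
      using A(2) i unfolding mat_sigma_def by (subst (asm) sum_eq_0_iff) auto
    then have "\<forall>j\<in>{j. A i j \<noteq> 0}. A i j = 0" using fin by (simp only: sum_eq_0_iff)
    then show "A i j = 0" by blast
  qed (simp add: zperiodic_def)
  then show "A \<in> {\<lambda>i j. 0}" by simp
qed (simp add: Theta_r_def Theta_def mat_sigma_def)

text \<open>The free module of rank 0 has one element, so there is a single lattice and a single
  flag, and the count is 1 over every field.\<close>

lemma struct_poly_0: "struct_poly n 0 (\<lambda>i j. 0) (\<lambda>i j. 0) (\<lambda>i j. 0) = 1"
proof (rule struct_poly_eqI)
  fix K :: "nat ring" assume K: "field K" "finite (carrier K)"
  interpret laurent_lattices K 0 using K by (simp add: laurent_lattices_def laurent_lattices_axioms_def)
  let ?z = "\<zero>\<^bsub>V\<^esub>" and ?Z = "\<lambda>i j :: int. 0 :: nat"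
  have car: "carrier V = {?z}"
    using V_zero_closed by (auto simp: V_mem V_zero extensional_def fun_eq_iff)
  have SSz: "U \<in> SS \<longleftrightarrow> U = {?z}" for U
  proof
    assume "U \<in> SS" then show "U = {?z}" using vs.subspaceD(1,3)[of U] car by blast
  next
    assume "U = {?z}"
    moreover have "supp_space (\<lambda>_ _. True) = {?z}" using car by (simp add: supp_space_def)
    ultimately show "U \<in> SS" using supp_space_SS[of "\<lambda>_ _. True"] by simp
  qed
  have z: "{?z} \<in> SS" unfolding SSz ..
  have box: "box a = {?z}" for a using supp_space_SS[of "\<lambda>t m. a \<le> m"] unfolding SSz .
  have lsh: "lsh a {?z} = {?z}" for a using lsh_SS[OF z, of a] unfolding SSz .
  have lat: "lattice_in K 0 U \<longleftrightarrow> U = {?z}" for U unfolding lattice_iff SSz box using lsh by auto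
  have fl: "L \<in> flags n K 0 \<longleftrightarrow> L = (\<lambda>i. {?z})" for L
  proof
    assume "L \<in> flags n K 0"
    then have "L i = {?z}" for i unfolding flags_iff periodic_flag_def mem_Collect_eq lat by blast
    then show "L = (\<lambda>i. {?z})" by blast
  next
    assume "L = (\<lambda>i. {?z})"
    then show "L \<in> flags n K 0" unfolding flags_iff periodic_flag_def mem_Collect_eq lat by (simp only: lsh) simp
  qed
  have "{?z} <+>\<^bsub>V\<^esub> {?z} = {?z}" using vs.subspace_set_add[OF z z] unfolding SSz .
  then have orb: "(L, L') \<in> flag_orbit n K 0 ?Z \<longleftrightarrow> L = (\<lambda>i. {?z}) \<and> L' = (\<lambda>i. {?z})" for L L'
    unfolding flag_orbit_def using vs.qdim_refl[OF z] by (auto simp: fl quot_dim_eq)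
  show "\<exists>L L''. (L, L'') \<in> flag_orbit n K 0 ?Z" using orb by blast
  fix L L'' assume "(L, L'') \<in> flag_orbit n K 0 ?Z"
  then have "{L' \<in> flags n K 0. (L, L') \<in> flag_orbit n K 0 ?Z \<and> (L', L'') \<in> flag_orbit n K 0 ?Z} = {\<lambda>i. {?z}}"
    by (auto simp: orb fl)
  then show "poly 1 (int (card (carrier K))) =
      int (card {L' \<in> flags n K 0. (L, L') \<in> flag_orbit n K 0 ?Z \<and> (L', L'') \<in> flag_orbit n K 0 ?Z})" by simp
qed

lemma pbw_elt_0:
  assumes n: "n > 0" and lp: "linear_order_on (L_plus n) Rp" and lm: "linear_order_on (L_minus n) Rm"
  shows "pbw_elt n 0 Rp Rm (\<lambda>i j. 0) = basis_elt (\<lambda>i j. 0)"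
proof -
  let ?Z = "\<lambda>i j :: int. 0 :: nat" and ?S = "affine_schur n 0"
  have diag: "diag_mat (\<lambda>i. 0) = ?Z" by (intro ext) (simp add: diag_mat_def)
  have "aff_comps n 0 = {\<lambda>i. 0}"
  proof (intro equalityI subsetI)
    fix l assume "l \<in> aff_comps n 0"
    from diag_mat_Theta_r[OF this] have "diag_mat l = ?Z" using Theta_r_0[OF n] by simp
    then have "diag_mat l i i = 0" for i by simp
    then show "l \<in> {\<lambda>i. 0}" by (auto simp: diag_mat_def)
  qed (simp add: aff_comps_def)
  then have one: "\<one>\<^bsub>?S\<^esub> = basis_elt ?Z" by (simp add: affine_schur_def diag)
  have "{C \<in> Theta_r n 0. poly (struct_poly n 0 ?Z ?Z C) 1 \<noteq> 0} = {?Z}"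
    unfolding Theta_r_0[OF n] using struct_poly_0 by auto
  then have "basis_mult n 0 ?Z ?Z = basis_elt ?Z" unfolding basis_mult_def by (simp add: struct_poly_0)
  then have mult: "basis_elt ?Z \<otimes>\<^bsub>?S\<^esub> basis_elt ?Z = basis_elt ?Z" by (simp add: mult_affine_schur)
  have "E_prod n 0 I R ?Z = \<one>\<^bsub>?S\<^esub>" if "linear_order_on I R" for I R
    using ordered_list_props(1)[OF that, of "{}"] by (simp add: E_prod_def)
  moreover have "bsigma ?Z = (\<lambda>i. 0)" by (intro ext) (simp add: bsigma_def)
  ultimately show ?thesis unfolding pbw_elt_def using lp lm one mult diag by simp
qed

theorem corollary3p7:
  fixes n r :: nat and Rp Rm :: "((int \<times> int) \<times> (int \<times> int)) set"
  assumes "n \<ge> 2"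
    and "linear_order_on (L_plus n) Rp"
    and "linear_order_on (L_minus n) Rm"
  shows "inj_on (pbw_elt n r Rp Rm) (Theta_r n r) \<and>
    rat_vs.independent (pbw_elt n r Rp Rm ` Theta_r n r) \<and>
    rat_vs.span (pbw_elt n r Rp Rm ` Theta_r n r) = carrier (affine_schur n r)"
proof -
  have n: "n > 0" using assms(1) by simp
  have "inj_on (pbw_elt n r Rp Rm) (Theta_r n r) \<and>
    rat_vs.independent (pbw_elt n r Rp Rm ` Theta_r n r) \<and>
    rat_vs.span (pbw_elt n r Rp Rm ` Theta_r n r) = {x. Poly_Mapping.keys x \<subseteq> Theta_r n r}"
  \<comment> \<open>For \<open>r = 0\<close> there are no periodic maps at all, as
    \<open>g k = g k + n\<close> fails. The algebra is then one-dimensional and the single product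
    is computed directly.\<close>
  proof (cases "r = 0")
    case True
    show ?thesis
      by (rule triangular_basis[where deg = "zdeg n"])
        (simp_all add: True Theta_r_0[OF n] pbw_elt_0[OF n assms(2,3)])
  next
    case False
    then have r: "r > 0" by simp
    show ?thesis
      by (rule triangular_basis[where deg = "zdeg n"])
        (use pbw_leading[OF n r _ assms(2,3)] in blast)+
  qed
  then show ?thesis by (simp add: affine_schur_def)
qed

end
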